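(* Let $f(x)=|x-\xi|^{\alpha}g(x)$ be the model function on $\Omega=[-1,1]$ described in the context, with some $\alpha>1$, and let $f_n$ be its Chebyshev projection of degree $n$. As $n\to\infty$, the following pointwise error estimates hold (for each fixed $x\in\Omega$). (i) If $\xi\in(-1,1)$, then $$|f'(x)-f_n'(x)|=\begin{cases}O(n^{-\alpha}), & x\in(-1,1),\\ O(n^{1-\alpha}), & x=\pm1.\end{cases}$$ (ii) If $\xi=\pm1$, then $$|f'(x)-f_n'(x)|=\begin{cases}O(n^{-2\alpha}), & x\in(-1,1),\\ O(n^{1-2\alpha}), & x=-\xi,\\ O(n^{2-2\alpha}), & x=\xi.\end{cases}$$
   Context: Let $\Omega=[-1,1]$. The model function is $f(x)=|x-\xi|^{\alpha}g(x)$, where $\xi\in\Omega$; $\alpha>0$ is not an even integer if $\xi\in(-1,1)$ and is not an integer if $\xi=\pm1$; and $g\in C^{\infty}(\Omega)$ with $g(\xi)\neq0$. With $T_k(x)=\cos(k\arccos x)$ and Chebyshev coefficients $a_k=\frac{2}{\pi}\int_{-1}^{1}\frac{f(x)T_k(x)}{\sqrt{1-x^2}}\,dx$, the Chebyshev projection of degree $n$ of $f$ is $f_n(x)=\frac{a_0}{2}+\sum_{k=1}^{n}a_kT_k(x)$. The estimates are pointwise: the implied constants may depend on $x$ (and on $f$) but not on $n$. Derivatives at $x=\pm1$ are one-sided. *)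

theory Defs
  imports "HOL-Analysis.Analysis" "HOL-Library.Landau_Symbols"
begin

abbreviation Omega :: "real set" where
  "Omega \<equiv> {-1..1}"

text \<open>Smoothness on a set; at boundary points the derivatives are one-sided.\<close>

definition smooth_on :: "real set \<Rightarrow> (real \<Rightarrow> real) \<Rightarrow> bool" where
  "smooth_on S g \<longleftrightarrow>
     (\<exists>D :: nat \<Rightarrow> real \<Rightarrow> real.
        (\<forall>x\<in>S. D 0 x = g x) \<and>
        (\<forall>k. \<forall>x\<in>S. (D k has_real_derivative D (Suc k) x) (at x within S)))"

text \<open>Functions on \<open>Omega\<close> are represented by total functions, whose values
  outside \<open>Omega\<close> are irrelevant.\<close>

definition model_function ::
    "real \<Rightarrow> real \<Rightarrow> (real \<Rightarrow> real) \<Rightarrow> (real \<Rightarrow> real) \<Rightarrow> bool" where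
  "model_function \<xi> \<alpha> g f \<longleftrightarrow>
     \<xi> \<in> Omega \<and> \<alpha> > 0 \<and>
     (\<xi> \<in> {-1<..<1} \<longrightarrow> \<not> (\<exists>m::int. even m \<and> \<alpha> = of_int m)) \<and>
     (\<xi> \<in> {-1, 1} \<longrightarrow> \<alpha> \<notin> \<int>) \<and>
     smooth_on Omega g \<and> g \<xi> \<noteq> 0 \<and>
     (\<forall>x\<in>Omega. f x = \<bar>x - \<xi>\<bar> powr \<alpha> * g x)"

definition cheb_T :: "nat \<Rightarrow> real \<Rightarrow> real" where
  "cheb_T k x = cos (real k * arccos x)"

definition cheb_coeff :: "(real \<Rightarrow> real) \<Rightarrow> nat \<Rightarrow> real" where
  "cheb_coeff f k =
     2 / pi * integral Omega (\<lambda>x. f x * cheb_T k x / sqrt (1 - x\<^sup>2))"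

definition cheb_proj :: "(real \<Rightarrow> real) \<Rightarrow> nat \<Rightarrow> real \<Rightarrow> real" where
  "cheb_proj f n x = cheb_coeff f 0 / 2 + (\<Sum>k=1..n. cheb_coeff f k * cheb_T k x)"

text \<open>The derivative of a function on \<open>Omega\<close>, one-sided at the endpoints. The restriction to
  \<open>Omega\<close> is essential also for \<open>cheb_T\<close>, as \<open>arccos\<close> is unspecified outside \<open>Omega\<close>.\<close>

definition deriv_Omega :: "(real \<Rightarrow> real) \<Rightarrow> real \<Rightarrow> real" where
  "deriv_Omega h x = vector_derivative h (at x within Omega)"

definition deriv_error :: "(real \<Rightarrow> real) \<Rightarrow> real \<Rightarrow> nat \<Rightarrow> real" where
  "deriv_error f x n = \<bar>deriv_Omega f x - deriv_Omega (cheb_proj f n) x\<bar>"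

end

(*
  In the variable x = cos t the model function is a product of powers |sin ((t - s) / 2)|^a with smooth
  functions. The Fourier coefficients b_k of |sin (t / 2)|^a are explicit: they are O(k^(-a-1)) and their
  differences are O(k^(-a-2)). Convolving such sequences shows that the Chebyshev coefficients of f are
  C b_k cos (k s) + O(k^(-a-2)), where cos s is the singularity; if the singularity is an endpoint, the two
  factors merge and a = 2 alpha. The error of the differentiated projection is the tail of the differentiated
  Chebyshev series. At interior points the leading part of the tail is summed by parts against bounded sums
  of sines. At an endpoint other than the singularity one passes to (x - cos s) f, whose coefficients are
  one order smaller. At an endpoint singularity the tail is estimated absolutely.
*)

theory Submission
  imports Defs
begin


text \<open>Bounds on the size of the coefficients are not enough. If they are only known to be
  O(k^(-a-1)), an absolute estimate of the differentiated tail at an interior point gives n^(1-a),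
  one power short. The missing power comes from cancellation, so the coefficients are needed with
  their phase cos (k s) and with an amplitude whose differences gain a power. Hence amplitude and
  phase are carried separately, by \<open>regular\<close> and \<open>twist\<close>. On the circle
  |cos t - cos s|^a = 2^a |sin ((t - s) / 2)|^a |sin ((t + s) / 2)|^a has two singular points.
  Convolution treats both at once, without localisation: to leading order each factor keeps its own
  coefficients, multiplied by the value of the other factor at its singular point. The smooth
  factor, being even and smooth in t, has rapidly decreasing coefficients and merely rescales the
  two contributions. The assumption \<alpha> > 1 makes the decay exponent a + 1 of the coefficients
  exceed 2, so that their first moments are summable. This is what the convolution estimate and the
  termwise differentiation at interior points rest on.\<close>

section \<open>Convolution of sequences indexed by the integers\<close>

text \<open>The summand 1 keeps negative powers meaningful at \<open>k = 0\<close>, where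
  \<open>0 powr q = 0\<close> would turn a bound into the claim that the entry vanishes.\<close>

definition wt :: "int \<Rightarrow> real" where "wt k = 1 + \<bar>real_of_int k\<bar>"

lemma wt_ge_1: "1 \<le> wt k" and wt_pos: "0 < wt k" and wt_minus [simp]: "wt (- k) = wt k"
  by (auto simp: wt_def)

lemma wt_add: "wt (j + k) \<le> wt j + wt k"
  by (auto simp: wt_def)

lemma int_UNIV_split:
  "UNIV = {0::int} \<union> (range (\<lambda>n. int n + 1) \<union> range (\<lambda>n. - (int n + 1)))"
proof -
  have "k \<in> {0::int} \<union> (range (\<lambda>n. int n + 1) \<union> range (\<lambda>n. - (int n + 1)))" for k :: int
  proof (cases k "0::int" rule: linorder_cases)
    case less
    then have "k = - (int (nat (- k - 1)) + 1)" by simp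
    then show ?thesis by blast
  next
    case greater
    then have "k = int (nat (k - 1)) + 1" by simp
    then show ?thesis by blast
  qed simp
  then show ?thesis by blast
qed

lemma has_sum_int:
  fixes x :: "int \<Rightarrow> 'a::real_normed_vector"
  assumes "((\<lambda>n. x (int n + 1)) has_sum a) UNIV" "((\<lambda>n. x (- (int n + 1))) has_sum b) UNIV"
  shows "(x has_sum (x 0 + (a + b))) UNIV"
proof -
  have "(x has_sum a) (range (\<lambda>n. int n + 1))"
    using assms(1) by (subst has_sum_reindex) (auto simp: inj_on_def o_def)
  moreover have "(x has_sum b) (range (\<lambda>n. - (int n + 1)))"
    using assms(2) by (subst has_sum_reindex) (auto simp: inj_on_def o_def)
  ultimately have "(x has_sum (a + b)) (range (\<lambda>n. int n + 1) \<union> range (\<lambda>n. - (int n + 1)))"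
    by (rule has_sum_Un_disjoint) auto
  moreover have "(x has_sum x 0) {0}"
    using has_sum_finite[of "{0}" x] by simp
  ultimately show ?thesis
    using has_sum_Un_disjoint[of x "{0}" "x 0"] unfolding int_UNIV_split by fastforce
qed

text \<open>Passage from unordered sums, which allow free reindexing, to ordinary series in which
  \<open>k\<close> and \<open>- k\<close> are paired, as cosine series require.\<close>

lemma infsum_int_sums:
  fixes x :: "int \<Rightarrow> 'a::banach"
  assumes "x summable_on UNIV"
  shows "(\<lambda>n. x (int n + 1) + x (- (int n + 1))) sums (infsum x UNIV - x 0)"
proof -
  have "x summable_on range (\<lambda>n. int n + 1)" "x summable_on range (\<lambda>n. - (int n + 1))"
    using assms summable_on_subset_banach by blast+
  then have s: "(\<lambda>n. x (int n + 1)) summable_on UNIV" "(\<lambda>n. x (- (int n + 1))) summable_on UNIV"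
    by (subst (asm) summable_on_reindex; auto simp: inj_on_def o_def)+
  then have h: "((\<lambda>n. x (int n + 1)) has_sum (infsum (\<lambda>n. x (int n + 1)) UNIV)) UNIV"
     "((\<lambda>n. x (- (int n + 1))) has_sum (infsum (\<lambda>n. x (- (int n + 1))) UNIV)) UNIV"
    by auto
  have "infsum x UNIV - x 0 = infsum (\<lambda>n. x (int n + 1)) UNIV + infsum (\<lambda>n. x (- (int n + 1))) UNIV"
    using infsumI[OF has_sum_int[OF h]] by simp
  then show ?thesis
    using sums_add[OF h[THEN has_sum_imp_sums]] by simp
qed

lemma summable_on_wt_powr:
  assumes "p > 1"
  shows "(\<lambda>k. wt k powr (- p)) summable_on UNIV"
proof -
  have "summable (\<lambda>n. real n powr (- p))"
    using assms by (simp add: summable_real_powr_iff)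
  then have "summable (\<lambda>n. real (n + 2) powr (- p))"
    by (subst summable_iff_shift)
  then have "summable (\<lambda>n. (2 + real n) powr (- p))"
    by (simp add: algebra_simps)
  then have "(\<lambda>n. (2 + real n) powr (- p)) summable_on UNIV"
    by (subst summable_on_UNIV_nonneg_real_iff) auto
  then have "(\<lambda>n. wt (int n + 1) powr (- p)) summable_on UNIV"
    by (simp add: wt_def add.commute)
  moreover from this have "(\<lambda>n. wt (- (int n + 1)) powr (- p)) summable_on UNIV"
    by (simp only: wt_minus)
  ultimately show ?thesis
    using has_sum_int[of "\<lambda>k. wt k powr (- p)"] unfolding summable_on_def by blast
qed

lemma abs_summable_wt:
  fixes x :: "int \<Rightarrow> 'a::banach"
  assumes "p > 1" "\<And>k. norm (x k) \<le> C * wt k powr (- p)"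
  shows "(\<lambda>k. norm (x k)) summable_on UNIV"
  by (rule Infinite_Sum.abs_summable_on_comparison_test'
        [OF summable_on_cmult_right[OF summable_on_wt_powr[OF assms(1)]] assms(2)])

section \<open>Products of absolutely convergent Fourier series\<close>

definition convolution :: "(int \<Rightarrow> complex) \<Rightarrow> (int \<Rightarrow> complex) \<Rightarrow> int \<Rightarrow> complex" where
  "convolution x y k = (\<Sum>\<^sub>\<infinity>j. x (k - j) * y j)"

definition fourier :: "(int \<Rightarrow> complex) \<Rightarrow> real \<Rightarrow> complex" where
  "fourier x t = (\<Sum>\<^sub>\<infinity>k. x k * cis (of_int k * t))"

lemma bij_shear: "bij_betw (\<lambda>(k, j). (k - j, j :: int)) UNIV UNIV"
  by (rule bij_betw_byWitness[where f' = "\<lambda>(i, j). (i + j, j)"]) auto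

lemma abs_summable_times:
  fixes x y :: "int \<Rightarrow> complex"
  assumes "(\<lambda>k. norm (x k)) summable_on UNIV" "(\<lambda>k. norm (y k)) summable_on UNIV"
  shows "(\<lambda>p. norm (x (fst p) * y (snd p))) summable_on UNIV"
proof -
  have "(\<lambda>j. norm (x i * y j)) summable_on UNIV" for i
    unfolding norm_mult by (rule summable_on_cmult_right[OF assms(2)])
  moreover have "(\<lambda>i. norm (\<Sum>\<^sub>\<infinity>j. norm (x i * y j))) summable_on UNIV"
    using assms(1) unfolding norm_mult infsum_cmult_right'
    by (simp add: abs_mult infsum_nonneg summable_on_cmult_left)
  ultimately have "(\<lambda>p. norm (x (fst p) * y (snd p))) summable_on (UNIV \<times> UNIV)"
    unfolding Infinite_Sum.abs_summable_on_Sigma_iff by simp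
  then show ?thesis by simp
qed

lemma abs_summable_shear:
  fixes x y :: "int \<Rightarrow> complex"
  assumes "(\<lambda>k. norm (x k)) summable_on UNIV" "(\<lambda>k. norm (y k)) summable_on UNIV"
  shows "(\<lambda>p. norm (x (fst p - snd p) * y (snd p))) summable_on UNIV"
  using abs_summable_times[OF assms]
    summable_on_reindex_bij_betw[OF bij_shear, of "\<lambda>p. norm (x (fst p) * y (snd p))"]
  by (simp add: case_prod_beta)

lemma abs_summable_convolution_terms:
  fixes x y :: "int \<Rightarrow> complex"
  assumes "(\<lambda>k. norm (x k)) summable_on UNIV" "(\<lambda>k. norm (y k)) summable_on UNIV"
  shows "(\<lambda>j. norm (x (k - j) * y j)) summable_on UNIV"
proof -
  have "(\<lambda>p. norm (x (fst p - snd p) * y (snd p))) summable_on (UNIV \<times> UNIV)"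
    using abs_summable_shear[OF assms] by simp
  from this[unfolded Infinite_Sum.abs_summable_on_Sigma_iff] show ?thesis by auto
qed

lemma fourier_terms_summable:
  assumes "(\<lambda>k. norm (x k)) summable_on UNIV"
  shows "(\<lambda>k. norm (x k * cis (of_int k * t))) summable_on UNIV"
  using assms by (simp add: norm_mult)

text \<open>The double family is absolutely summable, so the shear \<open>(k, j)\<close> to
  \<open>(k - j, j)\<close> may be applied before the sums are iterated again; the exponentials then
  combine to one that depends on \<open>k\<close> alone.\<close>

lemma fourier_mult:
  assumes "(\<lambda>k. norm (x k)) summable_on UNIV" "(\<lambda>k. norm (y k)) summable_on UNIV"
  shows "fourier x t * fourier y t = fourier (convolution x y) t"
proof -
  let ?x = "\<lambda>k. x k * cis (of_int k * t)" and ?y = "\<lambda>k. y k * cis (of_int k * t)"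
  have sx: "(\<lambda>k. norm (?x k)) summable_on UNIV" and sy: "(\<lambda>k. norm (?y k)) summable_on UNIV"
    using assms by (auto intro: fourier_terms_summable)
  have s1: "(\<lambda>(i, j). ?x i * ?y j) summable_on (UNIV \<times> UNIV)"
    using abs_summable_summable[OF abs_summable_times[OF sx sy]] by (simp add: case_prod_unfold)
  have s2: "(\<lambda>(k, j). ?x (k - j) * ?y j) summable_on (UNIV \<times> UNIV)"
    using abs_summable_summable[OF abs_summable_shear[OF sx sy]] by (simp add: case_prod_unfold)
  have "fourier x t * fourier y t = (\<Sum>\<^sub>\<infinity>i. \<Sum>\<^sub>\<infinity>j. ?x i * ?y j)"
    unfolding fourier_def infsum_cmult_right' infsum_cmult_left' by (rule refl)
  also have "\<dots> = infsum (\<lambda>(i, j). ?x i * ?y j) (UNIV \<times> UNIV)"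
    using infsum_Sigma_banach[OF s1] by simp
  also have "\<dots> = infsum (\<lambda>(k, j). ?x (k - j) * ?y j) (UNIV \<times> UNIV)"
    using infsum_reindex_bij_betw[OF bij_shear, of "\<lambda>(i, j). ?x i * ?y j"] by (simp add: case_prod_unfold)
  also have "\<dots> = (\<Sum>\<^sub>\<infinity>k. \<Sum>\<^sub>\<infinity>j. ?x (k - j) * ?y j)"
    using infsum_Sigma_banach[OF s2] by simp
  also have "\<dots> = (\<Sum>\<^sub>\<infinity>k. \<Sum>\<^sub>\<infinity>j. (x (k - j) * y j) * cis (of_int k * t))"
  proof -
    have "cis (of_int (k - j) * t) * cis (of_int j * t) = cis (of_int k * t)" for k j
      by (simp add: cis_mult algebra_simps)
    then have "?x (k - j) * ?y j = (x (k - j) * y j) * cis (of_int k * t)" for k j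
      by (metis (no_types, opaque_lifting) mult.assoc mult.left_commute)
    then show ?thesis by presburger
  qed
  also have "\<dots> = fourier (convolution x y) t"
    unfolding fourier_def convolution_def infsum_cmult_left' by (rule refl)
  finally show ?thesis .
qed

lemma convolution_add_left:
  assumes "(\<lambda>k. norm (x k)) summable_on UNIV" "(\<lambda>k. norm (x' k)) summable_on UNIV"
    "(\<lambda>k. norm (y k)) summable_on UNIV"
  shows "convolution (\<lambda>k. x k + x' k) y k = convolution x y k + convolution x' y k"
  unfolding convolution_def ring_distribs
  by (rule infsum_add; rule abs_summable_summable, rule abs_summable_convolution_terms; rule assms)

lemma convolution_cmult_left: "convolution (\<lambda>k. c * x k) y k = c * convolution x y k"
  unfolding convolution_def mult.assoc infsum_cmult_right' by (rule refl)

text \<open>One of \<open>j\<close> and \<open>k - j\<close> has at least half the weight of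
  \<open>k\<close>. Its factor supplies the decay in \<open>k\<close>, and the other factor stays
  behind to be summed over \<open>j\<close>.\<close>

lemma wt_powr_mult_le:
  assumes "0 < q" "q \<le> p"
  shows "wt (k - j) powr (- p) * wt j powr (- q)
           \<le> 2 powr q * wt k powr (- q) * (wt (k - j) powr (- p) + wt j powr (- q))"
proof -
  have *: "1 \<le> 2 powr q * wt k powr (- q) * (wt j powr q + wt (k - j) powr q)"
  proof -
    have "wt k \<le> 2 * max (wt j) (wt (k - j))"
      using wt_add[of j "k - j"] by simp
    then have "wt k powr q \<le> (2 * max (wt j) (wt (k - j))) powr q"
      using assms wt_pos[of k] by (intro powr_mono2) auto
    also have "\<dots> = 2 powr q * max (wt j) (wt (k - j)) powr q"
      using wt_pos by (subst powr_mult) (auto simp: le_max_iff_disj less_imp_le)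
    also have "\<dots> \<le> 2 powr q * (wt j powr q + wt (k - j) powr q)"
      by (auto simp: max_def)
    finally show ?thesis
      using wt_pos[of k] by (simp add: powr_minus field_simps)
  qed
  have "wt (k - j) powr (- p) * wt j powr (- q) * 1
     \<le> wt (k - j) powr (- p) * wt j powr (- q) * (2 powr q * wt k powr (- q) * (wt j powr q + wt (k - j) powr q))"
    using * by (intro mult_left_mono) auto
  also have "\<dots> = 2 powr q * wt k powr (- q) * (wt (k - j) powr (- p) * (wt j powr (- q) * wt j powr q)
       + (wt (k - j) powr (- p) * wt (k - j) powr q) * wt j powr (- q))"
    by (simp add: algebra_simps)
  also have "wt j powr (- q) * wt j powr q = 1"
    using wt_pos[of j] by (simp flip: powr_add)
  also have "wt (k - j) powr (- p) * wt (k - j) powr q = wt (k - j) powr (q - p)"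
    by (simp flip: powr_add)
  also have "2 powr q * wt k powr (- q) * (wt (k - j) powr (- p) * 1 + wt (k - j) powr (q - p) * wt j powr (- q))
     \<le> 2 powr q * wt k powr (- q) * (wt (k - j) powr (- p) * 1 + 1 * wt j powr (- q))"
  proof -
    have "wt (k - j) powr (q - p) \<le> wt (k - j) powr 0"
      using assms wt_ge_1 by (intro powr_mono) auto
    then have "wt (k - j) powr (q - p) \<le> 1" using wt_pos[of "k - j"] by simp
    then show ?thesis
      by (intro mult_left_mono add_left_mono mult_right_mono) auto
  qed
  finally show ?thesis by simp
qed

lemma bij_reflect: "bij_betw (\<lambda>j. k - j) UNIV (UNIV :: int set)"
  by (rule bij_betw_byWitness[where f' = "\<lambda>j. k - j"]) auto

lemma wt_shift_sum:
  assumes "p > 1"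
  shows "(\<lambda>j. wt (k - j) powr (- p)) summable_on UNIV"
    and "(\<Sum>\<^sub>\<infinity>j. wt (k - j) powr (- p)) = (\<Sum>\<^sub>\<infinity>j. wt j powr (- p))"
  using summable_on_reindex_bij_betw[OF bij_reflect, of "\<lambda>j. wt j powr (- p)" k] summable_on_wt_powr[OF assms]
    infsum_reindex_bij_betw[OF bij_reflect, of "\<lambda>j. wt j powr (- p)" k]
  by auto

text \<open>The bound is uniform in \<open>k\<close>, because a reflected translate of a summable
  family over the integers has the same sum.\<close>

lemma norm_infsum_le_wt:
  fixes F :: "int \<Rightarrow> complex"
  assumes "p > 1" "q > 1" "D \<ge> 0"
    and "\<And>j. norm (F j) \<le> D * (wt (k - j) powr (- p) + wt j powr (- q))"
  shows "norm (infsum F UNIV) \<le> D * ((\<Sum>\<^sub>\<infinity>j. wt j powr (- p)) + (\<Sum>\<^sub>\<infinity>j. wt j powr (- q)))"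
proof -
  let ?W = "\<lambda>j. D * (wt (k - j) powr (- p) + wt j powr (- q))"
  have sW: "(\<lambda>j. wt (k - j) powr (- p) + wt j powr (- q)) summable_on UNIV"
    using assms by (intro summable_on_add wt_shift_sum summable_on_wt_powr)
  then have s: "?W summable_on UNIV" by (rule summable_on_cmult_right)
  then have sF: "(\<lambda>j. norm (F j)) summable_on UNIV"
    by (rule Infinite_Sum.abs_summable_on_comparison_test') (rule assms)
  have "norm (infsum F UNIV) \<le> (\<Sum>\<^sub>\<infinity>j. norm (F j))"
    by (rule norm_infsum_bound[OF sF])
  also have "\<dots> \<le> infsum ?W UNIV"
    by (rule infsum_mono[OF sF s]) (rule assms)
  also have "\<dots> = D * ((\<Sum>\<^sub>\<infinity>j. wt j powr (- p)) + (\<Sum>\<^sub>\<infinity>j. wt j powr (- q)))"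
    using assms
    by (simp add: infsum_cmult_right' infsum_add wt_shift_sum summable_on_wt_powr)
  finally show ?thesis .
qed

lemma convolution_bound:
  assumes "1 < q" "q \<le> p" "\<And>k. norm (x k) \<le> C * wt k powr (- p)" "\<And>k. norm (y k) \<le> D * wt k powr (- q)"
  shows "\<exists>E. \<forall>k. norm (convolution x y k) \<le> E * wt k powr (- q)"
proof -
  have C: "0 \<le> C" and D: "0 \<le> D"
    using order_trans[OF norm_ge_zero assms(3)[of 0]] order_trans[OF norm_ge_zero assms(4)[of 0]]
    by (auto simp: wt_def)
  let ?S = "(\<Sum>\<^sub>\<infinity>j. wt j powr (- p)) + (\<Sum>\<^sub>\<infinity>j. wt j powr (- q))"
  have "norm (convolution x y k) \<le> C * D * (2 powr q * wt k powr (- q)) * ?S" for k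
    unfolding convolution_def
  proof (rule norm_infsum_le_wt)
    fix j
    have "norm (x (k - j) * y j) \<le> (C * wt (k - j) powr (- p)) * (D * wt j powr (- q))"
      unfolding norm_mult using assms C by (intro mult_mono) auto
    also have "\<dots> = C * D * (wt (k - j) powr (- p) * wt j powr (- q))" by simp
    also have "\<dots> \<le> C * D * (2 powr q * wt k powr (- q) * (wt (k - j) powr (- p) + wt j powr (- q)))"
      using C D assms by (intro mult_left_mono wt_powr_mult_le) auto
    finally show "norm (x (k - j) * y j) \<le> C * D * (2 powr q * wt k powr (- q)) * (wt (k - j) powr (- p) + wt j powr (- q))"
      by (simp add: mult_ac)
  qed (use assms C D in auto)
  then show ?thesis
    by (intro exI[of _ "C * D * 2 powr q * ?S"]) (simp add: mult_ac)
qed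

text \<open>An amplitude of order \<open>- p\<close> whose increments are of order
  \<open>- p - 1\<close>. The condition \<open>wt k \<le> 2 * wt m\<close> keeps \<open>m\<close>
  from lying near the origin while \<open>k\<close> is large, where no such increment bound could
  hold.\<close>

definition regular :: "real \<Rightarrow> real \<Rightarrow> (int \<Rightarrow> complex) \<Rightarrow> bool" where
  "regular C p \<beta> \<longleftrightarrow> 0 \<le> C \<and> (\<forall>k. norm (\<beta> k) \<le> C * wt k powr (- p)) \<and>
     (\<forall>k m. wt k \<le> 2 * wt m \<longrightarrow> norm (\<beta> m - \<beta> k) \<le> C * wt (m - k) * wt k powr (- p - 1))"

text \<open>The phase that translates the Fourier series by \<phi>. A twisted amplitude oscillates,
  so it need not have small increments itself.\<close>

definition twist :: "real \<Rightarrow> (int \<Rightarrow> complex) \<Rightarrow> int \<Rightarrow> complex" where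
  "twist \<phi> \<beta> k = \<beta> k * cis (of_int k * \<phi>)"

lemma norm_twist [simp]: "norm (twist \<phi> \<beta> k) = norm (\<beta> k)"
  by (simp add: twist_def norm_mult)

lemma wt_powr_half:
  assumes "wt k \<le> 2 * wt m" "0 \<le> q"
  shows "wt m powr (- q) \<le> 2 powr q * wt k powr (- q)"
proof -
  have "wt k powr q \<le> (2 * wt m) powr q"
    using assms wt_pos[of k] by (intro powr_mono2) auto
  then have "wt k powr q \<le> 2 powr q * wt m powr q"
    using wt_pos[of m] by (simp add: powr_mult)
  then show ?thesis
    using wt_pos[of m] wt_pos[of k] by (simp add: powr_minus field_simps)
qed

text \<open>Here \<open>k - j\<close> is comparable with \<open>k\<close>. Replacing \<beta> at
  \<open>k - j\<close> by \<beta> at \<open>k\<close> costs a factor \<open>wt j\<close>, paid for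
  by the decay of \<eta>. The last product is small by itself, since one power of
  \<open>wt (k - j)\<close> can be traded for one of \<open>wt k\<close>.\<close>

lemma regular_bracket_bound:
  assumes C: "regular C p \<beta>" and D: "regular D p \<eta>" and p: "p > 2" and "wt k \<le> 2 * wt (k - j)"
  shows "norm (\<beta> (k - j) * \<eta> j - \<beta> k * \<eta> j - \<eta> k * \<beta> (k - j))
     \<le> 2 * C * D * wt k powr (- p - 1) * (wt (k - j) powr (1 - p) + wt j powr (1 - p))"
proof -
  have C0: "0 \<le> C" "0 \<le> D" using C D by (auto simp: regular_def)
  have a: "wt j * wt j powr (- p) = wt j powr (1 - p)"
    using wt_pos[of j] by (subst powr_mult_base) auto
  have "norm ((\<beta> (k - j) - \<beta> k) * \<eta> j) \<le> (C * wt j * wt k powr (- p - 1)) * (D * wt j powr (- p))"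
    unfolding norm_mult
  proof (rule mult_mono)
    have "norm (\<beta> (k - j) - \<beta> k) \<le> C * wt ((k - j) - k) * wt k powr (- p - 1)"
      using C assms(4) unfolding regular_def by blast
    also have "wt ((k - j) - k) = wt j"
      using wt_minus[of j] by simp
    finally show "norm (\<beta> (k - j) - \<beta> k) \<le> C * wt j * wt k powr (- p - 1)" .
    show "norm (\<eta> j) \<le> D * wt j powr (- p)" using D by (auto simp: regular_def)
  qed (use C0 wt_pos[of j] in auto)
  also have "\<dots> = C * D * wt k powr (- p - 1) * wt j powr (1 - p)"
    by (simp flip: a)
  finally have 1: "norm ((\<beta> (k - j) - \<beta> k) * \<eta> j) \<le> C * D * wt k powr (- p - 1) * wt j powr (1 - p)" .
  have "wt (k - j) powr (- p) = wt (k - j) powr (1 - p) * wt (k - j) powr (- 1)"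
    by (subst powr_add[symmetric]) simp
  also have "\<dots> \<le> wt (k - j) powr (1 - p) * (2 * wt k powr (- 1))"
    using wt_powr_half[OF assms(4), of 1] by (intro mult_left_mono) auto
  finally have b: "wt (k - j) powr (- p) \<le> 2 * wt (k - j) powr (1 - p) * wt k powr (- 1)"
    by (simp only: mult_ac)
  have "norm (\<eta> k * \<beta> (k - j)) \<le> (D * wt k powr (- p)) * (C * wt (k - j) powr (- p))"
    unfolding norm_mult using C D C0 by (intro mult_mono) (auto simp: regular_def)
  also have "\<dots> \<le> (D * wt k powr (- p)) * (C * (2 * wt (k - j) powr (1 - p) * wt k powr (- 1)))"
    using b C0 by (intro mult_left_mono) auto
  also have "\<dots> = 2 * C * D * (wt k powr (- p) * wt k powr (- 1)) * wt (k - j) powr (1 - p)"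
    by (simp add: mult_ac)
  also have "wt k powr (- p) * wt k powr (- 1) = wt k powr (- p - 1)"
    by (subst powr_add[symmetric]) simp
  finally have 2: "norm (\<eta> k * \<beta> (k - j)) \<le> 2 * C * D * wt k powr (- p - 1) * wt (k - j) powr (1 - p)" .
  have "norm (\<beta> (k - j) * \<eta> j - \<beta> k * \<eta> j - \<eta> k * \<beta> (k - j))
      = norm ((\<beta> (k - j) - \<beta> k) * \<eta> j - \<eta> k * \<beta> (k - j))"
    by (simp add: algebra_simps)
  also have "\<dots> \<le> norm ((\<beta> (k - j) - \<beta> k) * \<eta> j) + norm (\<eta> k * \<beta> (k - j))"
    by (rule norm_triangle_ineq4)
  also have "\<dots> \<le> C * D * wt k powr (- p - 1) * wt j powr (1 - p)
        + 2 * C * D * wt k powr (- p - 1) * wt (k - j) powr (1 - p)"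
    by (rule add_mono[OF 1 2])
  also have "\<dots> \<le> 2 * C * D * wt k powr (- p - 1) * wt j powr (1 - p)
        + 2 * C * D * wt k powr (- p - 1) * wt (k - j) powr (1 - p)"
    using C0 by (intro add_mono mult_right_mono) auto
  finally show ?thesis by (simp add: distrib_left add.commute)
qed

lemma regular_summable:
  assumes "regular C p \<beta>" "p > 1"
  shows "(\<lambda>k. norm (\<beta> k)) summable_on UNIV"
  by (rule abs_summable_wt[of p _ C]) (use assms in \<open>auto simp: regular_def\<close>)

text \<open>The sum defining the convolution concentrates at \<open>j\<close> near \<open>0\<close> and near \<open>k\<close>, where one factor is,
  up to its phase, nearly constant.\<close>

lemma convolution_regular:
  assumes C: "regular C p \<beta>" and D: "regular D p \<eta>" and p: "p > 2"
  shows "\<exists>c d E. \<forall>k. norm (convolution (twist \<phi> \<beta>) (twist \<psi> \<eta>) k - (c * twist \<phi> \<beta> k + d * twist \<psi> \<eta> k))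
           \<le> E * wt k powr (- p - 1)"
proof -
  define x y where "x = twist \<phi> \<beta>" and "y = twist \<psi> \<eta>"
  \<comment> \<open>The constants are the values of each Fourier series at the singular point of the
    other: \<open>c\<close> belongs to the \<eta> factor at \<open>- \<phi>\<close>, and
    \<open>d\<close> to the \<beta> factor at \<open>- \<psi>\<close>.\<close>
  define c where "c = (\<Sum>\<^sub>\<infinity>j. twist (\<psi> - \<phi>) \<eta> j)"
  define d where "d = (\<Sum>\<^sub>\<infinity>j. twist (\<phi> - \<psi>) \<beta> j)"
  have C0: "0 \<le> C" "0 \<le> D" using C D by (auto simp: regular_def)
  have s: "(\<lambda>k. norm (\<beta> k)) summable_on UNIV" "(\<lambda>k. norm (\<eta> k)) summable_on UNIV"
    using regular_summable C D p by fastforce+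
  \<comment> \<open>Both leading terms are subtracted under the sum. In the second the index of
    \<open>d\<close> is reflected, so that it meets the terms with \<open>j\<close> near
    \<open>k\<close>.\<close>
  define F where "F k j = x (k - j) * y j - (twist (\<psi> - \<phi>) \<eta> j * x k + twist (\<phi> - \<psi>) \<beta> (k - j) * y k)" for k j
  have F: "convolution x y k - (c * x k + d * y k) = infsum (F k) UNIV" for k
  proof -
    have 1: "(\<lambda>j. x (k - j) * y j) summable_on UNIV"
      by (rule abs_summable_summable, rule abs_summable_convolution_terms) (use s in \<open>auto simp: x_def y_def\<close>)
    have 2: "(\<lambda>j. twist (\<psi> - \<phi>) \<eta> j) summable_on UNIV"
      by (rule abs_summable_summable) (use s in auto)
    have 3: "(\<lambda>j. twist (\<phi> - \<psi>) \<beta> j) summable_on UNIV"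
      by (rule abs_summable_summable) (use s in auto)
    then have 4: "(\<lambda>j. twist (\<phi> - \<psi>) \<beta> (k - j)) summable_on UNIV"
      by (simp add: summable_on_reindex_bij_betw[OF bij_reflect])
    have d: "d = (\<Sum>\<^sub>\<infinity>j. twist (\<phi> - \<psi>) \<beta> (k - j))"
      unfolding d_def by (rule infsum_reindex_bij_betw[OF bij_reflect, symmetric])
    have "((\<lambda>j. twist (\<psi> - \<phi>) \<eta> j * x k + twist (\<phi> - \<psi>) \<beta> (k - j) * y k) has_sum (c * x k + d * y k)) UNIV"
      unfolding c_def d
      by (intro has_sum_add has_sum_cmult_left has_sum_infsum 2 4)
    moreover have "((\<lambda>j. x (k - j) * y j) has_sum convolution x y k) UNIV"
      unfolding convolution_def by (rule has_sum_infsum[OF 1])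
    ultimately show ?thesis
      unfolding F_def diff_conv_add_uminus
      by (intro infsumI[symmetric] has_sum_add) (simp_all only: has_sum_uminus minus_minus)
  qed
  have nF: "norm (F k j) \<le> 2 * C * D * wt k powr (- p - 1) * (wt (k - j) powr (1 - p) + wt j powr (1 - p))" for k j
  proof -
    \<comment> \<open>All three products carry the same phase; it factors out and leaves the bracket
      of amplitudes.\<close>
    have e: "cis (of_int (k - j) * \<phi>) * cis (of_int j * \<psi>) = cis (of_int (k - j) * \<phi> + of_int j * \<psi>)"
      "cis (of_int j * (\<psi> - \<phi>)) * cis (of_int k * \<phi>) = cis (of_int (k - j) * \<phi> + of_int j * \<psi>)"
      "cis (of_int (k - j) * (\<phi> - \<psi>)) * cis (of_int k * \<psi>) = cis (of_int (k - j) * \<phi> + of_int j * \<psi>)"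
      by (auto simp: cis_mult algebra_simps)
    have "F k j = cis (of_int (k - j) * \<phi> + of_int j * \<psi>) * (\<beta> (k - j) * \<eta> j - \<beta> k * \<eta> j - \<eta> k * \<beta> (k - j))"
    proof -
      have "x (k - j) * y j = cis (of_int (k - j) * \<phi> + of_int j * \<psi>) * (\<beta> (k - j) * \<eta> j)"
        unfolding x_def y_def twist_def e(1)[symmetric] by (simp only: mult_ac)
      moreover have "twist (\<psi> - \<phi>) \<eta> j * x k = cis (of_int (k - j) * \<phi> + of_int j * \<psi>) * (\<beta> k * \<eta> j)"
        unfolding x_def y_def twist_def e(2)[symmetric] by (simp only: mult_ac)
      moreover have "twist (\<phi> - \<psi>) \<beta> (k - j) * y k = cis (of_int (k - j) * \<phi> + of_int j * \<psi>) * (\<eta> k * \<beta> (k - j))"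
        unfolding x_def y_def twist_def e(3)[symmetric] by (simp only: mult_ac)
      ultimately show ?thesis by (simp add: F_def algebra_simps)
    qed
    then have n: "norm (F k j) = norm (\<beta> (k - j) * \<eta> j - \<beta> k * \<eta> j - \<eta> k * \<beta> (k - j))"
      by (simp add: norm_mult)
    \<comment> \<open>The bracket is symmetric under exchanging (\<beta>, \<open>k - j\<close>) with
      (\<eta>, \<open>j\<close>), so the second case is the first with the roles exchanged.\<close>
    consider "wt k \<le> 2 * wt (k - j)" | "wt k \<le> 2 * wt j"
      using wt_add[of j "k - j"] by fastforce
    then show ?thesis
    proof cases
      case 1
      from regular_bracket_bound[OF C D p this] show ?thesis by (simp add: n)
    next
      case 2
      then have "wt k \<le> 2 * wt (k - (k - j))" by simp
      from regular_bracket_bound[OF D C p this]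
      have "norm (\<eta> j * \<beta> (k - j) - \<eta> k * \<beta> (k - j) - \<beta> k * \<eta> j)
        \<le> 2 * D * C * wt k powr (- p - 1) * (wt j powr (1 - p) + wt (k - j) powr (1 - p))"
        by simp
      moreover have "\<eta> j * \<beta> (k - j) - \<eta> k * \<beta> (k - j) - \<beta> k * \<eta> j
         = \<beta> (k - j) * \<eta> j - \<beta> k * \<eta> j - \<eta> k * \<beta> (k - j)"
        by (simp add: algebra_simps)
      ultimately show ?thesis by (simp add: n mult_ac add_ac)
    qed
  qed
  let ?S = "(\<Sum>\<^sub>\<infinity>j. wt j powr (- (p - 1))) + (\<Sum>\<^sub>\<infinity>j. wt j powr (- (p - 1)))"
  have "norm (convolution x y k - (c * x k + d * y k)) \<le> 2 * C * D * wt k powr (- p - 1) * ?S" for k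
    unfolding F
    \<comment> \<open>This is where \<open>p > 2\<close> enters: the remaining exponent
      \<open>p - 1\<close> must still be summable.\<close>
    by (rule norm_infsum_le_wt) (use p C0 nF[of k] in auto)
  then show ?thesis
    unfolding x_def y_def
    by (intro exI[of _ c] exI[of _ d] exI[of _ "2 * C * D * ?S"]) (simp add: mult_ac)
qed

text \<open>The two-sided form of a cosine series: for \<open>n > 0\<close> the entry
  \<open>b n\<close> stands at \<open>n\<close> and at \<open>- n\<close>, so the cosine carries the
  coefficient \<open>2 * b n\<close>.\<close>

definition even_ext :: "(nat \<Rightarrow> real) \<Rightarrow> int \<Rightarrow> complex" where
  "even_ext b k = of_real (b (nat \<bar>k\<bar>))"

lemma nat_diff_bound:
  fixes b :: "nat \<Rightarrow> real"
  assumes "\<And>n. \<bar>b (Suc n) - b n\<bar> \<le> C * (1 + real n) powr (- q)" "0 \<le> C" "0 \<le> q" "m \<le> n"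
  shows "\<bar>b n - b m\<bar> \<le> C * real (n - m) * (1 + real m) powr (- q)"
  using \<open>m \<le> n\<close>
proof (induction n rule: dec_induct)
  case (step n)
  have "(1 + real n) powr (- q) \<le> (1 + real m) powr (- q)"
    using step assms by (intro powr_mono2') auto
  then have "\<bar>b (Suc n) - b n\<bar> \<le> C * (1 + real m) powr (- q)"
    using assms(1)[of n] assms(2) by (meson mult_left_mono order_trans)
  moreover have "real (Suc n - m) = real (n - m) + 1" using step by simp
  ultimately show ?case
    using step.IH by (simp add: algebra_simps)
qed simp

text \<open>Consecutive differences are telescoped between the two absolute values. The largest step
  bound occurs at the smaller index, and \<open>wt k \<le> 2 * wt m\<close> makes that index
  comparable with \<open>k\<close>.\<close>

lemma regular_even_ext:
  fixes b :: "nat \<Rightarrow> real"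
  assumes b: "\<And>n. \<bar>b n\<bar> \<le> C * (1 + real n) powr (- p)"
    and db: "\<And>n. \<bar>b (Suc n) - b n\<bar> \<le> C * (1 + real n) powr (- p - 1)" and p: "0 \<le> p"
  shows "\<exists>C'. regular C' p (even_ext b)"
proof -
  have C0: "0 \<le> C" using order_trans[OF abs_ge_zero b[of 0]] by simp
  have "norm (even_ext b m - even_ext b k) \<le> C * 2 powr (p + 1) * wt (m - k) * wt k powr (- p - 1)"
    if "wt k \<le> 2 * wt m" for k m
  proof -
    define m' k' l where "m' = nat \<bar>m\<bar>" and "k' = nat \<bar>k\<bar>" and "l = min m' k'"
    have "\<bar>b m' - b k'\<bar> \<le> C * \<bar>real m' - real k'\<bar> * (1 + real l) powr (- (p + 1))"
      using nat_diff_bound[of b C "p + 1" m' k'] nat_diff_bound[of b C "p + 1" k' m'] db C0 p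
      by (cases "m' \<le> k'") (auto simp: l_def min_def abs_minus_commute of_nat_diff)
    also have "\<dots> \<le> C * wt (m - k) * (2 powr (p + 1) * wt k powr (- (p + 1)))"
    proof (intro mult_mono)
      show "\<bar>real m' - real k'\<bar> \<le> wt (m - k)" by (auto simp: m'_def k'_def wt_def)
      have "wt (int l) powr (- (p + 1)) \<le> 2 powr (p + 1) * wt k powr (- (p + 1))"
      proof (rule wt_powr_half)
        show "wt k \<le> 2 * wt (int l)"
          using that by (auto simp: l_def wt_def min_def m'_def k'_def)
      qed (use p in auto)
      then show "(1 + real l) powr (- (p + 1)) \<le> 2 powr (p + 1) * wt k powr (- (p + 1))"
        by (simp add: wt_def)
    qed (use C0 wt_pos[of "m - k"] in auto)
    finally show ?thesis
      by (simp add: even_ext_def m'_def k'_def mult_ac norm_of_real flip: of_real_diff)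
  qed
  moreover have "norm (even_ext b k) \<le> C * 2 powr (p + 1) * wt k powr (- p)" for k
  proof -
    have "norm (even_ext b k) \<le> C * wt k powr (- p)"
      using b[of "nat \<bar>k\<bar>"] by (simp add: even_ext_def wt_def)
    also have "\<dots> \<le> (C * 2 powr (p + 1)) * wt k powr (- p)"
    proof -
      have "(1::real) \<le> 2 powr (p + 1)" using p by (simp add: ge_one_powr_ge_zero)
      then show ?thesis using C0 by (intro mult_right_mono) (auto simp: mult_le_cancel_left1)
    qed
    finally show ?thesis .
  qed
  ultimately show ?thesis
    unfolding regular_def using C0 by (intro exI[of _ "C * 2 powr (p + 1)"]) auto
qed

section \<open>The Fourier series of a power of the sine\<close>

lemma has_integral_cos_multiple:
  "((\<lambda>t. cos (of_int n * t)) has_integral (if n = 0 then pi else 0)) {0..pi}" for n :: int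
proof (cases "n = 0")
  case True
  then show ?thesis using has_integral_const_real[of "1::real" 0 pi] by simp
next
  case False
  have "((\<lambda>t. cos (of_int n * t)) has_integral (sin (of_int n * pi) / of_int n - sin (of_int n * 0) / of_int n)) {0..pi}"
    using False
    by (intro fundamental_theorem_of_calculus)
      (auto intro!: derivative_eq_intros simp: has_real_derivative_iff_has_vector_derivative [symmetric])
  moreover have "sin (of_int n * pi) = 0"
    by (simp add: sin_zero_iff_int2)
  ultimately show ?thesis using False by simp
qed

lemma has_integral_cos_cos:
  "((\<lambda>t. cos (real k * t) * cos (real m * t)) has_integral
     (if k = m then (if m = 0 then pi else pi / 2) else 0)) {0..pi}"
proof -
  have "((\<lambda>t. (1/2) * (cos (of_int (int k - int m) * t) + cos (of_int (int k + int m) * t))) has_integral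
     (1/2) * ((if int k - int m = 0 then pi else 0) + (if int k + int m = 0 then pi else 0))) {0..pi}"
    by (intro has_integral_mult_right has_integral_add has_integral_cos_multiple)
  moreover have "(1/2) * (cos (of_int (int k - int m) * t) + cos (of_int (int k + int m) * t))
      = cos (real k * t) * cos (real m * t)" for t
    by (simp add: left_diff_distrib distrib_right cos_add cos_diff)
  ultimately have "((\<lambda>t. cos (real k * t) * cos (real m * t)) has_integral
     (1/2) * ((if int k - int m = 0 then pi else 0) + (if int k + int m = 0 then pi else 0))) {0..pi}"
    by (simp only:)
  moreover have "(1/2) * ((if int k - int m = 0 then pi else 0) + (if int k + int m = 0 then pi else 0))
     = (if k = m then (if m = 0 then pi else pi / 2) else 0)"
    by auto
  ultimately show ?thesis by (simp only:)
qed

text \<open>By the M-test the convergence is uniform, so the limit is continuous and may be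
  integrated termwise; orthogonality then isolates one coefficient.\<close>

lemma cos_series:
  assumes sc: "summable (\<lambda>k. \<bar>c k\<bar>)" and F: "\<And>t. t \<in> {0..pi} \<Longrightarrow> (\<lambda>k. c k * cos (real k * t)) sums F t"
  shows cos_series_continuous: "continuous_on {0..pi} F"
    and cos_series_coeff: "integral {0..pi} (\<lambda>t. F t * cos (real m * t)) = (if m = 0 then pi else pi / 2) * c m"
proof -
  have u: "uniform_limit {0..pi} (\<lambda>n t. \<Sum>k<n. c k * cos (real k * t)) F sequentially"
  proof -
    have "uniform_limit {0..pi} (\<lambda>n t. \<Sum>k<n. c k * cos (real k * t)) (\<lambda>t. \<Sum>k. c k * cos (real k * t)) sequentially"
    proof (rule Weierstrass_m_test[OF _ sc])
      show "norm (c n * cos (real n * x)) \<le> \<bar>c n\<bar>" for n x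
        using abs_cos_le_one[of "real n * x"] by (simp add: abs_mult mult_left_le)
    qed
    then show ?thesis
      by (rule uniform_limit_cong'[THEN iffD1, rotated 2]) (use F in \<open>auto simp: sums_iff\<close>)
  qed
  show "continuous_on {0..pi} F"
    by (rule uniform_limit_theorem[OF _ u]) (auto intro!: always_eventually continuous_intros)
  have u2: "uniform_limit {0..pi} (\<lambda>n t. (\<Sum>k<n. c k * cos (real k * t)) * cos (real m * t)) (\<lambda>t. F t * cos (real m * t)) sequentially"
  proof (rule uniform_lim_mult[OF u])
    show "bounded (F ` {0..pi})"
      using \<open>continuous_on {0..pi} F\<close> by (simp add: compact_continuous_image compact_imp_bounded)
    show "bounded ((\<lambda>t. cos (real m * t)) ` {0..pi})"
      by (auto intro!: compact_imp_bounded compact_continuous_image continuous_intros)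
  qed (auto intro: uniform_limit_const)
  have "continuous_on {0..pi} (\<lambda>t. (\<Sum>k<n. c k * cos (real k * t)) * cos (real m * t))" for n
    by (intro continuous_intros)
  from uniform_limit_integral[OF u2 this sequentially_bot] obtain I J where IJ: "\<And>n. ((\<lambda>t. (\<Sum>k<n. c k * cos (real k * t)) * cos (real m * t)) has_integral I n) {0..pi}"
    "((\<lambda>t. F t * cos (real m * t)) has_integral J) {0..pi}" "I \<longlonglongrightarrow> J"
    by blast
  let ?v = "(if m = 0 then pi else pi / 2) * c m"
  have "I n = ?v" if "n > m" for n
  proof -
    have "((\<lambda>t. \<Sum>k<n. c k * (cos (real k * t) * cos (real m * t))) has_integral
        (\<Sum>k<n. c k * (if k = m then (if m = 0 then pi else pi / 2) else 0))) {0..pi}"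
      by (intro has_integral_sum has_integral_mult_right has_integral_cos_cos) auto
    moreover have "(\<Sum>k<n. c k * (if k = m then (if m = 0 then pi else pi / 2) else 0)) = ?v"
      using that by (simp add: if_distrib[of "\<lambda>x. _ * x"] cong: if_cong)
    ultimately have "((\<lambda>t. (\<Sum>k<n. c k * cos (real k * t)) * cos (real m * t)) has_integral ?v) {0..pi}"
      by (simp add: sum_distrib_right mult.assoc)
    then show ?thesis using IJ(1) has_integral_unique by blast
  qed
  then have "I \<longlonglongrightarrow> ?v"
    by (intro tendsto_eventually) (auto simp: eventually_sequentially intro!: exI[of _ "Suc m"])
  then have "J = ?v" using IJ(3) LIMSEQ_unique by blast
  then show "integral {0..pi} (\<lambda>t. F t * cos (real m * t)) = ?v"
    using IJ(2) by (simp add: integral_unique)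
qed

text \<open>Up to a constant factor these are the Fourier coefficients of \<open>\<bar>sin (t / 2)\<bar> powr g\<close>: the recurrence
  says that the series solves \<open>(1 - cos t) S' = (g / 2) sin t S\<close>.\<close>

primrec sinpow_coeff :: "real \<Rightarrow> nat \<Rightarrow> real" where
  "sinpow_coeff g 0 = 1"
| "sinpow_coeff g (Suc n) = (real n - g / 2) / (real n + 1 + g / 2) * sinpow_coeff g n"

text \<open>Weighted AM-GM applied to \<open>t powr p\<close> and 1 with weights
  \<open>1 / p\<close> and \<open>1 - 1 / p\<close>.\<close>

lemma Bernoulli_powr:
  assumes "1 \<le> p" "0 < (t::real)"
  shows "1 + p * (t - 1) \<le> t powr p"
proof -
  have "(t powr p) powr (1 / p) * 1 powr (1 - 1 / p) \<le> (1 / p) * (t powr p) + (1 - 1 / p) * 1"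
    using assms by (intro Youngs_inequality_0) auto
  then have "t \<le> (1 / p) * (t powr p) + (1 - 1 / p)"
    using assms by (simp add: powr_powr)
  then have "p * t \<le> p * ((1 / p) * (t powr p) + (1 - 1 / p))"
    using assms by (intro mult_left_mono) auto
  then show ?thesis using assms by (simp add: algebra_simps)
qed

lemma eventually_decreasing_bounded:
  fixes s :: "nat \<Rightarrow> real"
  assumes "\<And>n. n \<ge> N \<Longrightarrow> s (Suc n) \<le> s n"
  shows "\<exists>C. \<forall>n. s n \<le> C"
proof -
  have "s n \<le> Max (s ` {..N})" for n
  proof (induction n)
    case (Suc n)
    then show ?case
      using assms[of n] by (cases "Suc n \<le> N") (auto intro!: Max_ge)
  qed auto
  then show ?thesis by blast
qed

text \<open>With y = n + 1 + g/2 the ratio in the recurrence is 1 - (g + 1)/y, which Bernoulli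
  bounds by (1 - 1/y)^(g+1). Hence (n + g/2)^(g+1) times the absolute coefficient is eventually
  decreasing.\<close>

lemma sinpow_coeff_decay:
  assumes "g > 0"
  shows "\<exists>C. \<forall>n. \<bar>sinpow_coeff g n\<bar> \<le> C * (1 + real n) powr (- (g + 1))"
proof -
  define s where "s n = (real n + g / 2) powr (g + 1) * \<bar>sinpow_coeff g n\<bar>" for n
  have "s (Suc n) \<le> s n" if "n \<ge> nat \<lceil>g\<rceil>" for n
  proof -
    have n: "real n \<ge> g" "real n > g / 2" using that assms by linarith+
    define y where "y = real n + 1 + g / 2"
    have y: "y > 1" "y - 1 = real n + g / 2" using n assms by (auto simp: y_def)
    have "1 + (g + 1) * ((y - 1) / y - 1) \<le> ((y - 1) / y) powr (g + 1)"
      using y assms by (intro Bernoulli_powr) auto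
    also have "1 + (g + 1) * ((y - 1) / y - 1) = (real n - g / 2) / y"
      using y by (simp add: field_simps) (simp add: y_def algebra_simps)
    also have "((y - 1) / y) powr (g + 1) = (y - 1) powr (g + 1) / y powr (g + 1)"
      using y by (simp add: powr_divide)
    finally have "(real n - g / 2) / y \<le> (y - 1) powr (g + 1) / y powr (g + 1)" .
    then have *: "y powr (g + 1) * ((real n - g / 2) / y) \<le> (y - 1) powr (g + 1)"
    proof -
      assume *: "(real n - g / 2) / y \<le> (y - 1) powr (g + 1) / y powr (g + 1)"
      have "y powr (g + 1) * ((real n - g / 2) / y) \<le> y powr (g + 1) * ((y - 1) powr (g + 1) / y powr (g + 1))"
        by (rule mult_left_mono[OF *]) simp
      then show ?thesis using y by simp
    qed
    have "s (Suc n) = y powr (g + 1) * ((real n - g / 2) / y) * \<bar>sinpow_coeff g n\<bar>"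
      using n assms y by (simp add: s_def y_def abs_mult add_ac)
    also have "\<dots> \<le> (y - 1) powr (g + 1) * \<bar>sinpow_coeff g n\<bar>"
      by (rule mult_right_mono[OF *]) simp
    finally show ?thesis by (simp add: s_def y)
  qed
  then obtain C where C: "\<And>n. s n \<le> C"
    using eventually_decreasing_bounded by metis
  \<comment> \<open>The factor comparing \<open>n + g / 2\<close> with \<open>1 + n\<close>, needed
    because \<open>g / 2\<close> may be smaller than 1.\<close>
  define \<delta> where "\<delta> = min 1 (g / 2)"
  have \<delta>: "0 < \<delta>" using assms by (simp add: \<delta>_def)
  have "\<bar>sinpow_coeff g n\<bar> \<le> C * \<delta> powr (- (g + 1)) * (1 + real n) powr (- (g + 1))" for n
  proof -
    have le: "\<delta> * (1 + real n) \<le> real n + g / 2"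
    proof -
      have "\<delta> * real n \<le> 1 * real n" by (intro mult_right_mono) (auto simp: \<delta>_def)
      moreover have "\<delta> \<le> g / 2" by (simp add: \<delta>_def)
      ultimately show ?thesis by (simp add: algebra_simps)
    qed
    have "(real n + g / 2) powr (- (g + 1)) \<le> (\<delta> * (1 + real n)) powr (- (g + 1))"
      using \<delta> assms le by (intro powr_mono2') auto
    also have "\<dots> = \<delta> powr (- (g + 1)) * (1 + real n) powr (- (g + 1))"
      using \<delta> by (simp add: powr_mult)
    finally have "(real n + g / 2) powr (- (g + 1)) \<le> \<delta> powr (- (g + 1)) * (1 + real n) powr (- (g + 1))" .
    moreover have "\<bar>sinpow_coeff g n\<bar> \<le> C * (real n + g / 2) powr (- (g + 1))"
    proof -
      have "\<bar>sinpow_coeff g n\<bar> = s n * (real n + g / 2) powr (- (g + 1))"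
      proof -
        have "(real n + g / 2) powr (g + 1) * (real n + g / 2) powr (- (g + 1)) = 1"
          using assms by (subst powr_add[symmetric]) auto
        then show ?thesis unfolding s_def by (metis mult.assoc mult.commute mult.right_neutral)
      qed
      then show ?thesis using C[of n] by (simp add: mult_right_mono)
    qed
    moreover have "0 \<le> C" using C[of 0] by (simp add: s_def order_trans[rotated])
    ultimately show ?thesis
      by (smt (verit) mult.assoc mult_left_mono)
  qed
  then show ?thesis by blast
qed

text \<open>By the recurrence the difference is \<open>- (g + 1) / (n + 1 + g / 2)\<close> times the
  coefficient, which gains exactly one order.\<close>

lemma sinpow_coeff_decay_diff:
  assumes "g > 0"
  shows "\<exists>C. \<forall>n. \<bar>sinpow_coeff g n\<bar> \<le> C * (1 + real n) powr (- (g + 1))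
     \<and> \<bar>sinpow_coeff g (Suc n) - sinpow_coeff g n\<bar> \<le> C * (1 + real n) powr (- (g + 2))"
proof -
  obtain C where C: "\<And>n. \<bar>sinpow_coeff g n\<bar> \<le> C * (1 + real n) powr (- (g + 1))"
    using sinpow_coeff_decay[OF assms] by blast
  have C0: "0 \<le> C" using order_trans[OF abs_ge_zero C[of 0]] by simp
  have "\<bar>sinpow_coeff g (Suc n) - sinpow_coeff g n\<bar> \<le> ((g + 1) * C) * (1 + real n) powr (- (g + 2))" for n
  proof -
    have e: "- (g + 2) = - (g + 1) + - 1" by simp
    have "sinpow_coeff g (Suc n) - sinpow_coeff g n = - ((g + 1) / (real n + 1 + g / 2)) * sinpow_coeff g n"
      using assms by (simp add: field_simps)
    then have "\<bar>sinpow_coeff g (Suc n) - sinpow_coeff g n\<bar> = ((g + 1) / (real n + 1 + g / 2)) * \<bar>sinpow_coeff g n\<bar>"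
      using assms by (simp add: abs_mult)
    also have "\<dots> \<le> ((g + 1) / (1 + real n)) * (C * (1 + real n) powr (- (g + 1)))"
      using assms C[of n] by (intro mult_mono divide_left_mono) auto
    also have "\<dots> = ((g + 1) * C) * ((1 + real n) powr (- (g + 1)) * (1 + real n) powr (- 1))"
      by (simp add: powr_minus field_simps)
    finally show ?thesis unfolding e powr_add .
  qed
  moreover have "C * (1 + real n) powr (- (g + 1)) \<le> ((g + 1) * C) * (1 + real n) powr (- (g + 1))" for n
    using assms C0 by (intro mult_right_mono) (auto simp: mult_le_cancel_right1)
  ultimately show ?thesis
    using C by (meson order_trans)
qed

definition sinpow_series :: "real \<Rightarrow> real \<Rightarrow> real" where
  "sinpow_series g t = 1 + (\<Sum>n. 2 * sinpow_coeff g (Suc n) * cos (real (Suc n) * t))"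

lemma summable_shift_powr:
  assumes "p > 1"
  shows "summable (\<lambda>n. (1 + real n) powr (- p))"
proof -
  have "summable (\<lambda>n. real (Suc n) powr (- p))"
    by (subst summable_Suc_iff) (use assms in \<open>simp add: summable_real_powr_iff\<close>)
  then show ?thesis by (simp add: add.commute)
qed

lemma sinpow_coeff_summable:
  assumes "g > 1"
  shows "summable (\<lambda>n. real n * \<bar>sinpow_coeff g n\<bar>)" "summable (\<lambda>n. \<bar>sinpow_coeff g n\<bar>)" "(\<lambda>n. real n * sinpow_coeff g n) \<longlonglongrightarrow> 0"
proof -
  obtain C where C: "\<And>n. \<bar>sinpow_coeff g n\<bar> \<le> C * (1 + real n) powr (- (g + 1))"
    using sinpow_coeff_decay[of g] assms by auto
  have C0: "0 \<le> C" using order_trans[OF abs_ge_zero C[of 0]] by simp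
  show 1: "summable (\<lambda>n. real n * \<bar>sinpow_coeff g n\<bar>)"
  proof (rule summable_comparison_test'[where N = 0])
    show "summable (\<lambda>n. C * (1 + real n) powr (- g))"
      using assms by (intro summable_mult summable_shift_powr)
    fix n
    have "real n * \<bar>sinpow_coeff g n\<bar> \<le> (1 + real n) * (C * (1 + real n) powr (- (g + 1)))"
      using C by (intro mult_mono) auto
    also have "\<dots> = C * ((1 + real n) * (1 + real n) powr (- (g + 1)))" by simp
    also have "(1 + real n) * (1 + real n) powr (- (g + 1)) = (1 + real n) powr (- g)"
      by (subst powr_mult_base) auto
    finally show "norm (real n * \<bar>sinpow_coeff g n\<bar>) \<le> C * (1 + real n) powr (- g)" by simp
  qed
  show "summable (\<lambda>n. \<bar>sinpow_coeff g n\<bar>)"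
    by (rule summable_comparison_test'[where N = 1, OF 1]) (auto simp: mult_le_cancel_right1)
  have "(\<lambda>n. \<bar>real n * sinpow_coeff g n\<bar>) \<longlonglongrightarrow> 0"
    using summable_LIMSEQ_zero[OF 1] by (simp add: abs_mult)
  then show "(\<lambda>n. real n * sinpow_coeff g n) \<longlonglongrightarrow> 0"
    by (simp add: tendsto_rabs_zero_iff)
qed

text \<open>After the products are expanded, the recurrence cancels everything except a defect at
  the cut-off. The defect tends to 0 because \<open>n * sinpow_coeff g n\<close> does when
  \<open>g > 1\<close>.\<close>

lemma sinpow_partial_ode:
  assumes "g > 0"
  shows "(1 - cos t) * (\<Sum>n<N. - 2 * sinpow_coeff g (Suc n) * real (Suc n) * sin (real (Suc n) * t))
     - g / 2 * sin t * (1 + (\<Sum>n<N. 2 * sinpow_coeff g (Suc n) * cos (real (Suc n) * t)))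
   = (real N - g / 2) * sinpow_coeff g N * (sin (real (Suc N) * t) - sin (real N * t))"
proof (induction N)
  case 0
  then show ?case by simp
next
  case (Suc N)
  define s c where "s = sin (real (Suc N) * t)" and "c = cos (real (Suc N) * t)"
  have 1: "sin (real N * t) = s * cos t - c * sin t"
    using sin_diff[of "real (Suc N) * t" t] by (simp add: s_def c_def algebra_simps)
  have 2: "sin (real (Suc (Suc N)) * t) = s * cos t + c * sin t"
    using sin_add[of "real (Suc N) * t" t] by (simp add: s_def c_def algebra_simps)
  define b where "b = sinpow_coeff g (Suc N)"
  \<comment> \<open>The recurrence with its denominator cleared, which expresses the old defect
    through the new coefficient.\<close>
  have 3: "(real N - g / 2) * sinpow_coeff g N = (real N + 1 + g / 2) * b"
    using assms by (simp add: b_def)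
  have "(1 - cos t) * (\<Sum>n<Suc N. - 2 * sinpow_coeff g (Suc n) * real (Suc n) * sin (real (Suc n) * t))
     - g / 2 * sin t * (1 + (\<Sum>n<Suc N. 2 * sinpow_coeff g (Suc n) * cos (real (Suc n) * t)))
   = (real N + 1 + g / 2) * b * (s - (s * cos t - c * sin t))
     + (1 - cos t) * (- 2 * b * real (Suc N) * s) - g / 2 * sin t * (2 * b * c)"
    using Suc.IH unfolding 3 1 by (simp only: sum.lessThan_Suc b_def s_def c_def) (simp add: algebra_simps)
  also have "\<dots> = (real (Suc N) - g / 2) * b * ((s * cos t + c * sin t) - s)"
    by (simp add: field_simps)
  finally show ?case unfolding 2 s_def b_def .
qed

lemma sinpow_series_terms_bound:
  "\<bar>2 * sinpow_coeff g (Suc n) * cos (real (Suc n) * t)\<bar> \<le> 2 * \<bar>sinpow_coeff g (Suc n)\<bar>"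
  "\<bar>- 2 * sinpow_coeff g (Suc n) * real (Suc n) * sin (real (Suc n) * t)\<bar> \<le> 2 * (real (Suc n) * \<bar>sinpow_coeff g (Suc n)\<bar>)"
  using mult_left_le[OF abs_cos_le_one[of "real (Suc n) * t"], of "2 * \<bar>sinpow_coeff g (Suc n)\<bar>"]
    mult_left_le[OF abs_sin_le_one[of "real (Suc n) * t"], of "2 * (real (Suc n) * \<bar>sinpow_coeff g (Suc n)\<bar>)"]
  by (simp_all add: abs_mult mult_ac del: sinpow_coeff.simps of_nat_Suc)

lemma sinpow_series_sums:
  assumes "g > 1"
  shows "(\<lambda>n. 2 * sinpow_coeff g (Suc n) * cos (real (Suc n) * t)) sums (sinpow_series g t - 1)"
proof -
  have "summable (\<lambda>n. 2 * sinpow_coeff g (Suc n) * cos (real (Suc n) * t))"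
  proof (rule summable_comparison_test'[where N = 0])
    show "summable (\<lambda>n. 2 * \<bar>sinpow_coeff g (Suc n)\<bar>)"
      using sinpow_coeff_summable(2)[OF assms]
      by (intro summable_mult) (subst summable_Suc_iff[where f = "\<lambda>n. \<bar>sinpow_coeff g n\<bar>"])
  qed (simp only: real_norm_def sinpow_series_terms_bound)
  then show ?thesis by (simp add: sinpow_series_def summable_sums)
qed

text \<open>For \<open>g > 1\<close> the differentiated series converges absolutely and uniformly,
  so the identity for partial sums passes to the limit.\<close>

lemma sinpow_series_ode:
  assumes g: "g > 1"
  shows "\<exists>S'. (sinpow_series g has_real_derivative S') (at t) \<and> (1 - cos t) * S' = g / 2 * sin t * sinpow_series g t"
proof -
  define f' where "f' n t = - 2 * sinpow_coeff g (Suc n) * real (Suc n) * sin (real (Suc n) * t)" for n t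
  define S' where "S' t = (\<Sum>n. f' n t)" for t
  have sM: "summable (\<lambda>n. 2 * (real (Suc n) * \<bar>sinpow_coeff g (Suc n)\<bar>))"
    using sinpow_coeff_summable(1)[OF g] by (intro summable_mult) (subst summable_Suc_iff[where f = "\<lambda>n. real n * \<bar>sinpow_coeff g n\<bar>"])
  have M: "norm (f' n t) \<le> 2 * (real (Suc n) * \<bar>sinpow_coeff g (Suc n)\<bar>)" for n t
    unfolding f'_def real_norm_def by (rule sinpow_series_terms_bound)
  have u: "uniform_limit UNIV (\<lambda>N t. \<Sum>n<N. f' n t) S' sequentially"
    unfolding S'_def by (rule Weierstrass_m_test[OF _ sM]) (rule M)
  have "\<exists>h. \<forall>x\<in>UNIV. (\<lambda>n. 2 * sinpow_coeff g (Suc n) * cos (real (Suc n) * x)) sums h x \<and> (h has_field_derivative S' x) (at x within UNIV)"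
  proof (rule has_field_derivative_series[OF _ _ u])
    show "((\<lambda>x. 2 * sinpow_coeff g (Suc n) * cos (real (Suc n) * x)) has_field_derivative f' n x) (at x within UNIV)" for n x
      unfolding f'_def by (auto intro!: derivative_eq_intros simp del: sinpow_coeff.simps of_nat_Suc)
    show "summable (\<lambda>n. 2 * sinpow_coeff g (Suc n) * cos (real (Suc n) * 0))"
      using sinpow_series_sums[OF g, of 0] by (rule sums_summable)
  qed auto
  then obtain h where h: "\<And>x. (\<lambda>n. 2 * sinpow_coeff g (Suc n) * cos (real (Suc n) * x)) sums h x"
    "\<And>x. (h has_field_derivative S' x) (at x)" by auto
  have hx: "sinpow_series g x = 1 + h x" for x
    using sums_unique2[OF h(1)[of x] sinpow_series_sums[OF g, of x]] by simp
  have "((\<lambda>x. 1 + h x) has_real_derivative S' t) (at t)"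
    by (auto intro!: derivative_eq_intros h)
  then have d: "(sinpow_series g has_real_derivative S' t) (at t)"
    unfolding hx[abs_def] .
  have l1: "(\<lambda>N. \<Sum>n<N. f' n t) \<longlonglongrightarrow> S' t"
    using tendsto_uniform_limitI[OF u] by simp
  have l2: "(\<lambda>N. \<Sum>n<N. 2 * sinpow_coeff g (Suc n) * cos (real (Suc n) * t)) \<longlonglongrightarrow> sinpow_series g t - 1"
    using sinpow_series_sums[OF g, of t] by (simp add: sums_def)
  have "(\<lambda>N. (1 - cos t) * (\<Sum>n<N. f' n t)
     - g / 2 * sin t * (1 + (\<Sum>n<N. 2 * sinpow_coeff g (Suc n) * cos (real (Suc n) * t))))
     \<longlonglongrightarrow> (1 - cos t) * S' t - g / 2 * sin t * (1 + (sinpow_series g t - 1))"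
    by (intro tendsto_intros l1 l2)
  moreover have "(\<lambda>N. (1 - cos t) * (\<Sum>n<N. f' n t)
     - g / 2 * sin t * (1 + (\<Sum>n<N. 2 * sinpow_coeff g (Suc n) * cos (real (Suc n) * t)))) \<longlonglongrightarrow> 0"
  proof -
    have b: "sinpow_coeff g \<longlonglongrightarrow> 0"
      using summable_LIMSEQ_zero[OF sinpow_coeff_summable(2)[OF g]] by (simp add: tendsto_rabs_zero_iff)
    have "(\<lambda>N. real N * sinpow_coeff g N - g / 2 * sinpow_coeff g N) \<longlonglongrightarrow> 0 - g / 2 * 0"
      by (intro tendsto_intros sinpow_coeff_summable(3)[OF g] b)
    then have "(\<lambda>N. (real N - g / 2) * sinpow_coeff g N) \<longlonglongrightarrow> 0" by (simp add: left_diff_distrib)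
    then have "(\<lambda>N. (real N - g / 2) * sinpow_coeff g N * (sin (real (Suc N) * t) - sin (real N * t))) \<longlonglongrightarrow> 0"
    proof (rule lim_null_mult_right_bounded, intro always_eventually allI)
      show "norm (sin (real (Suc N) * t) - sin (real N * t)) \<le> 2" for N
        using abs_sin_le_one[of "real (Suc N) * t"] abs_sin_le_one[of "real N * t"]
        unfolding real_norm_def by linarith
    qed
    then show ?thesis
      using sinpow_partial_ode[of g t] g unfolding f'_def by simp
  qed
  ultimately have "(1 - cos t) * S' t - g / 2 * sin t * (1 + (sinpow_series g t - 1)) = 0"
    using LIMSEQ_unique by blast
  then show ?thesis using d by (intro exI[of _ "S' t"]) simp
qed

lemma sin_half_formulas:
  "1 - cos t = 2 * (sin (t / 2))\<^sup>2" "sin t = 2 * sin (t / 2) * cos (t / 2)" for t :: real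
  using cos_double_sin[of "t / 2"] sin_double[of "t / 2"] by auto

lemma sinpow_series_isCont: "g > 1 \<Longrightarrow> isCont (sinpow_series g) t"
  using sinpow_series_ode DERIV_isCont by blast

text \<open>On the open interval from 0 to 2 pi the equation reads S'/S = (g/2) cot (t/2) where S is
  nonzero, which suggests that S divided by the sine power is constant. Continuity adds the
  endpoints and evenness the negative half. The range |t| \<le> 2 pi is what the shifts by up to pi
  of arguments in [-pi, pi] require.\<close>

lemma sinpow_series_eq:
  assumes g: "g > 1"
  shows "\<exists>c. c \<noteq> 0 \<and> (\<forall>t. \<bar>t\<bar> \<le> 2 * pi \<longrightarrow> sinpow_series g t = c * \<bar>sin (t / 2)\<bar> powr g)"
proof -
  have pos: "sin (t / 2) > 0" if "t \<in> {0<..<2 * pi}" for t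
    using that by (intro sin_gt_zero) auto
  have "\<exists>c. \<forall>t\<in>{0<..<2 * pi}. sinpow_series g t * sin (t / 2) powr (- g) = c"
  proof (rule has_field_derivative_zero_constant)
    fix t assume t: "t \<in> {0<..<2 * pi}"
    define s where "s = sin (t / 2)"
    have s: "s > 0" using pos[OF t] by (simp add: s_def)
    obtain S' where S': "(sinpow_series g has_real_derivative S') (at t)"
      "(1 - cos t) * S' = g / 2 * sin t * sinpow_series g t"
      using sinpow_series_ode[OF g] by blast
    \<comment> \<open>Half-angle formulas expose a common factor \<open>2 * s\<close>, which is
      nonzero here.\<close>
    have "2 * s * (s * S') = 2 * s * (g / 2 * cos (t / 2) * sinpow_series g t)"
      using S'(2) sin_half_formulas[of t] by (simp add: s_def power2_eq_square mult_ac)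
    then have S's: "s * S' = g / 2 * cos (t / 2) * sinpow_series g t"
      using s by simp
    have "((\<lambda>t. sinpow_series g t * sin (t / 2) powr (- g)) has_real_derivative
        (S' * s powr (- g) + sinpow_series g t * (- g * s powr (- g - 1) * (cos (t / 2) / 2)))) (at t)"
      using s unfolding s_def
      by (auto intro!: derivative_eq_intros S'(1) DERIV_fun_powr simp: mult_ac)
    moreover have "S' * s powr (- g) + sinpow_series g t * (- g * s powr (- g - 1) * (cos (t / 2) / 2)) = 0"
    proof -
      have "s powr (- g) = s powr (- g - 1) * s"
        using s powr_mult_base[of s "- g - 1"] by (simp add: mult.commute)
      then have "S' * s powr (- g) + sinpow_series g t * (- g * s powr (- g - 1) * (cos (t / 2) / 2))
         = s powr (- g - 1) * (s * S' - g / 2 * cos (t / 2) * sinpow_series g t)"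
        by (simp add: algebra_simps)
      then show ?thesis using S's by simp
    qed
    ultimately have "((\<lambda>t. sinpow_series g t * sin (t / 2) powr (- g)) has_real_derivative 0) (at t)"
      by (simp only:)
    then show "((\<lambda>t. sinpow_series g t * sin (t / 2) powr (- g)) has_field_derivative 0) (at t within {0<..<2 * pi})"
      by (rule has_field_derivative_at_within)
  qed simp
  then obtain c where c: "\<And>t. t \<in> {0<..<2 * pi} \<Longrightarrow> sinpow_series g t * sin (t / 2) powr (- g) = c"
    by blast
  have eq0: "sinpow_series g t = c * \<bar>sin (t / 2)\<bar> powr g" if "t \<in> {0<..<2 * pi}" for t
    using c[OF that] pos[OF that] by (auto simp: powr_minus field_simps)
  have eq1: "sinpow_series g t = c * \<bar>sin (t / 2)\<bar> powr g" if "t \<in> {0..2 * pi}" for t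
  proof -
    have "continuous_on (closure {0<..<2 * pi}) (\<lambda>t. sinpow_series g t - c * \<bar>sin (t / 2)\<bar> powr g)"
      using g by (intro continuous_intros continuous_on_powr')
        (auto intro!: continuous_at_imp_continuous_on sinpow_series_isCont continuous_intros)
    from continuous_constant_on_closure[OF this, of 0 t]
    have "sinpow_series g t - c * \<bar>sin (t / 2)\<bar> powr g = 0"
      using that eq0 pi_gt_zero by auto
    then show ?thesis by simp
  qed
  have even: "sinpow_series g (- t) = sinpow_series g t" for t
    by (simp add: sinpow_series_def)
  have eq: "sinpow_series g t = c * \<bar>sin (t / 2)\<bar> powr g" if "\<bar>t\<bar> \<le> 2 * pi" for t
    using eq1[of "\<bar>t\<bar>"] that even[of t] by (auto simp: abs_if split: if_splits)
  \<comment> \<open>Otherwise the series would vanish on [0, pi], and with it the constant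
    coefficient, which is 1.\<close>
  have "c \<noteq> 0"
  proof
    assume "c = 0"
    then have 0: "sinpow_series g t = 0" if "t \<in> {0..pi}" for t using eq[of t] that by auto
    define d where "d k = (if k = 0 then 1 else 2 * sinpow_coeff g k)" for k
    have "summable (\<lambda>k. \<bar>d k\<bar>)"
    proof (rule summable_comparison_test'[where N = 1])
      show "summable (\<lambda>k. 2 * \<bar>sinpow_coeff g k\<bar>)" by (intro summable_mult sinpow_coeff_summable g)
    qed (auto simp: d_def)
    moreover have "(\<lambda>k. d k * cos (real k * t)) sums sinpow_series g t" for t
    proof -
      have "(\<lambda>k. d (Suc k) * cos (real (Suc k) * t)) sums (sinpow_series g t - 1)"
        using sinpow_series_sums[OF g, of t] by (simp add: d_def)
      then show ?thesis by (subst (asm) sums_Suc_iff) (simp add: d_def)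
    qed
    ultimately have "integral {0..pi} (\<lambda>t. sinpow_series g t * cos (real 0 * t)) = pi * d 0"
      by (subst cos_series_coeff) auto
    moreover have "integral {0..pi} (\<lambda>t. sinpow_series g t * cos (real 0 * t)) = integral {0..pi} (\<lambda>t. 0)"
      by (intro integral_cong) (simp add: 0)
    ultimately show False by (simp add: d_def)
  qed
  then show ?thesis using eq by blast
qed

section \<open>Completeness of the Chebyshev system\<close>

lemma cheb_T_cos: "t \<in> {0..pi} \<Longrightarrow> cheb_T k (cos t) = cos (real k * t)"
  by (simp add: cheb_T_def arccos_cos)

lemma cos_image_Ioo: "cos ` {0<..<pi} = {-1<..<1::real}"
proof
  show "cos ` {0<..<pi} \<subseteq> {-1<..<1::real}"
    using cos_monotone_0_pi[of 0] cos_monotone_0_pi[of _ pi] by force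
  show "{-1<..<1::real} \<subseteq> cos ` {0<..<pi}"
  proof
    fix x :: real assume "x \<in> {-1<..<1}"
    then show "x \<in> cos ` {0<..<pi}"
      using arccos_lt_bounded[of x] by (intro image_eqI[of _ _ "arccos x"]) auto
  qed
qed

text \<open>The substitution \<open>x = cos t\<close> is made on the open interval, where the weight
  is finite and its reciprocal is the Jacobian; the endpoints form a null set.\<close>

lemma cheb_coeff_eq_integral:
  assumes f: "continuous_on Omega f"
  shows "cheb_coeff f k = 2 / pi * integral {0..pi} (\<lambda>t. f (cos t) * cos (real k * t))"
proof -
  let ?h = "\<lambda>x. f x * cheb_T k x / sqrt (1 - x\<^sup>2)"
  let ?F = "\<lambda>t. f (cos t) * cos (real k * t)"
  have F: "continuous_on {0..pi} ?F"
    by (intro continuous_intros continuous_on_compose2[OF f]) auto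
  have e: "\<bar>- sin t\<bar> * ?h (cos t) = ?F t" if "t \<in> {0<..<pi}" for t
  proof -
    have "sin t > 0" using that by (auto intro: sin_gt_zero)
    moreover have "1 - (cos t)\<^sup>2 = (sin t)\<^sup>2" by (simp add: sin_squared_eq)
    ultimately show ?thesis using that by (simp add: cheb_T_cos)
  qed
  have "?F absolutely_integrable_on {0..pi}"
    by (rule absolutely_integrable_continuous_real[OF F])
  then have "?F absolutely_integrable_on {0<..<pi}"
    using absolutely_integrable_on_open_interval[of 0 pi ?F] by simp
  then have "(\<lambda>t. \<bar>- sin t\<bar> * ?h (cos t)) absolutely_integrable_on {0<..<pi}"
    by (rule absolutely_integrable_spike[OF _ negligible_empty]) (use e in auto)
  moreover have "integral {0<..<pi} (\<lambda>t. \<bar>- sin t\<bar> * ?h (cos t)) = integral {0..pi} ?F"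
    unfolding integral_open_interval_real by (rule integral_cong) (rule e)
  moreover have "inj_on cos {0<..<pi}"
    by (rule inj_onI) (use cos_inj_pi in auto)
  moreover have "(cos has_real_derivative - sin t) (at t within {0<..<pi})" for t
    by (auto intro!: derivative_eq_intros)
  ultimately have "integral (cos ` {0<..<pi}) ?h = integral {0..pi} ?F"
    using has_absolute_integral_change_of_variables_1'[of "{0<..<pi}" cos "\<lambda>t. - sin t" ?h "integral {0..pi} ?F"]
    by simp
  then show ?thesis
    unfolding cheb_coeff_def cos_image_Ioo integral_open_interval_real[symmetric] by simp
qed

text \<open>Vanishing cosine moments give vanishing integrals against all polynomials in
  \<open>cos t\<close>. Weierstrass approximation of \<open>h\<close> itself then makes the integral
  of its square zero.\<close>

lemma cheb_orthogonal_zero: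
  assumes h: "continuous_on Omega h"
    and z: "\<And>k. integral {0..pi} (\<lambda>t. h (cos t) * cos (real k * t)) = 0"
    and x: "x \<in> Omega"
  shows "h x = 0"
proof -
  have hc: "continuous_on {0..pi} (\<lambda>t. h (cos t))"
    by (intro continuous_on_compose2[OF h] continuous_intros) auto
  \<comment> \<open>The induction needs every frequency \<open>k\<close>, because multiplying
    \<open>cos (k t)\<close> by \<open>cos t\<close> yields the mean of the two neighbouring
    frequencies.\<close>
  have moment: "integral {0..pi} (\<lambda>t. h (cos t) * (cos t) ^ m * cos (real k * t)) = 0" for m k
  proof (induction m arbitrary: k)
    case 0
    then show ?case using z[of k] by simp
  next
    case (Suc m)
    show ?case
    proof (cases k)
      case 0
      then show ?thesis using Suc[of 1] by (simp add: mult_ac)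
    next
      case (Suc j)
      have i: "(\<lambda>t. h (cos t) * (cos t) ^ m * cos (real i * t)) integrable_on {0..pi}" for i
        by (intro integrable_continuous_real continuous_intros hc)
      have "h (cos t) * (cos t) ^ Suc m * cos (real k * t)
          = (1/2) * (h (cos t) * (cos t) ^ m * cos (real (Suc k) * t) + h (cos t) * (cos t) ^ m * cos (real j * t))" for t
      proof -
        have c: "cos (real (Suc k) * t) + cos (real j * t) = 2 * cos t * cos (real k * t)"
          using cos_add[of "real k * t" t] cos_diff[of "real k * t" t] Suc by (simp add: algebra_simps)
        have "(1/2) * (h (cos t) * (cos t) ^ m * cos (real (Suc k) * t) + h (cos t) * (cos t) ^ m * cos (real j * t))
          = (1/2) * h (cos t) * (cos t) ^ m * (cos (real (Suc k) * t) + cos (real j * t))"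
          by (simp only: algebra_simps)
        then show ?thesis unfolding c by simp
      qed
      then have "integral {0..pi} (\<lambda>t. h (cos t) * (cos t) ^ Suc m * cos (real k * t))
        = integral {0..pi} (\<lambda>t. (1/2) * (h (cos t) * (cos t) ^ m * cos (real (Suc k) * t) + h (cos t) * (cos t) ^ m * cos (real j * t)))"
        by (simp only:)
      also have "\<dots> = (1/2) * (integral {0..pi} (\<lambda>t. h (cos t) * (cos t) ^ m * cos (real (Suc k) * t))
          + integral {0..pi} (\<lambda>t. h (cos t) * (cos t) ^ m * cos (real j * t)))"
        by (subst integral_mult_right, subst integral_add[OF i i]) (rule refl)
      finally show ?thesis by (simp add: Suc.IH del: power_Suc of_nat_Suc)
    qed
  qed
  have poly: "integral {0..pi} (\<lambda>t. h (cos t) * p (cos t)) = 0" if rp: "real_polynomial_function p" for p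
  proof -
    obtain a n where p: "p = (\<lambda>x. \<Sum>i\<le>n. a i * x ^ i)"
      using real_polynomial_function_imp_sum[OF rp] by (elim exE)
    have "((\<lambda>t. h (cos t) * (cos t) ^ i) has_integral 0) {0..pi}" for i
    proof -
      have "(\<lambda>t. h (cos t) * (cos t) ^ i) integrable_on {0..pi}"
        by (intro integrable_continuous_real continuous_intros hc)
      then show ?thesis using moment[of i 0] by (simp add: has_integral_integral)
    qed
    then have "((\<lambda>t. \<Sum>i\<le>n. a i * (h (cos t) * (cos t) ^ i)) has_integral (\<Sum>i\<le>n. a i * 0)) {0..pi}"
      by (intro has_integral_sum has_integral_mult_right) auto
    then show ?thesis
      by (intro integral_unique) (simp add: p sum_distrib_left mult_ac)
  qed
  have "integral {0..pi} (\<lambda>t. h (cos t) * h (cos t)) = 0"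
  proof (rule ccontr)
    let ?I = "integral {0..pi} (\<lambda>t. h (cos t) * h (cos t))"
    let ?A = "integral {0..pi} (\<lambda>t. \<bar>h (cos t)\<bar>)"
    assume "?I \<noteq> 0"
    then have I: "\<bar>?I\<bar> > 0" by simp
    have A: "?A \<ge> 0" by (intro integral_nonneg integrable_continuous_real continuous_intros hc) auto
    \<comment> \<open>Chosen so that \<open>?A * e\<close> stays below the supposedly nonzero
      integral; the summand 1 guards against \<open>?A = 0\<close>.\<close>
    define e where "e = \<bar>?I\<bar> / (2 * (?A + 1))"
    have e: "e > 0" using I A by (simp add: e_def)
    obtain p where p: "real_polynomial_function p" "\<And>x. x \<in> Omega \<Longrightarrow> \<bar>h x - p x\<bar> < e"
      using Stone_Weierstrass_real_polynomial_function[OF _ h e] by auto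
    have pc: "continuous_on {0..pi} (\<lambda>t. p (cos t))"
      by (intro continuous_on_compose2[OF continuous_on_polymonial_function[of p Omega]] continuous_intros)
        (use p in \<open>auto simp: real_polynomial_function_eq\<close>)
    have "?I = ?I - integral {0..pi} (\<lambda>t. h (cos t) * p (cos t))"
      using poly[OF p(1)] by simp
    also have "\<dots> = integral {0..pi} (\<lambda>t. h (cos t) * h (cos t) - h (cos t) * p (cos t))"
      by (intro integral_diff[symmetric] integrable_continuous_real continuous_intros hc pc)
    also have "norm \<dots> \<le> integral {0..pi} (\<lambda>t. \<bar>h (cos t)\<bar> * e)"
    proof (rule integral_norm_bound_integral)
      fix t :: real assume "t \<in> {0..pi}"
      have "\<bar>h (cos t) - p (cos t)\<bar> \<le> e" using p(2)[of "cos t"] by auto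
      then show "norm (h (cos t) * h (cos t) - h (cos t) * p (cos t)) \<le> \<bar>h (cos t)\<bar> * e"
        by (simp add: abs_mult mult_left_mono flip: right_diff_distrib)
    qed (intro integrable_continuous_real continuous_intros hc pc)+
    also have "\<dots> = ?A * e" by simp
    also have "\<dots> < \<bar>?I\<bar>"
      using I A by (simp add: e_def field_simps add_pos_nonneg)
    finally show False by simp
  qed
  then have "\<forall>t\<in>{0..pi}. h (cos t) * h (cos t) = 0"
    by (subst (asm) integral_eq_0_iff) (auto intro!: continuous_intros hc)
  moreover have "arccos x \<in> {0..pi}" "cos (arccos x) = x" using x by (auto intro: arccos_lbound arccos_ubound)
  ultimately show ?thesis by (metis mult_eq_0_iff)
qed

text \<open>The series converges uniformly to some continuous function with the same coefficients as
  \<open>g\<close>; the difference of the two is orthogonal to all cosines, hence zero.\<close>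

lemma cheb_series:
  assumes g: "continuous_on Omega g" and s: "summable (\<lambda>k. \<bar>cheb_coeff g k\<bar>)" and t: "t \<in> {0..pi}"
  shows "(\<lambda>k. cheb_coeff g (Suc k) * cos (real (Suc k) * t)) sums (g (cos t) - cheb_coeff g 0 / 2)"
proof -
  define d where "d k = (if k = 0 then 1/2 else 1) * cheb_coeff g k" for k
  define G where "G t = (\<Sum>k. d k * cos (real k * t))" for t
  have sd: "summable (\<lambda>k. \<bar>d k\<bar>)"
    by (rule summable_comparison_test'[where N = 1, OF s]) (auto simp: d_def)
  have G: "(\<lambda>k. d k * cos (real k * t)) sums G t" for t
  proof -
    have "norm (d k * cos (real k * t)) \<le> \<bar>d k\<bar>" for k
      using mult_left_le[OF abs_cos_le_one[of "real k * t"], of "\<bar>d k\<bar>"] by (simp add: abs_mult)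
    then show ?thesis
      unfolding G_def by (intro summable_sums summable_comparison_test'[where N = 0, OF sd]) auto
  qed
  have Gc: "continuous_on {0..pi} G"
    by (rule cos_series_continuous[OF sd G])
  define h where "h x = g x - G (arccos x)" for x
  have hc: "continuous_on Omega h"
    unfolding h_def
    by (intro continuous_intros g continuous_on_compose2[OF Gc]) (auto intro: arccos_lbound arccos_ubound)
  have "integral {0..pi} (\<lambda>t. h (cos t) * cos (real k * t)) = 0" for k
  proof -
    have "integral {0..pi} (\<lambda>t. h (cos t) * cos (real k * t))
      = integral {0..pi} (\<lambda>t. g (cos t) * cos (real k * t) - G t * cos (real k * t))"
      by (intro integral_cong) (simp add: h_def arccos_cos left_diff_distrib)
    also have "\<dots> = integral {0..pi} (\<lambda>t. g (cos t) * cos (real k * t)) - integral {0..pi} (\<lambda>t. G t * cos (real k * t))"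
      by (intro integral_diff integrable_continuous_real continuous_intros Gc continuous_on_compose2[OF g]) auto
    also have "integral {0..pi} (\<lambda>t. G t * cos (real k * t)) = (if k = 0 then pi else pi / 2) * d k"
      by (rule cos_series_coeff[OF sd G])
    also have "integral {0..pi} (\<lambda>t. g (cos t) * cos (real k * t)) = pi / 2 * cheb_coeff g k"
      by (simp add: cheb_coeff_eq_integral[OF g])
    finally show ?thesis by (simp add: d_def)
  qed
  then have "h (cos t) = 0"
    by (intro cheb_orthogonal_zero[OF hc]) auto
  then have "G t = g (cos t)" using t by (simp add: h_def arccos_cos)
  with G[of t] have "(\<lambda>k. d (Suc k) * cos (real (Suc k) * t)) sums (g (cos t) - cheb_coeff g 0 / 2)"
    by (subst sums_Suc_iff) (simp add: d_def)
  then show ?thesis by (simp add: d_def)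
qed

section \<open>Chebyshev coefficients of smooth functions\<close>

lemma smooth_on_continuous:
  assumes "smooth_on S g" shows "continuous_on S g"
proof -
  obtain D where D: "\<And>x. x \<in> S \<Longrightarrow> D 0 x = g x"
    "\<And>k x. x \<in> S \<Longrightarrow> (D k has_real_derivative D (Suc k) x) (at x within S)"
    using assms unfolding smooth_on_def by blast
  have "continuous_on S (D (0::nat))"
    using D(2) by (intro DERIV_continuous_on)
  then show ?thesis using D(1) by (simp cong: continuous_on_cong)
qed

text \<open>In the variable \<open>t = arccos x\<close> the operator \<open>(1 - x\<^sup>2) g'' - x g'\<close> is the second derivative,
  so it multiplies the Chebyshev coefficients by \<open>- k\<^sup>2\<close>.\<close>

lemma cheb_coeff_second_derivative:
  assumes "smooth_on Omega g"
  shows "\<exists>h. smooth_on Omega h \<and> (\<forall>k. (real k)\<^sup>2 * cheb_coeff g k = - cheb_coeff h k)"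
proof -
  obtain D where D: "\<And>x. x \<in> Omega \<Longrightarrow> D 0 x = g x"
    "\<And>k x. x \<in> Omega \<Longrightarrow> (D k has_real_derivative D (Suc k) x) (at x within Omega)"
    using assms unfolding smooth_on_def by blast
  \<comment> \<open>By the Leibniz rule \<open>E k\<close> is the \<open>k\<close>-th derivative of
    (1 - x^2) g'' - x g', so the family \<open>E\<close> witnesses smoothness.\<close>
  define E where "E k x = (1 - x\<^sup>2) * D (Suc (Suc k)) x - (2 * real k + 1) * x * D (Suc k) x - (real k)\<^sup>2 * D k x"
    for k x
  have E: "(E k has_real_derivative E (Suc k) x) (at x within Omega)" if "x \<in> Omega" for k x
    unfolding E_def[abs_def]
    by (rule derivative_eq_intros D(2) that refl | simp)+
      (simp add: algebra_simps power2_eq_square)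
  then have smE: "smooth_on Omega (E 0)"
    unfolding smooth_on_def by (intro exI[of _ E]) auto
  have dcos: "((\<lambda>t. D j (cos t)) has_real_derivative D (Suc j) (cos t) * (- sin t)) (at t within {0..pi})" for j t
  proof -
    have "(D j has_real_derivative D (Suc j) (cos t)) (at (cos t) within cos ` {0..pi})"
      by (rule has_field_derivative_subset[OF D(2)]) auto
    moreover have "(cos has_real_derivative - sin t) (at t within {0..pi})"
      by (auto intro!: derivative_eq_intros)
    ultimately show ?thesis using DERIV_image_chain unfolding o_def by blast
  qed
  have "(real k)\<^sup>2 * cheb_coeff g k = - cheb_coeff (E 0) k" for k
  proof -
    \<comment> \<open>The boundary expression of two integrations by parts in \<open>t\<close>; each
      summand contains a sine that vanishes at 0 and pi.\<close>
    define W where "W t = real k * D 0 (cos t) * sin (real k * t) + (- sin t * D 1 (cos t)) * cos (real k * t)" for t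
    have "(W has_real_derivative ((real k)\<^sup>2 * (D 0 (cos t) * cos (real k * t)) + E 0 (cos t) * cos (real k * t)))
        (at t within {0..pi})" for t
    proof -
      have "1 - (cos t)\<^sup>2 = sin t * sin t"
        using sin_cos_squared_add[of t] unfolding power2_eq_square by linarith
      then have E0: "E 0 (cos t) = sin t * sin t * D (Suc (Suc 0)) (cos t) - cos t * D (Suc 0) (cos t)"
        by (simp add: E_def)
      show ?thesis
        unfolding W_def[abs_def] E0
        by (auto intro!: derivative_eq_intros dcos simp: algebra_simps power2_eq_square)
    qed
    then have "((\<lambda>t. (real k)\<^sup>2 * (D 0 (cos t) * cos (real k * t)) + E 0 (cos t) * cos (real k * t)) has_integral (W pi - W 0)) {0..pi}"
      by (intro fundamental_theorem_of_calculus) (auto simp: has_real_derivative_iff_has_vector_derivative)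
    moreover have "W pi - W 0 = 0"
      by (simp add: W_def sin_npi mult.commute)
    ultimately have "integral {0..pi} (\<lambda>t. (real k)\<^sup>2 * (D 0 (cos t) * cos (real k * t)) + E 0 (cos t) * cos (real k * t)) = 0"
      by (metis integral_unique)
    moreover have "continuous_on Omega (D 0)"
      using D(2) by (intro DERIV_continuous_on)
    then have "(\<lambda>t. D 0 (cos t) * cos (real k * t)) integrable_on {0..pi}"
      by (intro integrable_continuous_real continuous_intros continuous_on_compose2[where f = cos]) auto
    moreover have "(\<lambda>t. E 0 (cos t) * cos (real k * t)) integrable_on {0..pi}"
      by (intro integrable_continuous_real continuous_intros continuous_on_compose2[OF smooth_on_continuous[OF smE]]) auto
    ultimately have "(real k)\<^sup>2 * integral {0..pi} (\<lambda>t. D 0 (cos t) * cos (real k * t))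
        + integral {0..pi} (\<lambda>t. E 0 (cos t) * cos (real k * t)) = 0"
      by (simp add: integral_add integrable_on_mult_right)
    moreover have "integral {0..pi} (\<lambda>t. D 0 (cos t) * cos (real k * t)) = integral {0..pi} (\<lambda>t. g (cos t) * cos (real k * t))"
      by (intro integral_cong) (simp add: D(1))
    ultimately have "(real k)\<^sup>2 * integral {0..pi} (\<lambda>t. g (cos t) * cos (real k * t))
        = - integral {0..pi} (\<lambda>t. E 0 (cos t) * cos (real k * t))" by simp
    then have "2 / pi * ((real k)\<^sup>2 * integral {0..pi} (\<lambda>t. g (cos t) * cos (real k * t)))
        = 2 / pi * (- integral {0..pi} (\<lambda>t. E 0 (cos t) * cos (real k * t)))"
      by (simp only:)
    then show ?thesis
      by (simp add: cheb_coeff_eq_integral mult_ac smooth_on_continuous[OF assms] smooth_on_continuous[OF smE])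
  qed
  then show ?thesis using smE by blast
qed

lemma cheb_coeff_bounded:
  assumes "continuous_on Omega g"
  shows "\<exists>C. \<forall>k. \<bar>cheb_coeff g k\<bar> \<le> C"
proof -
  obtain B where B: "\<And>x. x \<in> Omega \<Longrightarrow> \<bar>g x\<bar> \<le> B"
    using compact_imp_bounded[OF compact_continuous_image[OF assms]] unfolding bounded_iff by (metis imageI real_norm_def compact_Icc)
  have "\<bar>cheb_coeff g k\<bar> \<le> 2 / pi * (B * pi)" for k
  proof -
    have "norm (integral {0..pi} (\<lambda>t. g (cos t) * cos (real k * t))) \<le> integral {0..pi} (\<lambda>t. B)"
    proof (rule integral_norm_bound_integral)
      fix t :: real
      have "\<bar>g (cos t)\<bar> * \<bar>cos (real k * t)\<bar> \<le> \<bar>g (cos t)\<bar>"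
        by (rule mult_left_le) auto
      then show "norm (g (cos t) * cos (real k * t)) \<le> B"
        using B[of "cos t"] by (simp add: abs_mult)
    qed (intro integrable_continuous_real continuous_intros continuous_on_compose2[OF assms]; auto)+
    then have "\<bar>integral {0..pi} (\<lambda>t. g (cos t) * cos (real k * t))\<bar> \<le> B * pi" by (simp add: mult.commute)
    then show ?thesis
      unfolding cheb_coeff_eq_integral[OF assms] abs_mult by (intro mult_mono) auto
  qed
  then show ?thesis by blast
qed

text \<open>Each use of the second-derivative operator gains a factor k^2 and leaves a smooth
  function, whose coefficients are bounded.\<close>

lemma smooth_cheb_coeff_decay:
  assumes "smooth_on Omega g"
  shows "\<exists>C. \<forall>k. \<bar>cheb_coeff g k\<bar> \<le> C * (1 + real k) powr (- q)"
proof -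
  have pow: "\<exists>C. \<forall>k. real k ^ (2 * m) * \<bar>cheb_coeff g k\<bar> \<le> C" for m
    using assms
  proof (induction m arbitrary: g)
    case 0
    then show ?case using cheb_coeff_bounded[OF smooth_on_continuous] by simp
  next
    case (Suc m)
    obtain h where h: "smooth_on Omega h" "\<And>k. (real k)\<^sup>2 * cheb_coeff g k = - cheb_coeff h k"
      using cheb_coeff_second_derivative[OF Suc.prems] by blast
    have "real k ^ (2 * Suc m) * \<bar>cheb_coeff g k\<bar> = real k ^ (2 * m) * \<bar>cheb_coeff h k\<bar>" for k
    proof -
      have "(real k)\<^sup>2 * \<bar>cheb_coeff g k\<bar> = \<bar>cheb_coeff h k\<bar>"
        using arg_cong[OF h(2)[of k], of abs] by (simp add: abs_mult)
      then show ?thesis by (simp add: power_add power2_eq_square mult_ac)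
    qed
    then show ?case using Suc.IH[OF h(1)] by presburger
  qed
  define m where "m = nat \<lceil>q\<rceil>"
  obtain C0 Cm where C: "\<And>k. \<bar>cheb_coeff g k\<bar> \<le> C0" "\<And>k. real k ^ (2 * m) * \<bar>cheb_coeff g k\<bar> \<le> Cm"
    using pow[of m] cheb_coeff_bounded[OF smooth_on_continuous[OF assms]] by blast
  have "\<bar>cheb_coeff g k\<bar> \<le> 2 ^ (2 * m) * (C0 + Cm) * (1 + real k) powr (- q)" for k
  proof -
    have "(1 + real k) powr q \<le> (1 + real k) powr real (2 * m)"
      using real_nat_ceiling_ge[of q] by (intro powr_mono) (auto simp: m_def)
    also have "\<dots> = (1 + real k) ^ (2 * m)"
      by (subst powr_realpow) auto
    also have "\<dots> \<le> (2 * max 1 (real k)) ^ (2 * m)"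
      by (intro power_mono) auto
    also have "\<dots> = 2 ^ (2 * m) * max 1 (real k) ^ (2 * m)"
      by (rule power_mult_distrib)
    also have "\<dots> \<le> 2 ^ (2 * m) * (1 + real k ^ (2 * m))"
      by (intro mult_left_mono) (auto simp: max_def)
    finally have "(1 + real k) powr q * \<bar>cheb_coeff g k\<bar> \<le> 2 ^ (2 * m) * (1 + real k ^ (2 * m)) * \<bar>cheb_coeff g k\<bar>"
      by (intro mult_right_mono) auto
    also have "\<dots> = 2 ^ (2 * m) * (\<bar>cheb_coeff g k\<bar> + real k ^ (2 * m) * \<bar>cheb_coeff g k\<bar>)"
      by (simp add: algebra_simps)
    also have "\<dots> \<le> 2 ^ (2 * m) * (C0 + Cm)"
      using C by (intro mult_left_mono add_mono) auto
    finally show ?thesis by (simp add: powr_minus field_simps)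
  qed
  then show ?thesis by blast
qed

section \<open>Chebyshev polynomials and tails of series\<close>

lemma Omega_cos: assumes "x \<in> Omega" obtains t where "t \<in> {0..pi}" "x = cos t"
  using assms by (intro that[of "arccos x"]) (auto intro: arccos_lbound arccos_ubound)

lemma abs_cheb_T_le: "\<bar>cheb_T k x\<bar> \<le> 1"
  by (simp add: cheb_T_def)

lemma cheb_T_0 [simp]: "cheb_T 0 x = 1"
  by (simp add: cheb_T_def)

lemma cheb_T_1: "x \<in> Omega \<Longrightarrow> cheb_T (Suc 0) x = x"
  by (simp add: cheb_T_def)

lemma cheb_T_rec:
  assumes "x \<in> Omega"
  shows "cheb_T (Suc (Suc k)) x = 2 * x * cheb_T (Suc k) x - cheb_T k x"
proof -
  have "cos (real (Suc k) * a + a) + cos (real (Suc k) * a - a) = 2 * cos a * cos (real (Suc k) * a)" for a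
    by (simp only: cos_add cos_diff) simp
  then have "cos (real (Suc (Suc k)) * a) + cos (real k * a) = 2 * cos a * cos (real (Suc k) * a)" for a
    by (simp add: algebra_simps)
  from this[of "arccos x"] show ?thesis using assms by (simp add: cheb_T_def algebra_simps)
qed

text \<open>The three-term recurrence differentiated. Unlike the quotient k sin (k t) / sin t it
  also makes sense at the endpoints.\<close>

fun cheb_dT :: "nat \<Rightarrow> real \<Rightarrow> real" where
  "cheb_dT 0 x = 0"
| "cheb_dT (Suc 0) x = 1"
| "cheb_dT (Suc (Suc k)) x = 2 * cheb_T (Suc k) x + 2 * x * cheb_dT (Suc k) x - cheb_dT k x"

lemma DERIV_cheb_T:
  assumes x: "x \<in> Omega"
  shows "(cheb_T k has_real_derivative cheb_dT k x) (at x within Omega)"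
proof -
  have "(cheb_T k has_real_derivative cheb_dT k x) (at x within Omega)
    \<and> (cheb_T (Suc k) has_real_derivative cheb_dT (Suc k) x) (at x within Omega)"
  proof (induction k)
    case 0
    have "(cheb_T (Suc 0) has_real_derivative 1) (at x within Omega)"
      by (rule has_field_derivative_transform_within[OF DERIV_ident zero_less_one x]) (simp add: cheb_T_1)
    moreover have "cheb_T 0 = (\<lambda>x. 1)" by auto
    ultimately show ?case by simp
  next
    case (Suc k)
    have "((\<lambda>x. 2 * x * cheb_T (Suc k) x - cheb_T k x) has_real_derivative cheb_dT (Suc (Suc k)) x) (at x within Omega)"
      using Suc.IH by (auto intro!: derivative_eq_intros)
    then have "(cheb_T (Suc (Suc k)) has_real_derivative cheb_dT (Suc (Suc k)) x) (at x within Omega)"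
      by (rule has_field_derivative_transform_within[OF _ zero_less_one x]) (simp add: cheb_T_rec)
    then show ?case using Suc.IH by simp
  qed
  then show ?thesis by simp
qed

lemma cheb_dT_sin:
  assumes t: "t \<in> {0..pi}"
  shows "cheb_dT k (cos t) * sin t = real k * sin (real k * t)"
proof -
  have "cheb_dT k (cos t) * sin t = real k * sin (real k * t)
    \<and> cheb_dT (Suc k) (cos t) * sin t = real (Suc k) * sin (real (Suc k) * t)"
  proof (induction k)
    case (Suc k)
    define s c where "s = sin (real (Suc k) * t)" and "c = cos (real (Suc k) * t)"
    have 1: "sin (real k * t) = s * cos t - c * sin t"
      using sin_diff[of "real (Suc k) * t" t] by (simp add: s_def c_def algebra_simps)
    have 2: "sin (real (Suc (Suc k)) * t) = s * cos t + c * sin t"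
      using sin_add[of "real (Suc k) * t" t] by (simp add: s_def c_def algebra_simps)
    have "cheb_dT (Suc (Suc k)) (cos t) * sin t
        = 2 * c * sin t + 2 * cos t * (cheb_dT (Suc k) (cos t) * sin t) - cheb_dT k (cos t) * sin t"
      using t by (simp add: cheb_T_cos c_def algebra_simps)
    also have "\<dots> = 2 * c * sin t + 2 * cos t * (real (Suc k) * s) - real k * (s * cos t - c * sin t)"
      using Suc.IH 1 by (simp only: s_def)
    also have "\<dots> = real (Suc (Suc k)) * (s * cos t + c * sin t)"
      by (simp add: algebra_simps)
    finally show ?case using Suc.IH 2 by (simp only:)
  qed simp
  then show ?thesis by simp
qed

lemma abs_sin_multiple_le: "\<bar>sin (real k * t)\<bar> \<le> real k * \<bar>sin t\<bar>"
proof (induction k)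
  case (Suc k)
  have "sin (real (Suc k) * t) = sin (real k * t) * cos t + cos (real k * t) * sin t"
    using sin_add[of "real k * t" t] by (simp add: algebra_simps)
  also have "\<bar>\<dots>\<bar> \<le> \<bar>sin (real k * t)\<bar> * 1 + 1 * \<bar>sin t\<bar>"
    by (intro order_trans[OF abs_triangle_ineq] add_mono) (auto simp: abs_mult intro!: mult_left_le mult_left_le_one_le)
  also have "\<dots> \<le> real (Suc k) * \<bar>sin t\<bar>"
    using Suc.IH by (simp add: algebra_simps)
  finally show ?case .
qed simp

lemma cheb_dT_endpoint:
  assumes "x = 1 \<or> x = -1"
  shows "cheb_dT k x = x ^ Suc k * (real k)\<^sup>2"
proof -
  have x: "x * x = 1" "x \<in> Omega" using assms by auto
  have T: "cheb_T k x = x ^ k \<and> cheb_T (Suc k) x = x ^ Suc k" for k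
    by (induction k) (use x in \<open>simp_all add: cheb_T_1 cheb_T_rec mult.assoc[symmetric]\<close>)
  have "cheb_dT k x = x ^ Suc k * (real k)\<^sup>2 \<and> cheb_dT (Suc k) x = x ^ Suc (Suc k) * (real (Suc k))\<^sup>2"
  proof (induction k)
    case (Suc k)
    have "cheb_dT (Suc (Suc k)) x = 2 * x ^ Suc k + 2 * (x * (x ^ Suc (Suc k) * (real (Suc k))\<^sup>2)) - x ^ Suc k * (real k)\<^sup>2"
      using Suc.IH T[of k] by simp
    also have "x * (x ^ Suc (Suc k) * (real (Suc k))\<^sup>2) = (x * x) * (x ^ Suc k * (real (Suc k))\<^sup>2)"
      by (simp only: power_Suc mult_ac)
    finally have "cheb_dT (Suc (Suc k)) x = x ^ Suc k * (real (Suc (Suc k)))\<^sup>2"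
      using x by (simp add: algebra_simps power2_eq_square)
    also have "x ^ Suc k = (x * x) * x ^ Suc k" using x by simp
    also have "\<dots> = x ^ Suc (Suc (Suc k))" by (simp only: power_Suc mult_ac)
    finally show ?case using Suc.IH by simp
  qed (use x in auto)
  then show ?thesis by simp
qed

lemma abs_cheb_dT_interior:
  assumes "-1 < x" "x < 1"
  shows "\<bar>cheb_dT k x\<bar> \<le> real k / sqrt (1 - x\<^sup>2)"
proof -
  obtain t where t: "t \<in> {0..pi}" "x = cos t" using Omega_cos[of x] assms by auto
  have s: "sqrt (1 - x\<^sup>2) = sin t"
    using t sin_ge_zero[of t] by (simp add: sin_squared_eq[symmetric])
  have "1 - x\<^sup>2 > 0" using assms by (simp add: abs_square_less_1 abs_less_iff)
  then have "sin t > 0" by (simp flip: s)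
  moreover have "\<bar>cheb_dT k x\<bar> * sin t = real k * \<bar>sin (real k * t)\<bar>"
    using arg_cong[OF cheb_dT_sin[OF t(1), of k], of abs] \<open>sin t > 0\<close> t by (simp add: abs_mult)
  moreover have "real k * \<bar>sin (real k * t)\<bar> \<le> real k * 1" by (intro mult_left_mono) auto
  ultimately show ?thesis unfolding s by (simp add: field_simps)
qed

text \<open>The Markov bound for Chebyshev polynomials: inside it follows from |sin (k t)| \<le> k
  |sin t|, and at the endpoints it is attained.\<close>

lemma abs_cheb_dT_le:
  assumes "x \<in> Omega"
  shows "\<bar>cheb_dT k x\<bar> \<le> (real k)\<^sup>2"
proof (cases "x = 1 \<or> x = -1")
  case True
  then have "\<bar>x ^ Suc k\<bar> = 1" by (auto simp: power_abs)
  then show ?thesis using cheb_dT_endpoint[OF True, of k] by (simp add: abs_mult)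
next
  case False
  obtain t where t: "t \<in> {0..pi}" "x = cos t" using Omega_cos assms by blast
  then have "t \<noteq> 0" "t \<noteq> pi" using False by auto
  then have s: "sin t > 0" using t by (intro sin_gt_zero) auto
  have "\<bar>cheb_dT k x\<bar> * sin t = real k * \<bar>sin (real k * t)\<bar>"
    using arg_cong[OF cheb_dT_sin[OF t(1), of k], of abs] s t by (simp add: abs_mult)
  also have "\<dots> \<le> real k * (real k * \<bar>sin t\<bar>)"
    by (intro mult_left_mono abs_sin_multiple_le) auto
  finally show ?thesis using s by (simp add: power2_eq_square)
qed

section \<open>Termwise differentiation of Chebyshev series\<close>

lemma deriv_Omega_eq:
  assumes "x \<in> Omega" "(h has_real_derivative D) (at x within Omega)"
  shows "deriv_Omega h x = D"
  unfolding deriv_Omega_def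
  by (rule vector_derivative_within_closed_interval)
    (use assms in \<open>auto simp: has_real_derivative_iff_has_vector_derivative\<close>)

lemma DERIV_cheb_proj:
  assumes "x \<in> Omega"
  shows "(cheb_proj f n has_real_derivative (\<Sum>k<n. cheb_coeff f (Suc k) * cheb_dT (Suc k) x)) (at x within Omega)"
proof -
  have "cheb_proj f n = (\<lambda>x. cheb_coeff f 0 / 2 + (\<Sum>k<n. cheb_coeff f (Suc k) * cheb_T (Suc k) x))"
    by (auto simp: cheb_proj_def sum.atLeast1_atMost_eq)
  moreover have "((\<lambda>x. cheb_coeff f 0 / 2 + (\<Sum>k<n. cheb_coeff f (Suc k) * cheb_T (Suc k) x)) has_real_derivative
      0 + (\<Sum>k<n. cheb_coeff f (Suc k) * cheb_dT (Suc k) x)) (at x within Omega)"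
    by (intro DERIV_add DERIV_const DERIV_sum DERIV_cmult DERIV_cheb_T assms)
  ultimately show ?thesis by simp
qed

text \<open>The majorant \<open>M\<close> is left open because two are used: a multiple of k on
  compact subintervals of the open interval, and k^2 on all of \<open>Omega\<close>.\<close>

lemma DERIV_cheb_series:
  assumes S: "convex S" "S \<subseteq> Omega" "x \<in> S"
    and M: "\<And>k y. y \<in> S \<Longrightarrow> \<bar>cheb_dT (Suc k) y\<bar> \<le> M k"
    and s: "summable (\<lambda>k. \<bar>d k\<bar> * M k)"
    and F: "\<And>y. y \<in> S \<Longrightarrow> (\<lambda>k. d k * cheb_T (Suc k) y) sums F y"
  shows "(F has_real_derivative (\<Sum>k. d k * cheb_dT (Suc k) x)) (at x within S)"
    and "summable (\<lambda>k. d k * cheb_dT (Suc k) x)"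
proof -
  have b: "norm (d k * cheb_dT (Suc k) y) \<le> \<bar>d k\<bar> * M k" if "y \<in> S" for k y
    using M[OF that] by (simp add: abs_mult mult_left_mono del: cheb_dT.simps)
  have u: "uniform_limit S (\<lambda>n y. \<Sum>k<n. d k * cheb_dT (Suc k) y) (\<lambda>y. \<Sum>k. d k * cheb_dT (Suc k) y) sequentially"
    by (rule Weierstrass_m_test[OF b s])
  have "\<exists>h. \<forall>y\<in>S. (\<lambda>k. d k * cheb_T (Suc k) y) sums h y
     \<and> (h has_field_derivative (\<Sum>k. d k * cheb_dT (Suc k) y)) (at y within S)"
  proof (rule has_field_derivative_series[OF S(1) _ u S(3)])
    show "((\<lambda>y. d k * cheb_T (Suc k) y) has_field_derivative d k * cheb_dT (Suc k) y) (at y within S)" if "y \<in> S" for k y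
      using that S(2) by (intro DERIV_cmult has_field_derivative_subset[OF DERIV_cheb_T]) auto
    show "summable (\<lambda>k. d k * cheb_T (Suc k) x)" using F[OF S(3)] by (rule sums_summable)
  qed
  then obtain h where h: "\<And>y. y \<in> S \<Longrightarrow> (\<lambda>k. d k * cheb_T (Suc k) y) sums h y"
     "\<And>y. y \<in> S \<Longrightarrow> (h has_field_derivative (\<Sum>k. d k * cheb_dT (Suc k) y)) (at y within S)" by blast
  have "h y = F y" if "y \<in> S" for y using h(1) F that sums_unique2 by blast
  then show "(F has_real_derivative (\<Sum>k. d k * cheb_dT (Suc k) x)) (at x within S)"
    by (intro has_field_derivative_transform_within[OF h(2)[OF S(3)] zero_less_one S(3)]) auto
  show "summable (\<lambda>k. d k * cheb_dT (Suc k) x)"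
    by (rule summable_comparison_test'[where N = 0, OF s]) (rule b[OF S(3)])
qed

text \<open>The integral comparison for a decreasing power in telescoping form. Writing t for the
  ratio of the two bases, it follows from ln t \<le> t - 1 and 1 + u \<le> exp u.\<close>

lemma powr_telescope:
  assumes "p > 1"
  shows "(p - 1) * (real (Suc (Suc m))) powr (- p) \<le> real (Suc m) powr (1 - p) - real (Suc (Suc m)) powr (1 - p)"
proof -
  define y t where "y = real (Suc (Suc m))" and "t = real (Suc m) / y"
  have y: "y > 0" "real (Suc m) = t * y" by (auto simp: y_def t_def)
  have t: "0 < t" "1 - t = 1 / y" by (auto simp: t_def y_def field_simps)
  have "1 + (p - 1) * (1 - t) \<le> 1 + (p - 1) * (- ln t)"
    using assms ln_le_minus_one[OF t(1)] by (intro add_left_mono mult_left_mono) auto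
  also have "\<dots> \<le> exp ((p - 1) * (- ln t))" by (rule exp_ge_add_one_self)
  also have "\<dots> = t powr (1 - p)" using t by (simp add: powr_def algebra_simps)
  finally have "(1 + (p - 1) * (1 - t)) * y powr (1 - p) \<le> t powr (1 - p) * y powr (1 - p)"
    by (rule mult_right_mono) simp
  also have "t powr (1 - p) * y powr (1 - p) = real (Suc m) powr (1 - p)"
    using t y by (simp add: powr_mult)
  also have "(1 + (p - 1) * (1 - t)) * y powr (1 - p) = y powr (1 - p) + (p - 1) * (y powr (1 - p) / y)"
    unfolding t(2) by (simp add: algebra_simps)
  also have "y powr (1 - p) / y = y powr (- p)"
    using y powr_mult_base[of y "- p"] by (simp add: nonzero_divide_eq_eq mult.commute)
  finally show ?thesis by (simp add: y_def)
qed

text \<open>The term with index \<open>k\<close> is compared with \<open>Suc k\<close>, so the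
  telescoping sum starts exactly at \<open>n\<close> and needs \<open>n \<ge> 1\<close>.\<close>

lemma tail_powr:
  assumes p: "p > 1" and s: "\<And>k. k \<ge> n \<Longrightarrow> \<bar>s k\<bar> \<le> C * real (Suc k) powr (- p)" and n: "n \<ge> 1"
  shows "summable (\<lambda>k. \<bar>s (k + n)\<bar>)" "(\<Sum>k. \<bar>s (k + n)\<bar>) \<le> C / (p - 1) * real n powr (1 - p)"
proof -
  have "0 \<le> C * real (Suc n) powr (- p)"
    using order_trans[OF abs_ge_zero s[of n]] by simp
  then have C: "0 \<le> C" by (simp add: zero_le_mult_iff)
  define D where "D k = C / (p - 1) * (real (k + n) powr (1 - p) - real (Suc (k + n)) powr (1 - p))" for k
  have "(\<lambda>k. real (k + n) powr (1 - p)) \<longlonglongrightarrow> 0"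
    by (rule LIMSEQ_ignore_initial_segment)
      (use p in \<open>intro tendsto_neg_powr filterlim_real_sequentially, simp\<close>)
  then have "(\<lambda>k. real (k + n) powr (1 - p) - real (Suc k + n) powr (1 - p)) sums (real (0 + n) powr (1 - p) - 0)"
    by (rule telescope_sums')
  then have D: "D sums (C / (p - 1) * real n powr (1 - p))"
    unfolding D_def by (intro sums_mult) simp
  have le: "\<bar>s (k + n)\<bar> \<le> D k" for k
  proof -
    obtain m where m: "k + n = Suc m" using n by (cases "k + n") auto
    have "\<bar>s (k + n)\<bar> \<le> C / (p - 1) * ((p - 1) * real (Suc (k + n)) powr (- p))"
      using s[of "k + n"] p by simp
    also have "\<dots> \<le> D k"
      unfolding D_def m using C p powr_telescope[OF p, of m] by (intro mult_left_mono) auto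
    finally show ?thesis .
  qed
  show 1: "summable (\<lambda>k. \<bar>s (k + n)\<bar>)"
    by (rule summable_comparison_test'[where N = 0, OF sums_summable[OF D]]) (simp add: le)
  show "(\<Sum>k. \<bar>s (k + n)\<bar>) \<le> C / (p - 1) * real n powr (1 - p)"
    using suminf_le[OF le 1 sums_summable[OF D]] sums_unique[OF D] by simp
qed

text \<open>Multiplication by 2 sin (\<psi>/2) telescopes the sum. If this factor vanishes, \<psi>
  is a multiple of 2 pi and every term is 0; for cosines the sums would grow instead.\<close>

lemma sin_partial_sums_bounded: "\<exists>B. \<forall>n. \<bar>\<Sum>k<n. sin (real k * \<psi>)\<bar> \<le> B"
proof (cases "sin (\<psi> / 2) = 0")
  case True
  then obtain i :: int where "\<psi> / 2 = of_int i * pi" by (auto simp: sin_zero_iff_int2)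
  then have "real k * \<psi> = of_int (int k * 2 * i) * pi" for k by simp
  then have "sin (real k * \<psi>) = 0" for k
    unfolding sin_zero_iff_int2 by blast
  then show ?thesis by (intro exI[of _ 0]) simp
next
  case False
  have *: "2 * sin (\<psi> / 2) * (\<Sum>k<n. sin (real k * \<psi>)) = cos (\<psi> / 2) - cos (real n * \<psi> - \<psi> / 2)" for n
  proof (induction n)
    case (Suc n)
    have "cos (real n * \<psi> - \<psi> / 2) - cos (real (Suc n) * \<psi> - \<psi> / 2) = 2 * sin (\<psi> / 2) * sin (real n * \<psi>)"
      using cos_diff[of "real n * \<psi>" "\<psi> / 2"] cos_add[of "real n * \<psi>" "\<psi> / 2"] by (simp add: algebra_simps)
    then show ?case using Suc.IH by (simp add: distrib_left del: of_nat_Suc)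
  qed simp
  have "\<bar>\<Sum>k<n. sin (real k * \<psi>)\<bar> \<le> 1 / \<bar>sin (\<psi> / 2)\<bar>" for n
  proof -
    have "2 * \<bar>sin (\<psi> / 2)\<bar> * \<bar>\<Sum>k<n. sin (real k * \<psi>)\<bar> = \<bar>cos (\<psi> / 2) - cos (real n * \<psi> - \<psi> / 2)\<bar>"
      using arg_cong[OF *[of n], of abs] by (simp add: abs_mult)
    also have "\<dots> \<le> 2"
      using abs_cos_le_one[of "\<psi> / 2"] abs_cos_le_one[of "real n * \<psi> - \<psi> / 2"] by linarith
    finally show ?thesis using False by (simp add: field_simps)
  qed
  then show ?thesis by blast
qed

text \<open>Summation by parts: partial sums starting at \<open>n\<close> are differences of two
  bounded ones, hence the factor \<open>2 * B\<close>. The tail is controlled by the variation of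
  \<open>v\<close>, which is one power smaller than an absolute estimate when the differences of
  \<open>v\<close> gain a power.\<close>

lemma abel_tail:
  fixes v s :: "nat \<Rightarrow> real"
  assumes B: "\<And>n. \<bar>\<Sum>k<n. s k\<bar> \<le> B" and v: "v \<longlonglongrightarrow> 0"
    and dv: "\<And>k. \<bar>v (Suc k) - v k\<bar> \<le> C * real (Suc k) powr (- p)" and p: "p > 1"
    and sm: "summable (\<lambda>k. v k * s k)" and n: "n \<ge> 1"
  shows "\<bar>\<Sum>k. v (k + n) * s (k + n)\<bar> \<le> 2 * B * C / (p - 1) * real n powr (1 - p)"
proof -
  define P where "P k = (\<Sum>j<k. s (j + n))" for k
  have B0: "0 \<le> B" using B[of 0] by simp
  have P: "\<bar>P k\<bar> \<le> 2 * B" for k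
  proof -
    have "(\<Sum>j<k + n. s j) = (\<Sum>j<n. s j) + P k"
      by (induction k) (auto simp: P_def)
    then show ?thesis using B[of "k + n"] B[of n] by linarith
  qed
  have parts: "(\<Sum>k<K. v (k + n) * s (k + n)) = v (K + n) * P K - (\<Sum>k<K. (v (Suc (k + n)) - v (k + n)) * P (Suc k))" for K
  proof (induction K)
    case (Suc K)
    have "P (Suc K) = P K + s (K + n)" by (simp add: P_def)
    then show ?case using Suc.IH by (simp add: algebra_simps)
  qed (simp add: P_def)
  note tail = tail_powr[OF p _ n, of "\<lambda>k. v (Suc k) - v k" C, OF dv]
  let ?T = "\<Sum>k. \<bar>v (Suc (k + n)) - v (k + n)\<bar>"
  have bound: "\<bar>\<Sum>k<K. v (k + n) * s (k + n)\<bar> \<le> \<bar>v (K + n)\<bar> * (2 * B) + 2 * B * ?T" for K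
  proof -
    have "\<bar>\<Sum>k<K. (v (Suc (k + n)) - v (k + n)) * P (Suc k)\<bar> \<le> (\<Sum>k<K. \<bar>v (Suc (k + n)) - v (k + n)\<bar> * (2 * B))"
      by (intro order_trans[OF sum_abs] sum_mono) (simp add: abs_mult mult_left_mono P)
    also have "\<dots> = 2 * B * (\<Sum>k<K. \<bar>v (Suc (k + n)) - v (k + n)\<bar>)"
      by (simp add: sum_distrib_left mult.commute)
    also have "\<dots> \<le> 2 * B * ?T"
      using B0 by (intro mult_left_mono sum_le_suminf tail) auto
    finally have "\<bar>\<Sum>k<K. (v (Suc (k + n)) - v (k + n)) * P (Suc k)\<bar> \<le> 2 * B * ?T" .
    moreover have "\<bar>v (K + n) * P K\<bar> \<le> \<bar>v (K + n)\<bar> * (2 * B)"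
      by (simp add: abs_mult mult_left_mono P)
    ultimately show ?thesis unfolding parts by linarith
  qed
  have "(\<lambda>K. \<bar>\<Sum>k<K. v (k + n) * s (k + n)\<bar>) \<longlonglongrightarrow> \<bar>\<Sum>k. v (k + n) * s (k + n)\<bar>"
    using sm by (intro tendsto_rabs summable_LIMSEQ summable_ignore_initial_segment[where f = "\<lambda>k. v k * s k"])
  moreover have "(\<lambda>K. \<bar>v (K + n)\<bar> * (2 * B) + 2 * B * ?T) \<longlonglongrightarrow> \<bar>0\<bar> * (2 * B) + 2 * B * ?T"
    by (intro tendsto_intros LIMSEQ_ignore_initial_segment v)
  ultimately have "\<bar>\<Sum>k. v (k + n) * s (k + n)\<bar> \<le> \<bar>0\<bar> * (2 * B) + 2 * B * ?T"
    by (rule LIMSEQ_le) (use bound in blast)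
  also have "\<dots> \<le> 2 * B * (C / (p - 1) * real n powr (1 - p))"
    using B0 mult_left_mono[OF tail(2), of "2 * B"] by simp
  finally show ?thesis by simp
qed

section \<open>Errors of the differentiated projection\<close>

declare sinpow_coeff.simps(2) [simp del]

text \<open>The interface between coefficient asymptotics and error analysis. Here \<open>g\<close>
  is \<alpha> for an interior singularity and 2 \<alpha> for an endpoint one, and
  \<open>cos \<phi>\<close> is the singular point.\<close>

definition cheb_asymp :: "real \<Rightarrow> real \<Rightarrow> (real \<Rightarrow> real) \<Rightarrow> bool" where
  "cheb_asymp g \<phi> f \<longleftrightarrow>
     (\<forall>x\<in>Omega. (\<lambda>k. cheb_coeff f (Suc k) * cheb_T (Suc k) x) sums (f x - cheb_coeff f 0 / 2)) \<and>
     (\<exists>A E. \<forall>k. \<bar>cheb_coeff f k - A * sinpow_coeff g k * cos (real k * \<phi>)\<bar> \<le> E * (1 + real k) powr (- (g + 2)))"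

lemma cheb_asympD:
  assumes "cheb_asymp g \<phi> f" "x \<in> Omega"
  shows "(\<lambda>k. cheb_coeff f (Suc k) * cheb_T (Suc k) x) sums (f x - cheb_coeff f 0 / 2)"
  using assms by (auto simp: cheb_asymp_def)

lemma mult_powr_real_antimono:
  assumes "real m \<le> x" "0 \<le> C" "0 \<le> q" "m > 0"
  shows "C * x powr (- q) \<le> C * real m powr (- q)"
  using assms by (intro mult_left_mono powr_mono2') auto

lemma cheb_asymp_bound:
  assumes "cheb_asymp g \<phi> f" "g > 1"
  obtains C where "0 \<le> C" "\<And>k. \<bar>cheb_coeff f k\<bar> \<le> C * real (Suc k) powr (- (g + 1))"
proof -
  obtain A E where AE: "\<And>k. \<bar>cheb_coeff f k - A * sinpow_coeff g k * cos (real k * \<phi>)\<bar> \<le> E * (1 + real k) powr (- (g + 2))"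
    using assms(1) by (auto simp: cheb_asymp_def)
  obtain B where B: "\<And>k. \<bar>sinpow_coeff g k\<bar> \<le> B * (1 + real k) powr (- (g + 1))"
    using sinpow_coeff_decay[of g] assms by auto
  have E: "0 \<le> E" using order_trans[OF abs_ge_zero AE[of 0]] by simp
  have B0: "0 \<le> B" using order_trans[OF abs_ge_zero B[of 0]] by simp
  have "\<bar>cheb_coeff f k\<bar> \<le> (E + \<bar>A\<bar> * B) * real (Suc k) powr (- (g + 1))" for k
  proof -
    have "E * (1 + real k) powr (- (g + 2)) \<le> E * (1 + real k) powr (- (g + 1))"
      using E by (intro mult_left_mono powr_mono) auto
    moreover have "\<bar>A * sinpow_coeff g k * cos (real k * \<phi>)\<bar> \<le> \<bar>A\<bar> * (B * (1 + real k) powr (- (g + 1)))"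
    proof -
      have "\<bar>A * sinpow_coeff g k\<bar> * \<bar>cos (real k * \<phi>)\<bar> \<le> \<bar>A * sinpow_coeff g k\<bar>"
        by (rule mult_left_le) auto
      also have "\<dots> \<le> \<bar>A\<bar> * (B * (1 + real k) powr (- (g + 1)))"
        unfolding abs_mult by (intro mult_left_mono B) auto
      finally show ?thesis by (simp add: abs_mult)
    qed
    ultimately show ?thesis
      using AE[of k] by (simp add: algebra_simps)
  qed
  then show ?thesis using that[of "E + \<bar>A\<bar> * B"] E B0 by simp
qed

text \<open>These are the coefficients of (x - cos \<phi>) f. By the identity 2 cos \<phi> cos
  ((k+1) \<phi>) = cos ((k+2) \<phi>) + cos (k \<phi>), only differences of consecutive amplitudes
  survive in the leading part, which is one order smaller.\<close>

lemma cheb_asymp_second_difference: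
  assumes "cheb_asymp g \<phi> f" "g > 1"
  obtains C where "0 \<le> C"
    "\<And>k. \<bar>(cheb_coeff f (Suc (Suc k)) + cheb_coeff f k) / 2 - cos \<phi> * cheb_coeff f (Suc k)\<bar>
         \<le> C * real (Suc k) powr (- (g + 2))"
proof -
  obtain A E where AE: "\<And>k. \<bar>cheb_coeff f k - A * sinpow_coeff g k * cos (real k * \<phi>)\<bar> \<le> E * (1 + real k) powr (- (g + 2))"
    using assms(1) by (auto simp: cheb_asymp_def)
  obtain B where B: "\<And>k. \<bar>sinpow_coeff g (Suc k) - sinpow_coeff g k\<bar> \<le> B * (1 + real k) powr (- (g + 2))"
    using sinpow_coeff_decay_diff[of g] assms by auto
  have E: "0 \<le> E" using order_trans[OF abs_ge_zero AE[of 0]] by simp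
  have B0: "0 \<le> B" using order_trans[OF abs_ge_zero B[of 0]] by simp
  have "\<bar>(cheb_coeff f (Suc (Suc k)) + cheb_coeff f k) / 2 - cos \<phi> * cheb_coeff f (Suc k)\<bar>
         \<le> (2 * E + \<bar>A\<bar> * B) * real (Suc k) powr (- (g + 2))" for k
  proof -
    let ?P = "real (Suc k) powr (- (g + 2))"
    define r where "r j = cheb_coeff f j - A * sinpow_coeff g j * cos (real j * \<phi>)" for j
    have r: "\<bar>r j\<bar> \<le> E * ?P" if "j \<ge> k" for j
    proof -
      have "\<bar>r j\<bar> \<le> E * (1 + real j) powr (- (g + 2))"
        using AE[of j] by (simp add: r_def)
      also have "\<dots> \<le> E * ?P"
        using that E assms by (intro mult_powr_real_antimono) auto
      finally show ?thesis .
    qed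
    have d: "\<bar>sinpow_coeff g (Suc j) - sinpow_coeff g j\<bar> \<le> B * ?P" if "j \<ge> k" for j
    proof -
      have "\<bar>sinpow_coeff g (Suc j) - sinpow_coeff g j\<bar> \<le> B * (1 + real j) powr (- (g + 2))"
        using B[of j] by simp
      also have "\<dots> \<le> B * ?P"
        using that B0 assms by (intro mult_powr_real_antimono) auto
      finally show ?thesis .
    qed
    define c0 c2 where "c0 = cos (real k * \<phi>)" and "c2 = cos (real (Suc (Suc k)) * \<phi>)"
    have c: "2 * (cos \<phi> * cos (real (Suc k) * \<phi>)) = c0 + c2"
    proof -
      have "cos (real (Suc k) * \<phi> + \<phi>) + cos (real (Suc k) * \<phi> - \<phi>) = 2 * (cos \<phi> * cos (real (Suc k) * \<phi>))"
        by (simp only: cos_add cos_diff) simp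
      then show ?thesis unfolding c0_def c2_def by (simp add: algebra_simps)
    qed
    have "(cheb_coeff f (Suc (Suc k)) + cheb_coeff f k) / 2 - cos \<phi> * cheb_coeff f (Suc k)
      = (r (Suc (Suc k)) + r k) / 2 - cos \<phi> * r (Suc k)
        + A / 2 * (sinpow_coeff g (Suc (Suc k)) * c2 + sinpow_coeff g k * c0 - sinpow_coeff g (Suc k) * (2 * (cos \<phi> * cos (real (Suc k) * \<phi>))))"
      unfolding r_def c0_def c2_def by (simp add: field_simps del: of_nat_Suc)
    also have "\<dots> = r (Suc (Suc k)) / 2 + r k / 2 - cos \<phi> * r (Suc k)
        + A / 2 * ((sinpow_coeff g (Suc (Suc k)) - sinpow_coeff g (Suc k)) * c2) - A / 2 * ((sinpow_coeff g (Suc k) - sinpow_coeff g k) * c0)"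
      unfolding c by (simp add: field_simps)
    finally have eq: "(cheb_coeff f (Suc (Suc k)) + cheb_coeff f k) / 2 - cos \<phi> * cheb_coeff f (Suc k) = \<dots>" .
    have b1: "\<bar>cos \<phi> * r (Suc k)\<bar> \<le> E * ?P"
      using mult_left_le_one_le[of "\<bar>r (Suc k)\<bar>" "\<bar>cos \<phi>\<bar>"] r[of "Suc k"] by (simp add: abs_mult)
    have b2: "\<bar>A / 2 * ((sinpow_coeff g (Suc j) - sinpow_coeff g j) * cos y)\<bar> \<le> \<bar>A\<bar> / 2 * (B * ?P)" if "j \<ge> k" for j y
    proof -
      have "\<bar>sinpow_coeff g (Suc j) - sinpow_coeff g j\<bar> * \<bar>cos y\<bar> \<le> \<bar>sinpow_coeff g (Suc j) - sinpow_coeff g j\<bar>"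
        by (rule mult_left_le) auto
      then have "\<bar>(sinpow_coeff g (Suc j) - sinpow_coeff g j) * cos y\<bar> \<le> B * ?P"
        using d[OF that] by (simp add: abs_mult)
      from mult_left_mono[OF this, of "\<bar>A\<bar> / 2"] show ?thesis
        by (simp add: abs_mult)
    qed
    have b3: "\<bar>r (Suc (Suc k)) / 2\<bar> \<le> E * ?P / 2" "\<bar>r k / 2\<bar> \<le> E * ?P / 2"
      using r[of "Suc (Suc k)"] r[of k] by auto
    have "\<bar>(cheb_coeff f (Suc (Suc k)) + cheb_coeff f k) / 2 - cos \<phi> * cheb_coeff f (Suc k)\<bar>
      \<le> E * ?P / 2 + E * ?P / 2 + E * ?P + \<bar>A\<bar> / 2 * (B * ?P) + \<bar>A\<bar> / 2 * (B * ?P)"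
      unfolding eq c2_def c0_def
      using b1 b3 b2[of "Suc k" "real (Suc (Suc k)) * \<phi>", OF le_SucI[OF order_refl]] b2[of k "real k * \<phi>", OF order_refl]
      by linarith
    also have "\<dots> = (2 * E + \<bar>A\<bar> * B) * ?P" by (simp add: algebra_simps)
    finally show ?thesis .
  qed
  then show ?thesis using that[of "2 * E + \<bar>A\<bar> * B"] E B0 by simp
qed

section \<open>The error as a tail, and its rate at interior points\<close>

lemma deriv_error_tail:
  assumes x: "x \<in> Omega" and s: "summable (\<lambda>k. cheb_coeff f (Suc k) * cheb_dT (Suc k) x)"
    and d: "((\<lambda>y. f y - cheb_coeff f 0 / 2) has_real_derivative (\<Sum>k. cheb_coeff f (Suc k) * cheb_dT (Suc k) x)) (at x within Omega)"
  shows "deriv_error f x n = \<bar>\<Sum>k. cheb_coeff f (Suc (k + n)) * cheb_dT (Suc (k + n)) x\<bar>"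
proof -
  have "((\<lambda>y. (f y - cheb_coeff f 0 / 2) + cheb_coeff f 0 / 2) has_real_derivative
      (\<Sum>k. cheb_coeff f (Suc k) * cheb_dT (Suc k) x) + 0) (at x within Omega)"
    by (intro DERIV_add d DERIV_const)
  then have "deriv_Omega f x = (\<Sum>k. cheb_coeff f (Suc k) * cheb_dT (Suc k) x)"
    by (intro deriv_Omega_eq[OF x]) simp
  moreover have "deriv_Omega (cheb_proj f n) x = (\<Sum>k<n. cheb_coeff f (Suc k) * cheb_dT (Suc k) x)"
    by (rule deriv_Omega_eq[OF x DERIV_cheb_proj[OF x]])
  ultimately show ?thesis
    using suminf_split_initial_segment[OF s, of n] by (simp add: deriv_error_def del: cheb_dT.simps)
qed

lemma Suc_power_mult_powr:
  "real (Suc k) * real (Suc k) powr (- (q + 1)) = real (Suc k) powr (- q)"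
  "real (Suc k) * real (Suc k) powr (- (q + 2)) = real (Suc k) powr (- (q + 1))"
  "(real (Suc k))\<^sup>2 * real (Suc k) powr (- (q + 2)) = real (Suc k) powr (- q)"
  "(real (Suc k))\<^sup>2 * real (Suc k) powr (- (q + 1)) = real (Suc k) powr (- (q - 1))"
proof -
  have *: "real (Suc k) * real (Suc k) powr p = real (Suc k) powr (1 + p)"
    "(real (Suc k))\<^sup>2 * real (Suc k) powr p = real (Suc k) powr (2 + p)" for p
    unfolding powr_add by (simp_all only: powr_one powr_numeral of_nat_0_le_iff of_nat_0_less_iff zero_less_Suc)
  show "real (Suc k) * real (Suc k) powr (- (q + 1)) = real (Suc k) powr (- q)"
    "real (Suc k) * real (Suc k) powr (- (q + 2)) = real (Suc k) powr (- (q + 1))"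
    "(real (Suc k))\<^sup>2 * real (Suc k) powr (- (q + 2)) = real (Suc k) powr (- q)"
    "(real (Suc k))\<^sup>2 * real (Suc k) powr (- (q + 1)) = real (Suc k) powr (- (q - 1))"
    unfolding * by (rule arg_cong[where f = "\<lambda>p. real (Suc k) powr p"], simp)+
qed

lemma summable_Suc_powr:
  assumes "p > 1" shows "summable (\<lambda>k. real (Suc k) powr (- p))"
  by (subst summable_Suc_iff) (use assms in \<open>simp add: summable_real_powr_iff\<close>)

lemma suminf_tail_abs_le:
  assumes "p > 1" "\<And>k. \<bar>s k\<bar> \<le> C * real (Suc k) powr (- p)" "n \<ge> 1"
  shows "\<bar>\<Sum>k. s (k + n)\<bar> \<le> C / (p - 1) * real n powr (1 - p)"
  using tail_powr[of p n s C] assms summable_rabs[of "\<lambda>k. s (k + n)"] by force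

text \<open>On a compact interval around \<open>x\<close> inside (-1, 1) the derivative of T_k is
  O(k), so the terms are O(k^(-g)), summable for \<open>g > 1\<close>.\<close>

lemma cheb_asymp_DERIV_interior:
  assumes f: "cheb_asymp g \<phi> f" and g: "g > 1" and x: "-1 < x" "x < 1"
  shows "((\<lambda>y. f y - cheb_coeff f 0 / 2) has_real_derivative (\<Sum>k. cheb_coeff f (Suc k) * cheb_dT (Suc k) x)) (at x within Omega)"
    and "summable (\<lambda>k. cheb_coeff f (Suc k) * cheb_dT (Suc k) x)"
proof -
  obtain C where C: "0 \<le> C" "\<And>k. \<bar>cheb_coeff f k\<bar> \<le> C * real (Suc k) powr (- (g + 1))"
    using cheb_asymp_bound[OF f g] by blast
  \<comment> \<open>The midpoint between |x| and 1, which leaves room on both sides.\<close>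
  define r where "r = (1 + \<bar>x\<bar>) / 2"
  have r: "0 < r" "r < 1" "\<bar>x\<bar> < r" using x by (auto simp: r_def)
  define S where "S = {-r..r}"
  define q where "q = sqrt (1 - r\<^sup>2)"
  have q: "q > 0" using r by (simp add: q_def abs_square_less_1)
  have S: "convex S" "S \<subseteq> Omega" "x \<in> S" "x \<in> interior S" using r by (auto simp: S_def)
  have M: "\<bar>cheb_dT (Suc k) y\<bar> \<le> real (Suc k) / q" if "y \<in> S" for k y
  proof -
    have y: "\<bar>y\<bar> \<le> r" using that by (auto simp: S_def)
    then have "y\<^sup>2 \<le> r\<^sup>2" using r by (intro power2_le_iff_abs_le[THEN iffD2]) auto
    then have "q \<le> sqrt (1 - y\<^sup>2)" by (simp add: q_def)
    have "\<bar>cheb_dT (Suc k) y\<bar> \<le> real (Suc k) / sqrt (1 - y\<^sup>2)"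
      using y r by (intro abs_cheb_dT_interior) auto
    also have "\<dots> \<le> real (Suc k) / q"
      using \<open>q \<le> sqrt (1 - y\<^sup>2)\<close> q by (intro divide_left_mono mult_pos_pos) linarith+
    finally show ?thesis .
  qed
  have s: "summable (\<lambda>k. \<bar>cheb_coeff f (Suc k)\<bar> * (real (Suc k) / q))"
  proof (rule summable_comparison_test'[where N = 0])
    show "summable (\<lambda>k. (C / q) * real (Suc k) powr (- g))"
      by (intro summable_mult summable_Suc_powr g)
    fix k
    have "\<bar>cheb_coeff f (Suc k)\<bar> \<le> C * real (Suc k) powr (- (g + 1))"
      using C g by (intro order_trans[OF C(2) mult_powr_real_antimono]) auto
    then have "\<bar>cheb_coeff f (Suc k)\<bar> * (real (Suc k) / q) \<le> (C * real (Suc k) powr (- (g + 1))) * (real (Suc k) / q)"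
      using q by (intro mult_right_mono) auto
    also have "\<dots> = (C / q) * (real (Suc k) * real (Suc k) powr (- (g + 1)))" by simp
    also have "\<dots> = (C / q) * real (Suc k) powr (- g)" unfolding Suc_power_mult_powr by simp
    finally show "norm (\<bar>cheb_coeff f (Suc k)\<bar> * (real (Suc k) / q)) \<le> (C / q) * real (Suc k) powr (- g)"
      using q by simp
  qed
  have F: "(\<lambda>k. cheb_coeff f (Suc k) * cheb_T (Suc k) y) sums (f y - cheb_coeff f 0 / 2)" if "y \<in> S" for y
    using cheb_asympD[OF f] that S by blast
  note D = DERIV_cheb_series[OF S(1-3) M s F]
  show "summable (\<lambda>k. cheb_coeff f (Suc k) * cheb_dT (Suc k) x)" by (rule D(2))
  have "((\<lambda>y. f y - cheb_coeff f 0 / 2) has_real_derivative (\<Sum>k. cheb_coeff f (Suc k) * cheb_dT (Suc k) x)) (at x)"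
    using D(1) at_within_interior[OF S(4)] by simp
  then show "((\<lambda>y. f y - cheb_coeff f 0 / 2) has_real_derivative (\<Sum>k. cheb_coeff f (Suc k) * cheb_dT (Suc k) x)) (at x within Omega)"
    by (rule has_field_derivative_at_within)
qed

lemma bigo_powrI:
  assumes "\<And>n. n \<ge> 1 \<Longrightarrow> \<bar>e n\<bar> \<le> C * real n powr p"
  shows "e \<in> O(\<lambda>n. real n powr p)"
  by (rule bigoI[of _ C]) (use assms in \<open>auto simp: eventually_sequentially intro!: exI[of _ 1]\<close>)

text \<open>Modulo an absolutely summable remainder, the tail is a sum of \<open>k b\<^sub>k cos (k \<phi>) sin (k t)\<close>, in which
  no term oscillates with frequency zero except \<open>sin 0 = 0\<close>: this is why the rate does not deteriorate
  at \<open>x = \<xi>\<close>.\<close>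

lemma deriv_error_interior:
  assumes f: "cheb_asymp g \<phi> f" and g: "g > 1" and x: "-1 < x" "x < 1"
  shows "deriv_error f x \<in> O(\<lambda>n. real n powr (- g))"
proof -
  obtain A E where AE: "\<And>k. \<bar>cheb_coeff f k - A * sinpow_coeff g k * cos (real k * \<phi>)\<bar> \<le> E * (1 + real k) powr (- (g + 2))"
    using f by (auto simp: cheb_asymp_def)
  have E: "0 \<le> E" using order_trans[OF abs_ge_zero AE[of 0]] by simp
  obtain B where B: "\<And>k. \<bar>sinpow_coeff g k\<bar> \<le> B * (1 + real k) powr (- (g + 1))"
     "\<And>k. \<bar>sinpow_coeff g (Suc k) - sinpow_coeff g k\<bar> \<le> B * (1 + real k) powr (- (g + 2))"
    using sinpow_coeff_decay_diff[of g] g by auto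
  have B0: "0 \<le> B" using order_trans[OF abs_ge_zero B(1)[of 0]] by simp
  obtain t where t: "t \<in> {0..pi}" "x = cos t" using Omega_cos[of x] x by auto
  have "t \<noteq> 0" "t \<noteq> pi" using t x by auto
  then have st: "sin t > 0" using t by (intro sin_gt_zero) auto
  define v where "v k = real (Suc k) * sinpow_coeff g (Suc k)" for k
  define s where "s \<psi> k = sin (real (Suc k) * \<psi>)" for \<psi> and k :: nat
  \<comment> \<open>The part of the tail beyond the leading term; its order \<open>- (g + 1)\<close>
    is small enough to be summed absolutely.\<close>
  define \<rho> where "\<rho> k = real (Suc k) * (cheb_coeff f (Suc k) - A * sinpow_coeff g (Suc k) * cos (real (Suc k) * \<phi>)) * s t k" for k
  have \<rho>: "\<bar>\<rho> k\<bar> \<le> E * real (Suc k) powr (- (g + 1))" for k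
  proof -
    have "\<bar>\<rho> k\<bar> \<le> real (Suc k) * \<bar>cheb_coeff f (Suc k) - A * sinpow_coeff g (Suc k) * cos (real (Suc k) * \<phi>)\<bar>"
      unfolding \<rho>_def s_def abs_mult by (rule order_trans[OF mult_left_le]) auto
    also have "\<dots> \<le> real (Suc k) * (E * (1 + real (Suc k)) powr (- (g + 2)))"
      using AE[of "Suc k"] by (intro mult_left_mono) auto
    also have "\<dots> \<le> real (Suc k) * (E * real (Suc k) powr (- (g + 2)))"
      using E g by (intro mult_left_mono mult_powr_real_antimono) auto
    also have "\<dots> = E * (real (Suc k) * real (Suc k) powr (- (g + 2)))" by simp
    finally show ?thesis unfolding Suc_power_mult_powr .
  qed
  have vb: "\<bar>v k\<bar> \<le> B * real (Suc k) powr (- g)" for k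
  proof -
    have "\<bar>v k\<bar> \<le> real (Suc k) * (B * (1 + real (Suc k)) powr (- (g + 1)))"
      unfolding v_def abs_mult using B(1)[of "Suc k"] by (intro mult_mono) auto
    also have "\<dots> \<le> real (Suc k) * (B * real (Suc k) powr (- (g + 1)))"
      using B0 g by (intro mult_left_mono mult_powr_real_antimono) auto
    also have "\<dots> = B * (real (Suc k) * real (Suc k) powr (- (g + 1)))" by simp
    finally show ?thesis unfolding Suc_power_mult_powr .
  qed
  have dv: "\<bar>v (Suc k) - v k\<bar> \<le> (2 * B) * real (Suc k) powr (- (g + 1))" for k
  proof -
    let ?y = "real (Suc (Suc k))"
    have "v (Suc k) - v k = ?y * (sinpow_coeff g (Suc (Suc k)) - sinpow_coeff g (Suc k)) + sinpow_coeff g (Suc k)"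
      by (simp add: v_def algebra_simps)
    also have "\<bar>\<dots>\<bar> \<le> ?y * (B * ?y powr (- (g + 2))) + B * ?y powr (- (g + 1))"
    proof (intro order_trans[OF abs_triangle_ineq] add_mono)
      show "\<bar>?y * (sinpow_coeff g (Suc (Suc k)) - sinpow_coeff g (Suc k))\<bar> \<le> ?y * (B * ?y powr (- (g + 2)))"
        unfolding abs_mult using B(2)[of "Suc k"] by (intro mult_mono) auto
      show "\<bar>sinpow_coeff g (Suc k)\<bar> \<le> B * ?y powr (- (g + 1))" using B(1)[of "Suc k"] by simp
    qed
    also have "\<dots> = B * (?y * ?y powr (- (g + 2))) + B * ?y powr (- (g + 1))" by simp
    also have "\<dots> = (2 * B) * ?y powr (- (g + 1))" unfolding Suc_power_mult_powr by simp
    also have "\<dots> \<le> (2 * B) * real (Suc k) powr (- (g + 1))"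
      using B0 g by (intro mult_powr_real_antimono) auto
    finally show ?thesis .
  qed
  have "(\<lambda>k. B * real (Suc k) powr (- g)) \<longlonglongrightarrow> 0"
    using summable_LIMSEQ_zero[OF summable_mult[OF summable_Suc_powr[OF g]]] .
  then have v0: "v \<longlonglongrightarrow> 0"
    by (rule Lim_null_comparison[rotated]) (use vb in auto)
  have sv: "summable (\<lambda>k. v k * s \<psi> k)" for \<psi>
  proof (rule summable_comparison_test'[where N = 0])
    show "summable (\<lambda>k. B * real (Suc k) powr (- g))" by (intro summable_mult summable_Suc_powr g)
    show "norm (v k * s \<psi> k) \<le> B * real (Suc k) powr (- g)" for k
      unfolding real_norm_def abs_mult s_def by (rule order_trans[OF mult_left_le vb]) auto
  qed
  obtain K where K: "\<And>n. \<bar>\<Sum>k<n. s (t + \<phi>) k\<bar> \<le> K" "\<And>n. \<bar>\<Sum>k<n. s (t - \<phi>) k\<bar> \<le> K"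
  proof -
    have "\<exists>K. \<forall>n. \<bar>\<Sum>k<n. s \<psi> k\<bar> \<le> K" for \<psi>
    proof -
      obtain K where "\<And>n. \<bar>\<Sum>k<n. sin (real k * \<psi>)\<bar> \<le> K" using sin_partial_sums_bounded by blast
      \<comment> \<open>The sums of \<open>s\<close> start at frequency one; prepending the zero
        term sin 0 brings them into the form of the bounded sums.\<close>
      from this[of "Suc _"] have "\<bar>\<Sum>k<n. s \<psi> k\<bar> \<le> K" for n
        unfolding sum.lessThan_Suc_shift s_def by simp
      then show ?thesis by blast
    qed
    then obtain K1 K2 where "\<And>n. \<bar>\<Sum>k<n. s (t + \<phi>) k\<bar> \<le> K1" "\<And>n. \<bar>\<Sum>k<n. s (t - \<phi>) k\<bar> \<le> K2" by meson
    then show ?thesis using that[of "max K1 K2"] by (simp add: le_max_iff_disj)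
  qed
  \<comment> \<open>Product-to-sum: sin (k t) cos (k \<phi>) splits into the frequencies
    \<open>t + \<phi>\<close> and \<open>t - \<phi>\<close>, each handled by summation by
    parts.\<close>
  have terms: "cheb_coeff f (Suc k) * cheb_dT (Suc k) x
      = 1 / sin t * (A / 2 * (v k * s (t + \<phi>) k) + A / 2 * (v k * s (t - \<phi>) k) + \<rho> k)" for k
  proof -
    have "cheb_dT (Suc k) x = real (Suc k) * s t k / sin t"
      using cheb_dT_sin[OF t(1), of "Suc k"] st t(2) by (simp add: s_def field_simps del: cheb_dT.simps of_nat_Suc)
    moreover have "s (t + \<phi>) k + s (t - \<phi>) k = 2 * s t k * cos (real (Suc k) * \<phi>)"
      using sin_add[of "real (Suc k) * t" "real (Suc k) * \<phi>"] sin_diff[of "real (Suc k) * t" "real (Suc k) * \<phi>"]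
      unfolding s_def by (simp only: distrib_left right_diff_distrib)
    then have "A / 2 * (v k * s (t + \<phi>) k) + A / 2 * (v k * s (t - \<phi>) k)
        = A * v k * (s t k * cos (real (Suc k) * \<phi>))"
      by (simp only: distrib_left[symmetric])
    ultimately show ?thesis
      by (simp add: \<rho>_def v_def algebra_simps add_divide_distrib[symmetric] del: of_nat_Suc)
  qed
  have "\<bar>deriv_error f x n\<bar> \<le> 1 / sin t * (\<bar>A\<bar> * (2 * K * (2 * B) / g) + E / g) * real n powr (- g)" if n: "n \<ge> 1" for n
  proof -
    let ?s1 = "\<Sum>k. v (k + n) * s (t + \<phi>) (k + n)" and ?s2 = "\<Sum>k. v (k + n) * s (t - \<phi>) (k + n)"
    have sr: "summable (\<lambda>k. \<rho> (k + n))"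
      by (rule summable_rabs_cancel[OF tail_powr(1)[OF _ \<rho> n]]) (use g in simp)
    have sv': "summable (\<lambda>k. v (k + n) * s \<psi> (k + n))" for \<psi>
      by (rule summable_ignore_initial_segment[OF sv])
    have "deriv_error f x n = \<bar>\<Sum>k. cheb_coeff f (Suc (k + n)) * cheb_dT (Suc (k + n)) x\<bar>"
      using x by (intro deriv_error_tail cheb_asymp_DERIV_interior[OF f g x]) auto
    also have "(\<Sum>k. cheb_coeff f (Suc (k + n)) * cheb_dT (Suc (k + n)) x)
       = 1 / sin t * (A / 2 * ?s1 + A / 2 * ?s2 + (\<Sum>k. \<rho> (k + n)))"
      unfolding terms
      by (intro sums_unique[symmetric] sums_mult sums_add summable_sums sr sv')
    also have "\<bar>\<dots>\<bar> = 1 / sin t * \<bar>A / 2 * ?s1 + A / 2 * ?s2 + (\<Sum>k. \<rho> (k + n))\<bar>"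
      using st by (simp add: abs_mult)
    also have "\<dots> \<le> 1 / sin t * ((\<bar>A\<bar> * (2 * K * (2 * B) / g) + E / g) * real n powr (- g))"
    proof (intro mult_left_mono)
      have 1: "\<bar>?s1\<bar> \<le> 2 * K * (2 * B) / g * real n powr (- g)"
        using abel_tail[OF K(1) v0 dv _ sv n] g by simp
      have 2: "\<bar>?s2\<bar> \<le> 2 * K * (2 * B) / g * real n powr (- g)"
        using abel_tail[OF K(2) v0 dv _ sv n] g by simp
      have 3: "\<bar>\<Sum>k. \<rho> (k + n)\<bar> \<le> E / g * real n powr (- g)"
        using suminf_tail_abs_le[of "g + 1" \<rho> E n] \<rho> g n by simp
      have "\<bar>A / 2 * ?s1 + A / 2 * ?s2 + (\<Sum>k. \<rho> (k + n))\<bar>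
         \<le> \<bar>A\<bar> / 2 * \<bar>?s1\<bar> + \<bar>A\<bar> / 2 * \<bar>?s2\<bar> + \<bar>\<Sum>k. \<rho> (k + n)\<bar>"
        by (intro order_trans[OF abs_triangle_ineq] add_right_mono) (simp add: abs_mult abs_triangle_ineq[THEN order_trans])
      also have "\<dots> \<le> \<bar>A\<bar> / 2 * (2 * K * (2 * B) / g * real n powr (- g))
          + \<bar>A\<bar> / 2 * (2 * K * (2 * B) / g * real n powr (- g)) + E / g * real n powr (- g)"
        by (intro add_mono mult_left_mono 1 2 3) auto
      also have "\<dots> = (\<bar>A\<bar> * (2 * K * (2 * B) / g) + E / g) * real n powr (- g)"
        by (simp add: algebra_simps)
      finally show "\<bar>A / 2 * ?s1 + A / 2 * ?s2 + (\<Sum>k. \<rho> (k + n))\<bar>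
        \<le> (\<bar>A\<bar> * (2 * K * (2 * B) / g) + E / g) * real n powr (- g)" .
    qed (use st in simp)
    finally show ?thesis by (simp add: deriv_error_def mult.assoc)
  qed
  then show ?thesis by (rule bigo_powrI)
qed

text \<open>For \<open>g > 2\<close> even the Markov factor k^2 leaves a summable majorant, so
  differentiation is possible up to the boundary.\<close>

lemma cheb_asymp_DERIV_Omega:
  assumes f: "cheb_asymp g \<phi> f" and g: "g > 2" and x: "x \<in> Omega"
  shows "((\<lambda>y. f y - cheb_coeff f 0 / 2) has_real_derivative (\<Sum>k. cheb_coeff f (Suc k) * cheb_dT (Suc k) x)) (at x within Omega)"
    and "summable (\<lambda>k. cheb_coeff f (Suc k) * cheb_dT (Suc k) x)"
    and "\<exists>C. \<forall>k. \<bar>cheb_coeff f (Suc k) * cheb_dT (Suc k) x\<bar> \<le> C * real (Suc k) powr (- (g - 1))"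
proof -
  have g1: "g > 1" using g by simp
  obtain C where C: "0 \<le> C" "\<And>k. \<bar>cheb_coeff f k\<bar> \<le> C * real (Suc k) powr (- (g + 1))"
    using cheb_asymp_bound[OF f g1] by blast
  have b: "\<bar>cheb_coeff f (Suc k)\<bar> * (real (Suc k))\<^sup>2 \<le> C * real (Suc k) powr (- (g - 1))" for k
  proof -
    have "\<bar>cheb_coeff f (Suc k)\<bar> \<le> C * real (Suc k) powr (- (g + 1))"
      using C g by (intro order_trans[OF C(2) mult_powr_real_antimono]) auto
    then have "\<bar>cheb_coeff f (Suc k)\<bar> * (real (Suc k))\<^sup>2 \<le> (C * real (Suc k) powr (- (g + 1))) * (real (Suc k))\<^sup>2"
      by (intro mult_right_mono) auto
    also have "\<dots> = C * ((real (Suc k))\<^sup>2 * real (Suc k) powr (- (g + 1)))" by (simp only: mult_ac)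
    finally show ?thesis unfolding Suc_power_mult_powr .
  qed
  have s: "summable (\<lambda>k. \<bar>cheb_coeff f (Suc k)\<bar> * (real (Suc k))\<^sup>2)"
  proof (rule summable_comparison_test'[where N = 0])
    show "summable (\<lambda>k. C * real (Suc k) powr (- (g - 1)))"
      using g by (intro summable_mult summable_Suc_powr) simp
    show "norm (\<bar>cheb_coeff f (Suc k)\<bar> * (real (Suc k))\<^sup>2) \<le> C * real (Suc k) powr (- (g - 1))" for k
      using b[of k] by (simp add: abs_mult)
  qed
  note D = DERIV_cheb_series[OF convex_real_interval(5) order_refl x abs_cheb_dT_le s cheb_asympD[OF f]]
  show "((\<lambda>y. f y - cheb_coeff f 0 / 2) has_real_derivative (\<Sum>k. cheb_coeff f (Suc k) * cheb_dT (Suc k) x)) (at x within Omega)"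
    "summable (\<lambda>k. cheb_coeff f (Suc k) * cheb_dT (Suc k) x)"
    using D by blast+
  have "\<bar>cheb_coeff f (Suc k) * cheb_dT (Suc k) x\<bar> \<le> C * real (Suc k) powr (- (g - 1))" for k
    unfolding abs_mult by (rule order_trans[OF mult_left_mono[OF abs_cheb_dT_le[OF x]] b]) simp
  then show "\<exists>C. \<forall>k. \<bar>cheb_coeff f (Suc k) * cheb_dT (Suc k) x\<bar> \<le> C * real (Suc k) powr (- (g - 1))"
    by blast
qed

text \<open>Meant for an endpoint that is itself singular. There the sign of T_k' and that of cos (k
  \<phi>) alternate together or not at all, so the leading terms do not cancel and the absolute
  estimate is the natural one.\<close>

lemma deriv_error_endpoint:
  assumes f: "cheb_asymp g \<phi> f" and g: "g > 2" and x: "x \<in> Omega"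
  shows "deriv_error f x \<in> O(\<lambda>n. real n powr (2 - g))"
proof -
  note D = cheb_asymp_DERIV_Omega[OF assms]
  obtain C where C: "\<And>k. \<bar>cheb_coeff f (Suc k) * cheb_dT (Suc k) x\<bar> \<le> C * real (Suc k) powr (- (g - 1))"
    using D(3) by blast
  have "\<bar>deriv_error f x n\<bar> \<le> C / (g - 1 - 1) * real n powr (1 - (g - 1))" if "n \<ge> 1" for n
    unfolding deriv_error_tail[OF x D(2,1)] abs_idempotent
    by (rule suminf_tail_abs_le[OF _ C that]) (use g in simp)
  then show ?thesis using bigo_powrI[of "deriv_error f x" "C / (g - 1 - 1)" "2 - g"] by simp
qed

text \<open>Multiplication by x averages neighbouring Chebyshev polynomials. Cutting the sum at
  \<open>n\<close> leaves an explicit boundary term, kept exactly because it enters the error of the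
  projection.\<close>

lemma cheb_partial_mult:
  fixes c :: "nat \<Rightarrow> real"
  assumes y: "y \<in> Omega"
  shows "(y - \<xi>) * (c 0 / 2 + (\<Sum>k<n. c (Suc k) * cheb_T (Suc k) y))
     = c 1 / 2 - \<xi> * c 0 / 2 + (\<Sum>k<n. ((c (Suc (Suc k)) + c k) / 2 - \<xi> * c (Suc k)) * cheb_T (Suc k) y)
       + (c n * cheb_T (Suc n) y - c (Suc n) * cheb_T n y) / 2"
proof (induction n)
  case 0
  then show ?case using y by (simp add: cheb_T_1 field_simps)
next
  case (Suc n)
  have "(y - \<xi>) * (c (Suc n) * cheb_T (Suc n) y) = ((c (Suc (Suc n)) + c n) / 2 - \<xi> * c (Suc n)) * cheb_T (Suc n) y
     + (c (Suc n) * cheb_T (Suc (Suc n)) y - c (Suc (Suc n)) * cheb_T (Suc n) y) / 2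
     - (c n * cheb_T (Suc n) y - c (Suc n) * cheb_T n y) / 2"
    unfolding cheb_T_rec[OF y] by (simp add: field_simps)
  then show ?case using Suc.IH unfolding sum.lessThan_Suc add.assoc[symmetric] distrib_left by linarith
qed

text \<open>The preceding identity differentiated in \<open>y\<close>, obtained from the recurrence
  of \<open>cheb_dT\<close>.\<close>

lemma cheb_partial_mult_deriv:
  fixes c :: "nat \<Rightarrow> real"
  shows "(y - \<xi>) * (\<Sum>k<n. c (Suc k) * cheb_dT (Suc k) y) + (c 0 / 2 + (\<Sum>k<n. c (Suc k) * cheb_T (Suc k) y))
     = (\<Sum>k<n. ((c (Suc (Suc k)) + c k) / 2 - \<xi> * c (Suc k)) * cheb_dT (Suc k) y)
       + (c n * cheb_dT (Suc n) y - c (Suc n) * cheb_dT n y) / 2"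
proof (induction n)
  case (Suc n)
  have "(y - \<xi>) * (c (Suc n) * cheb_dT (Suc n) y) + c (Suc n) * cheb_T (Suc n) y
     = ((c (Suc (Suc n)) + c n) / 2 - \<xi> * c (Suc n)) * cheb_dT (Suc n) y
     + (c (Suc n) * cheb_dT (Suc (Suc n)) y - c (Suc (Suc n)) * cheb_dT (Suc n) y) / 2
     - (c n * cheb_dT (Suc n) y - c (Suc n) * cheb_dT n y) / 2"
    by (simp add: field_simps)
  then show ?case using Suc.IH unfolding sum.lessThan_Suc add.assoc[symmetric] distrib_left by linarith
qed simp

text \<open>At an endpoint the differentiated series need not converge absolutely. The series of \<open>(x - \<xi>) f\<close>
  does, because multiplication by \<open>x - \<xi>\<close> weakens the singularity, and dividing by \<open>x - \<xi>\<close> costs only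
  two boundary terms.\<close>

lemma deriv_error_endpoint_away:
  assumes f: "cheb_asymp g \<phi> f" and g: "g > 1" and x: "x \<in> Omega" and ne: "x \<noteq> cos \<phi>"
  shows "deriv_error f x \<in> O(\<lambda>n. real n powr (1 - g))"
proof -
  define \<xi> c where "\<xi> = cos \<phi>" and "c = cheb_coeff f"
  \<comment> \<open>The coefficients of (x - \<xi>) f, shifted by one so that \<open>e k\<close>
    belongs to degree \<open>Suc k\<close>.\<close>
  define e where "e k = (c (Suc (Suc k)) + c k) / 2 - \<xi> * c (Suc k)" for k
  obtain C where C: "0 \<le> C" "\<And>k. \<bar>c k\<bar> \<le> C * real (Suc k) powr (- (g + 1))"
    using cheb_asymp_bound[OF f g] unfolding c_def by blast
  obtain D where D: "0 \<le> D" "\<And>k. \<bar>e k\<bar> \<le> D * real (Suc k) powr (- (g + 2))"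
    using cheb_asymp_second_difference[OF f g] unfolding c_def e_def \<xi>_def by blast
  have c0: "c \<longlonglongrightarrow> 0"
  proof (rule Lim_null_comparison)
    show "(\<lambda>k. C * real (Suc k) powr (- (g + 1))) \<longlonglongrightarrow> 0"
      using g by (intro summable_LIMSEQ_zero[OF summable_mult[OF summable_Suc_powr]]) simp
  qed (use C in simp)
  have T0: "(\<lambda>n. c n * cheb_T (Suc n) y - c (Suc n) * cheb_T n y) \<longlonglongrightarrow> 0 - 0" for y
    by (intro tendsto_diff lim_null_mult_right_bounded[where B = 1] c0 LIMSEQ_Suc)
      (simp_all add: abs_cheb_T_le)
  have fs: "(\<lambda>n. \<Sum>k<n. c (Suc k) * cheb_T (Suc k) y) \<longlonglongrightarrow> f y - c 0 / 2" if "y \<in> Omega" for y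
    using cheb_asympD[OF f that] by (simp add: sums_def c_def)
  define \<kappa> where "\<kappa> = c 1 / 2 - \<xi> * c 0 / 2"
  define h where "h y = (y - \<xi>) * f y" for y
  have hs: "(\<lambda>k. e k * cheb_T (Suc k) y) sums (h y - \<kappa>)" if "y \<in> Omega" for y
  proof -
    have "(\<lambda>n. (y - \<xi>) * (c 0 / 2 + (\<Sum>k<n. c (Suc k) * cheb_T (Suc k) y)) - \<kappa>
        - (c n * cheb_T (Suc n) y - c (Suc n) * cheb_T n y) / 2) \<longlonglongrightarrow> (y - \<xi>) * (c 0 / 2 + (f y - c 0 / 2)) - \<kappa> - (0 - 0) / 2"
      by (intro tendsto_intros fs[OF that] T0) simp
    then show ?thesis
      unfolding sums_def cheb_partial_mult[OF that] e_def[symmetric] \<kappa>_def[symmetric] by (simp add: h_def)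
  qed
  have eb: "\<bar>e k\<bar> * (real (Suc k))\<^sup>2 \<le> D * real (Suc k) powr (- g)" for k
  proof -
    have "\<bar>e k\<bar> * (real (Suc k))\<^sup>2 \<le> (D * real (Suc k) powr (- (g + 2))) * (real (Suc k))\<^sup>2"
      by (intro mult_right_mono D) auto
    also have "\<dots> = D * ((real (Suc k))\<^sup>2 * real (Suc k) powr (- (g + 2)))" by (simp only: mult_ac)
    finally show ?thesis unfolding Suc_power_mult_powr .
  qed
  have es: "summable (\<lambda>k. \<bar>e k\<bar> * (real (Suc k))\<^sup>2)"
  proof (rule summable_comparison_test'[where N = 0])
    show "summable (\<lambda>k. D * real (Suc k) powr (- g))"
      using g by (intro summable_mult summable_Suc_powr) simp
    show "norm (\<bar>e k\<bar> * (real (Suc k))\<^sup>2) \<le> D * real (Suc k) powr (- g)" for k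
      using eb[of k] by (simp add: abs_mult)
  qed
  define H where "H = (\<Sum>k. e k * cheb_dT (Suc k) x)"
  note Dh = DERIV_cheb_series[OF convex_real_interval(5) order_refl x abs_cheb_dT_le es hs, folded H_def]
  have ne': "x \<noteq> \<xi>" using ne by (simp add: \<xi>_def)
  \<comment> \<open>The quotient rule recovers the derivative of \<open>f\<close> from that of
    \<open>h\<close>, avoiding termwise differentiation of the series of \<open>f\<close>
    itself.\<close>
  have "((\<lambda>y. ((h y - \<kappa>) + \<kappa>) / (y - \<xi>)) has_real_derivative (((H + 0) * (x - \<xi>) - ((h x - \<kappa>) + \<kappa>) * (1 - 0)) / ((x - \<xi>) * (x - \<xi>)))) (at x within Omega)"
    using ne' by (intro DERIV_divide DERIV_add Dh(1) DERIV_const DERIV_diff DERIV_ident) auto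
  moreover have "((H + 0) * (x - \<xi>) - ((h x - \<kappa>) + \<kappa>) * (1 - 0)) / ((x - \<xi>) * (x - \<xi>)) = (H - f x) / (x - \<xi>)"
    using ne' by (simp add: h_def divide_simps) (simp add: algebra_simps)
  ultimately have "((\<lambda>y. h y / (y - \<xi>)) has_real_derivative (H - f x) / (x - \<xi>)) (at x within Omega)"
    by simp
  then have "(f has_real_derivative (H - f x) / (x - \<xi>)) (at x within Omega)"
    by (rule has_field_derivative_transform_within[where d = "\<bar>x - \<xi>\<bar>"])
      (use ne' x in \<open>auto simp: h_def dist_real_def\<close>)
  then have df: "deriv_Omega f x = (H - f x) / (x - \<xi>)" by (rule deriv_Omega_eq[OF x])
  have dn: "deriv_Omega (cheb_proj f n) x = (\<Sum>k<n. c (Suc k) * cheb_dT (Suc k) x)" for n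
    unfolding c_def by (rule deriv_Omega_eq[OF x DERIV_cheb_proj[OF x]])
  have fT: "summable (\<lambda>k. c (Suc k) * cheb_T (Suc k) x)" "f x = c 0 / 2 + (\<Sum>k. c (Suc k) * cheb_T (Suc k) x)"
    using cheb_asympD[OF f x] by (auto simp: sums_iff c_def)
  \<comment> \<open>Multiplied by \<open>x - \<xi>\<close>, the error consists of the differentiated
    tail for \<open>h\<close>, the undifferentiated tail for \<open>f\<close> and the boundary terms
    at the cut-off.\<close>
  have err: "(x - \<xi>) * (deriv_Omega f x - deriv_Omega (cheb_proj f n) x)
      = (\<Sum>k. e (k + n) * cheb_dT (Suc (k + n)) x) - (\<Sum>k. c (Suc (k + n)) * cheb_T (Suc (k + n)) x)
        - (c n * cheb_dT (Suc n) x - c (Suc n) * cheb_dT n x) / 2" for n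
  proof -
    have "(x - \<xi>) * deriv_Omega f x = H - f x" using ne' by (simp add: df)
    moreover have "(x - \<xi>) * deriv_Omega (cheb_proj f n) x
        = (\<Sum>k<n. e k * cheb_dT (Suc k) x) + (c n * cheb_dT (Suc n) x - c (Suc n) * cheb_dT n x) / 2
          - (c 0 / 2 + (\<Sum>k<n. c (Suc k) * cheb_T (Suc k) x))"
      using cheb_partial_mult_deriv[of x \<xi> c n] by (simp add: dn e_def del: cheb_dT.simps)
    moreover have "H = (\<Sum>k. e (k + n) * cheb_dT (Suc (k + n)) x) + (\<Sum>k<n. e k * cheb_dT (Suc k) x)"
      unfolding H_def by (rule suminf_split_initial_segment[OF Dh(2)])
    moreover have "f x = c 0 / 2 + ((\<Sum>k. c (Suc (k + n)) * cheb_T (Suc (k + n)) x) + (\<Sum>k<n. c (Suc k) * cheb_T (Suc k) x))"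
      using fT suminf_split_initial_segment[OF fT(1), of n] by simp
    ultimately show ?thesis by (simp add: right_diff_distrib del: cheb_dT.simps)
  qed
  have "\<bar>deriv_error f x n\<bar> \<le> (D / (g - 1) + C / g + C) / \<bar>x - \<xi>\<bar> * real n powr (1 - g)" if n: "n \<ge> 1" for n
  proof -
    have 1: "\<bar>\<Sum>k. e (k + n) * cheb_dT (Suc (k + n)) x\<bar> \<le> D / (g - 1) * real n powr (1 - g)"
    proof (rule suminf_tail_abs_le[OF g _ n, of "\<lambda>k. e k * cheb_dT (Suc k) x"])
      show "\<bar>e k * cheb_dT (Suc k) x\<bar> \<le> D * real (Suc k) powr (- g)" for k
        unfolding abs_mult by (rule order_trans[OF mult_left_mono[OF abs_cheb_dT_le[OF x]] eb]) simp
    qed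
    have "\<bar>\<Sum>k. c (Suc (k + n)) * cheb_T (Suc (k + n)) x\<bar> \<le> C / (g + 1 - 1) * real n powr (1 - (g + 1))"
    proof (rule suminf_tail_abs_le[OF _ _ n, of "g + 1" "\<lambda>k. c (Suc k) * cheb_T (Suc k) x"])
      fix k
      have "\<bar>c (Suc k) * cheb_T (Suc k) x\<bar> \<le> \<bar>c (Suc k)\<bar>"
        unfolding abs_mult by (rule mult_left_le) (auto simp: abs_cheb_T_le)
      also have "\<dots> \<le> C * real (Suc k) powr (- (g + 1))"
        using C g by (intro order_trans[OF C(2) mult_powr_real_antimono]) auto
      finally show "\<bar>c (Suc k) * cheb_T (Suc k) x\<bar> \<le> C * real (Suc k) powr (- (g + 1))" .
    qed (use g in simp)
    also have "\<dots> = C / g * real n powr (- g)" by simp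
    also have "\<dots> \<le> C / g * real n powr (1 - g)"
      using C g n by (intro mult_left_mono powr_mono) auto
    finally have 2: "\<bar>\<Sum>k. c (Suc (k + n)) * cheb_T (Suc (k + n)) x\<bar> \<le> C / g * real n powr (1 - g)" .
    \<comment> \<open>A boundary term is a coefficient of order \<open>- (g + 1)\<close> times the
      Markov factor, which gives the order \<open>1 - g\<close>.\<close>
    have 3: "\<bar>c i * cheb_dT j x\<bar> \<le> C * real n powr (1 - g)" if "n \<le> i" "j \<le> Suc n" for i j
    proof -
      have "\<bar>c i * cheb_dT j x\<bar> \<le> (C * real (Suc n) powr (- (g + 1))) * (real (Suc n))\<^sup>2"
        unfolding abs_mult
      proof (rule mult_mono)
        show "\<bar>c i\<bar> \<le> C * real (Suc n) powr (- (g + 1))"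
          using C g that by (intro order_trans[OF C(2) mult_powr_real_antimono]) auto
        have "(real j)\<^sup>2 \<le> (real (Suc n))\<^sup>2" using that by (intro power_mono) auto
        then show "\<bar>cheb_dT j x\<bar> \<le> (real (Suc n))\<^sup>2" using abs_cheb_dT_le[OF x, of j] by linarith
      qed (use C in auto)
      also have "\<dots> = C * ((real (Suc n))\<^sup>2 * real (Suc n) powr (- (g + 1)))" by (simp only: mult_ac)
      also have "\<dots> = C * real (Suc n) powr (- (g - 1))" unfolding Suc_power_mult_powr ..
      also have "\<dots> \<le> C * real n powr (- (g - 1))"
        using C g n by (intro mult_powr_real_antimono) auto
      finally show ?thesis by simp
    qed
    have 4: "\<bar>c n * cheb_dT (Suc n) x\<bar> \<le> C * real n powr (1 - g)" "\<bar>c (Suc n) * cheb_dT n x\<bar> \<le> C * real n powr (1 - g)"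
      by (rule 3; simp)+
    have "\<bar>x - \<xi>\<bar> * deriv_error f x n = \<bar>(x - \<xi>) * (deriv_Omega f x - deriv_Omega (cheb_proj f n) x)\<bar>"
      by (simp add: deriv_error_def abs_mult)
    also have "\<dots> \<le> D / (g - 1) * real n powr (1 - g) + C / g * real n powr (1 - g) + C * real n powr (1 - g)"
    proof -
      have "\<bar>a - b - (u - w) / 2\<bar> \<le> A + B + M" if "\<bar>a\<bar> \<le> A" "\<bar>b\<bar> \<le> B" "\<bar>u\<bar> \<le> M" "\<bar>w\<bar> \<le> M"
        for a b u w A B M :: real
        using that by (simp add: abs_le_iff field_simps)
      from this[OF 1 2 4] show ?thesis unfolding err .
    qed
    also have "\<dots> = (D / (g - 1) + C / g + C) * real n powr (1 - g)" by (simp only: distrib_right)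
    finally have "\<bar>x - \<xi>\<bar> * deriv_error f x n \<le> (D / (g - 1) + C / g + C) * real n powr (1 - g)" .
    then have "deriv_error f x n \<le> ((D / (g - 1) + C / g + C) * real n powr (1 - g)) / \<bar>x - \<xi>\<bar>"
      using ne' by (subst pos_le_divide_eq) (auto simp: mult.commute)
    then show ?thesis by (simp add: deriv_error_def)
  qed
  then show ?thesis by (rule bigo_powrI)
qed

section \<open>The model function\<close>

lemma twist_0 [simp]: "twist 0 \<beta> = \<beta>"
  by (simp add: twist_def fun_eq_iff)

lemma fourier_twist: "fourier (twist \<psi> \<beta>) t = fourier \<beta> (t + \<psi>)"
  unfolding fourier_def
  by (intro infsum_cong) (simp add: twist_def mult.assoc cis_mult distrib_left add.commute)

lemma fourier_even_ext:
  assumes s: "(\<lambda>k. norm (even_ext b k)) summable_on UNIV"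
    and S: "(\<lambda>n. 2 * b (Suc n) * cos (real (Suc n) * t)) sums (S - b 0)"
  shows "fourier (even_ext b) t = of_real S"
proof -
  have "(\<lambda>k. even_ext b k * cis (of_int k * t)) summable_on UNIV"
    by (rule abs_summable_summable[OF fourier_terms_summable[OF s]])
  from infsum_int_sums[OF this]
  have "(\<lambda>n. even_ext b (int n + 1) * cis (of_int (int n + 1) * t) + even_ext b (- (int n + 1)) * cis (of_int (- (int n + 1)) * t))
     sums (fourier (even_ext b) t - of_real (b 0))"
    by (simp add: fourier_def even_ext_def)
  moreover have "even_ext b (int n + 1) * cis (of_int (int n + 1) * t) + even_ext b (- (int n + 1)) * cis (of_int (- (int n + 1)) * t)
     = of_real (2 * b (Suc n) * cos (real (Suc n) * t))" for n
  proof -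
    have "nat \<bar>int n + 1\<bar> = Suc n" "nat \<bar>- (int n + 1)\<bar> = Suc n"
      "of_int (int n + 1) * t = real (Suc n) * t" "of_int (- (int n + 1)) * t = - (real (Suc n) * t)"
      by (auto simp: algebra_simps)
    then show ?thesis
      unfolding even_ext_def by (simp only:) (simp add: complex_eq_iff del: of_nat_Suc)
  qed
  ultimately have "(\<lambda>n. of_real (2 * b (Suc n) * cos (real (Suc n) * t)) :: complex) sums (fourier (even_ext b) t - of_real (b 0))"
    by (simp only:)
  moreover have "(\<lambda>n. of_real (2 * b (Suc n) * cos (real (Suc n) * t)) :: complex) sums (of_real (S - b 0))"
    by (rule sums_of_real[OF S])
  ultimately have "fourier (even_ext b) t - of_real (b 0) = of_real (S - b 0)"
    by (rule sums_unique2)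
  then show ?thesis by simp
qed

lemma regular_sinpow_coeff: "g > 0 \<Longrightarrow> \<exists>C. regular C (g + 1) (even_ext (sinpow_coeff g))"
proof -
  assume g: "g > 0"
  obtain C where C: "\<And>n. \<bar>sinpow_coeff g n\<bar> \<le> C * (1 + real n) powr (- (g + 1))"
     "\<And>n. \<bar>sinpow_coeff g (Suc n) - sinpow_coeff g n\<bar> \<le> C * (1 + real n) powr (- (g + 2))"
    using sinpow_coeff_decay_diff[OF g] by blast
  have e: "- (g + 2) = - (g + 1) - 1" by simp
  show ?thesis
    using regular_even_ext[OF C(1) C(2)[unfolded e]] g by simp
qed

lemma fourier_sinpow_coeff:
  assumes "g > 1"
  shows "fourier (twist \<psi> (even_ext (sinpow_coeff g))) t = of_real (sinpow_series g (t + \<psi>))"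
proof -
  obtain C where "regular C (g + 1) (even_ext (sinpow_coeff g))" using regular_sinpow_coeff[of g] assms by auto
  then have "(\<lambda>k. norm (even_ext (sinpow_coeff g) k)) summable_on UNIV"
    using assms regular_summable[of C "g + 1"] by simp
  then show ?thesis
    unfolding fourier_twist using sinpow_series_sums[OF assms] by (intro fourier_even_ext) simp_all
qed

text \<open>The smooth factor as a two-sided series, hence the halved coefficients. It is regular
  with the exponent of the singular factors, so it can be convolved with them, and its own size is
  already of remainder order.\<close>

lemma smooth_even_ext:
  assumes G: "smooth_on Omega G" and g: "g > 1"
  shows "\<exists>C. regular C (g + 1) (even_ext (\<lambda>k. cheb_coeff G k / 2))"
    and "\<exists>D. \<forall>k. norm (even_ext (\<lambda>k. cheb_coeff G k / 2) k) \<le> D * wt k powr (- (g + 2))"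
    and "\<bar>t\<bar> \<le> pi \<Longrightarrow> fourier (even_ext (\<lambda>k. cheb_coeff G k / 2)) t = of_real (G (cos t))"
proof -
  let ?u = "\<lambda>k. cheb_coeff G k / 2"
  obtain C where C: "\<And>k. \<bar>cheb_coeff G k\<bar> \<le> C * (1 + real k) powr (- (g + 2))"
    using smooth_cheb_coeff_decay[OF G] by blast
  have C0: "0 \<le> C" using order_trans[OF abs_ge_zero C[of 0]] by simp
  have u: "\<bar>?u k\<bar> \<le> C * (1 + real k) powr (- (g + 2))" for k
    using C[of k] by simp
  have 1: "\<bar>?u k\<bar> \<le> C * (1 + real k) powr (- (g + 1))" for k
  proof -
    have "C * (1 + real k) powr (- (g + 2)) \<le> C * (1 + real k) powr (- (g + 1))"
      using C0 by (intro mult_left_mono powr_mono) auto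
    then show ?thesis using u[of k] by linarith
  qed
  have 2: "\<bar>?u (Suc k) - ?u k\<bar> \<le> C * (1 + real k) powr (- (g + 1) - 1)" for k
  proof -
    have "C * (1 + real (Suc k)) powr (- (g + 2)) \<le> C * (1 + real k) powr (- (g + 2))"
      using C0 g by (intro mult_left_mono powr_mono2') auto
    then have "\<bar>?u (Suc k) - ?u k\<bar> \<le> C * (1 + real k) powr (- (g + 2))"
      using C[of k] C[of "Suc k"] by (simp only: abs_le_iff) linarith
    moreover have "- (g + 2) = - (g + 1) - 1" by simp
    ultimately show ?thesis by (simp only:)
  qed
  show reg: "\<exists>C. regular C (g + 1) (even_ext ?u)"
    using regular_even_ext[OF 1 2] g by simp
  show "\<exists>D. \<forall>k. norm (even_ext ?u k) \<le> D * wt k powr (- (g + 2))"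
  proof (intro exI[of _ C] allI)
    show "norm (even_ext ?u k) \<le> C * wt k powr (- (g + 2))" for k
      using u[of "nat \<bar>k\<bar>"] by (simp add: even_ext_def wt_def)
  qed
  show "fourier (even_ext ?u) t = of_real (G (cos t))" if t: "\<bar>t\<bar> \<le> pi"
  proof (rule fourier_even_ext)
    show "(\<lambda>k. norm (even_ext ?u k)) summable_on UNIV"
      using reg g regular_summable by fastforce
    have "summable (\<lambda>k. \<bar>cheb_coeff G k\<bar>)"
    proof (rule summable_comparison_test'[where N = 0])
      show "summable (\<lambda>k. C * (1 + real k) powr (- (g + 2)))"
        using g by (intro summable_mult summable_shift_powr) simp
    qed (use C in simp)
    then have "(\<lambda>k. cheb_coeff G (Suc k) * cos (real (Suc k) * \<bar>t\<bar>)) sums (G (cos \<bar>t\<bar>) - cheb_coeff G 0 / 2)"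
      using t by (intro cheb_series smooth_on_continuous G) auto
    moreover have "cos (real (Suc k) * \<bar>t\<bar>) = cos (real (Suc k) * t)" "cos \<bar>t\<bar> = cos t" for k
      by (auto simp: abs_if)
    ultimately show "(\<lambda>n. 2 * (cheb_coeff G (Suc n) / 2) * cos (real (Suc n) * t)) sums (G (cos t) - cheb_coeff G 0 / 2)"
      by simp
  qed
qed

text \<open>The Fourier coefficients at \<open>m\<close> and \<open>- m\<close> add up to the
  Chebyshev coefficient. In this pairing the twists by \<phi> and \<open>- \<phi>\<close> both turn
  into 2 cos (m \<phi>), so the leading constant is 2 Re (a1 + a2).\<close>

lemma cheb_asymp_fourier:
  assumes g: "g > 1"
    and F: "\<And>t. \<bar>t\<bar> \<le> pi \<Longrightarrow> fourier z t = of_real (f (cos t))"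
    and z: "\<And>k. norm (z k - (a1 * twist (- \<phi>) (even_ext (sinpow_coeff g)) k + a2 * twist \<phi> (even_ext (sinpow_coeff g)) k)) \<le> E * wt k powr (- (g + 2))"
  shows "cheb_asymp g \<phi> f"
proof -
  let ?b = "even_ext (sinpow_coeff g)"
  obtain B where B: "regular B (g + 1) ?b" using regular_sinpow_coeff[of g] g by auto
  have E: "0 \<le> E" using order_trans[OF norm_ge_zero z[of 0]] by (simp add: wt_def)
  have zs: "(\<lambda>k. norm (z k)) summable_on UNIV"
  proof (rule abs_summable_wt[of "g + 1"])
    fix k
    have "norm (z k) \<le> norm (a1 * twist (- \<phi>) ?b k + a2 * twist \<phi> ?b k) + E * wt k powr (- (g + 2))"
      using z[of k] norm_triangle_sub[of "z k"] by (meson add_left_mono order_trans)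
    also have "norm (a1 * twist (- \<phi>) ?b k + a2 * twist \<phi> ?b k) \<le> norm a1 * norm (?b k) + norm a2 * norm (?b k)"
      by (rule order_trans[OF norm_triangle_ineq]) (simp add: norm_mult)
    also have "\<dots> \<le> norm a1 * (B * wt k powr (- (g + 1))) + norm a2 * (B * wt k powr (- (g + 1)))"
      using B by (intro add_mono mult_left_mono) (auto simp: regular_def)
    also have "E * wt k powr (- (g + 2)) \<le> E * wt k powr (- (g + 1))"
      using E wt_ge_1[of k] by (intro mult_left_mono powr_mono) auto
    finally show "norm (z k) \<le> (norm a1 * B + norm a2 * B + E) * wt k powr (- (g + 1))"
      by (simp add: algebra_simps)
  qed (use g in simp)
  \<comment> \<open>At \<open>m = 0\<close> the pair counts \<open>z 0\<close> twice, hence the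
    factor 1/2.\<close>
  define D where "D m = (if m = 0 then 1 / 2 else 1) * Re (z (int m) + z (- int m))" for m
  have S: "(\<lambda>n. D (Suc n) * cos (real (Suc n) * t)) sums (f (cos t) - D 0)" if t: "\<bar>t\<bar> \<le> pi" for t
  proof -
    \<comment> \<open>Averaging the representations at \<open>t\<close> and \<open>- t\<close> of
      the even function removes the sines, with no symmetry of \<open>z\<close> required.\<close>
    have 1: "((\<lambda>k. z k * cis (of_int k * t)) has_sum of_real (f (cos t))) UNIV"
      using has_sum_infsum[OF abs_summable_summable[OF fourier_terms_summable[OF zs, of t]]] F[OF t] by (simp add: fourier_def)
    have 2: "((\<lambda>k. z k * cis (of_int k * (- t))) has_sum of_real (f (cos t))) UNIV"
      using has_sum_infsum[OF abs_summable_summable[OF fourier_terms_summable[OF zs, of "- t"]]] F[of "- t"] t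
      by (simp add: fourier_def)
    have "((\<lambda>k. (1/2) * (z k * cis (of_int k * t) + z k * cis (of_int k * (- t)))) has_sum
        (1/2) * (of_real (f (cos t)) + of_real (f (cos t)))) UNIV"
      by (intro has_sum_cmult_right has_sum_add 1 2)
    moreover have "(1/2) * (z k * cis (of_int k * t) + z k * cis (of_int k * (- t))) = z k * of_real (cos (of_int k * t))" for k
      by (simp add: complex_eq_iff)
    ultimately have "((\<lambda>k. z k * of_real (cos (of_int k * t))) has_sum of_real (f (cos t))) UNIV"
      by (simp only:) simp
    then have "(\<lambda>k. z k * of_real (cos (of_int k * t))) summable_on UNIV"
       "infsum (\<lambda>k. z k * of_real (cos (of_int k * t))) UNIV = of_real (f (cos t))"
      by (auto simp: summable_on_def infsumI)
    note sums_Re[OF infsum_int_sums[OF this(1), unfolded this(2)]]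
    moreover have "cos (of_int (int n + 1) * t) = cos (real (Suc n) * t)"
      "cos (of_int (- (int n + 1)) * t) = cos (real (Suc n) * t)" for n
    proof -
      have "of_int (int n + 1) * t = real (Suc n) * t" "of_int (- (int n + 1)) * t = - (real (Suc n) * t)"
        by (auto simp: algebra_simps)
      then show "cos (of_int (int n + 1) * t) = cos (real (Suc n) * t)"
        "cos (of_int (- (int n + 1)) * t) = cos (real (Suc n) * t)" by (simp_all only: cos_minus)
    qed
    ultimately have "(\<lambda>n. Re (z (int n + 1) + z (- (int n + 1))) * cos (real (Suc n) * t)) sums (f (cos t) - Re (z 0))"
      by (simp only: flip: distrib_right) simp
    moreover have "D (Suc n) = Re (z (int n + 1) + z (- (int n + 1)))" for n
      by (simp add: D_def add.commute)
    moreover have "D 0 = Re (z 0)" by (simp add: D_def)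
    ultimately show ?thesis by simp
  qed
  have sD: "summable (\<lambda>m. \<bar>D m\<bar>)"
  proof -
    have "summable (\<lambda>n. norm (z (int n + 1)) + norm (z (- (int n + 1))))"
      by (rule sums_summable[OF infsum_int_sums[OF zs]])
    then have "summable (\<lambda>n. \<bar>D (Suc n)\<bar>)"
    proof (rule summable_comparison_test'[where N = 0])
      fix n
      have "\<bar>Re (z (int n + 1)) + Re (z (- (int n + 1)))\<bar> \<le> norm (z (int n + 1)) + norm (z (- (int n + 1)))"
        by (intro order_trans[OF abs_triangle_ineq] add_mono abs_Re_le_cmod)
      then show "norm \<bar>D (Suc n)\<bar> \<le> norm (z (int n + 1)) + norm (z (- (int n + 1)))"
        by (simp add: D_def add.commute)
    qed
    then show ?thesis by (subst (asm) summable_Suc_iff[where f = "\<lambda>m. \<bar>D m\<bar>"])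
  qed
  have S': "(\<lambda>m. D m * cos (real m * t)) sums f (cos t)" if "t \<in> {0..pi}" for t
    using sums_Suc_iff[where f = "\<lambda>m. D m * cos (real m * t)", of "f (cos t) - D 0"] S[of t] that by simp
  \<comment> \<open>Continuity of \<open>f\<close>, needed for the integral formula of its
    coefficients, is read off from the uniformly convergent series.\<close>
  have "continuous_on Omega (\<lambda>x. f (cos (arccos x)))"
    by (rule continuous_on_compose2[OF cos_series_continuous[OF sD S']])
      (auto intro!: continuous_intros arccos_lbound arccos_ubound)
  then have fc: "continuous_on Omega f"
    by (rule continuous_on_eq) simp
  have coeff: "cheb_coeff f m = Re (z (int m) + z (- int m))" for m
  proof -
    have "integral {0..pi} (\<lambda>t. f (cos t) * cos (real m * t)) = (if m = 0 then pi else pi / 2) * D m"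
      by (rule cos_series_coeff[OF sD S'])
    then show ?thesis
      unfolding cheb_coeff_eq_integral[OF fc] by (simp add: D_def)
  qed
  show ?thesis
    unfolding cheb_asymp_def
  proof (intro conjI ballI)
    fix x :: real assume "x \<in> Omega"
    then obtain t where t: "t \<in> {0..pi}" "x = cos t" by (rule Omega_cos)
    have "D (Suc n) = cheb_coeff f (Suc n)" "D 0 = cheb_coeff f 0 / 2" for n
      by (auto simp: D_def coeff)
    then show "(\<lambda>k. cheb_coeff f (Suc k) * cheb_T (Suc k) x) sums (f x - cheb_coeff f 0 / 2)"
      using S[of t] t by (simp only: cheb_T_cos) simp
  next
    have "\<bar>cheb_coeff f m - 2 * Re (a1 + a2) * sinpow_coeff g m * cos (real m * \<phi>)\<bar> \<le> (2 * E) * (1 + real m) powr (- (g + 2))" for m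
    proof -
      define w where "w k = a1 * twist (- \<phi>) ?b k + a2 * twist \<phi> ?b k" for k
      have "w (int m) + w (- int m) = of_real (2 * sinpow_coeff g m * cos (real m * \<phi>)) * (a1 + a2)"
        by (simp add: w_def twist_def even_ext_def complex_eq_iff algebra_simps)
      then have "cheb_coeff f m - 2 * Re (a1 + a2) * sinpow_coeff g m * cos (real m * \<phi>)
          = Re ((z (int m) - w (int m)) + (z (- int m) - w (- int m)))"
        unfolding coeff by (simp add: algebra_simps complex_eq_iff)
      also have "\<bar>\<dots>\<bar> \<le> norm (z (int m) - w (int m)) + norm (z (- int m) - w (- int m))"
        by (rule order_trans[OF abs_Re_le_cmod norm_triangle_ineq])
      also have "\<dots> \<le> E * wt (int m) powr (- (g + 2)) + E * wt (- int m) powr (- (g + 2))"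
        using z unfolding w_def by (intro add_mono)
      finally show ?thesis by (simp add: wt_def)
    qed
    then show "\<exists>A E. \<forall>k. \<bar>cheb_coeff f k - A * sinpow_coeff g k * cos (real k * \<phi>)\<bar> \<le> E * (1 + real k) powr (- (g + 2))"
      by blast
  qed
qed

text \<open>Of the two leading terms of the convolution, the multiple of the smooth coefficients is
  itself of remainder order and is absorbed.\<close>

lemma convolution_smooth:
  assumes G: "smooth_on Omega G" and g: "g > 1"
  shows "\<exists>c E. \<forall>k. norm (convolution (twist \<psi> (even_ext (sinpow_coeff g))) (even_ext (\<lambda>k. cheb_coeff G k / 2)) k - c * twist \<psi> (even_ext (sinpow_coeff g)) k)
     \<le> E * wt k powr (- (g + 2))"
proof -
  let ?x = "twist \<psi> (even_ext (sinpow_coeff g))" and ?u = "even_ext (\<lambda>k. cheb_coeff G k / 2)"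
  obtain B where B: "regular B (g + 1) (even_ext (sinpow_coeff g))" using regular_sinpow_coeff[of g] g by auto
  obtain U D where U: "regular U (g + 1) ?u" and D: "\<And>k. norm (?u k) \<le> D * wt k powr (- (g + 2))"
    using smooth_even_ext[OF G g] by blast
  obtain c d E where E: "\<And>k. norm (convolution ?x ?u k - (c * ?x k + d * ?u k)) \<le> E * wt k powr (- (g + 1) - 1)"
    using convolution_regular[OF B U, of \<psi> 0] g by auto
  have e: "- (g + 1) - 1 = - (g + 2)" by simp
  have "norm (convolution ?x ?u k - c * ?x k) \<le> (E + norm d * D) * wt k powr (- (g + 2))" for k
  proof -
    have "norm (convolution ?x ?u k - c * ?x k) = norm ((convolution ?x ?u k - (c * ?x k + d * ?u k)) + d * ?u k)"
      by (simp add: algebra_simps)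
    also have "\<dots> \<le> E * wt k powr (- (g + 2)) + norm d * (D * wt k powr (- (g + 2)))"
      using E[unfolded e] D by (intro order_trans[OF norm_triangle_ineq] add_mono) (auto simp: norm_mult intro!: mult_left_mono)
    finally show ?thesis by (simp add: algebra_simps)
  qed
  then show ?thesis by blast
qed

lemma abs_cos_diff: "\<bar>cos t - cos \<phi>\<bar> = 2 * \<bar>sin ((t - \<phi>) / 2)\<bar> * \<bar>sin ((t + \<phi>) / 2)\<bar>" for t \<phi> :: real
  by (simp add: cos_diff_cos abs_mult) (metis abs_minus_cancel minus_diff_eq minus_divide_left mult.commute sin_minus)

text \<open>The two sine factors are convolved first, giving \<open>p * X + q * Y\<close> plus a
  remainder \<open>W\<close>; convolution with the smooth factor preserves both phases up to
  constants and keeps \<open>W\<close> at remainder order.\<close>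

lemma cheb_asymp_interior_singularity:
  assumes g: "g > 1" and G: "smooth_on Omega G" and \<phi>: "0 \<le> \<phi>" "\<phi> \<le> pi"
    and f: "\<And>x. x \<in> Omega \<Longrightarrow> f x = \<bar>x - cos \<phi>\<bar> powr g * G x"
  shows "cheb_asymp g \<phi> f"
proof -
  define X Y U where "X = twist (- \<phi>) (even_ext (sinpow_coeff g))" and "Y = twist \<phi> (even_ext (sinpow_coeff g))" and "U = even_ext (\<lambda>k. cheb_coeff G k / 2)"
  obtain c where c: "c \<noteq> 0" "\<And>t. \<bar>t\<bar> \<le> 2 * pi \<Longrightarrow> sinpow_series g t = c * \<bar>sin (t / 2)\<bar> powr g"
    using sinpow_series_eq[OF g] by blast
  \<comment> \<open>Each sine power equals its series divided by \<open>c\<close>, and the factor 2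
    in the product formula for |cos t - cos \<phi>| contributes \<open>2 powr g\<close>.\<close>
  define \<mu> where "\<mu> = complex_of_real (2 powr g / c\<^sup>2)"
  obtain B where B: "regular B (g + 1) (even_ext (sinpow_coeff g))" using regular_sinpow_coeff[of g] g by auto
  obtain U' D where U: "regular U' (g + 1) U" and D: "\<And>k. norm (U k) \<le> D * wt k powr (- (g + 2))"
    using smooth_even_ext[OF G g] unfolding U_def by blast
  have sX: "(\<lambda>k. norm (X k)) summable_on UNIV" and sY: "(\<lambda>k. norm (Y k)) summable_on UNIV"
    and sU: "(\<lambda>k. norm (U k)) summable_on UNIV"
    using regular_summable[OF B] regular_summable[OF U] g by (auto simp: X_def Y_def)
  obtain p q R where R: "\<And>k. norm (convolution X Y k - (p * X k + q * Y k)) \<le> R * wt k powr (- (g + 1) - 1)"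
    using convolution_regular[OF B B, of "- \<phi>" \<phi>] g unfolding X_def Y_def by auto
  have e: "- (g + 1) - 1 = - (g + 2)" by simp
  define W where "W k = convolution X Y k - (p * X k + q * Y k)" for k
  have W: "norm (W k) \<le> R * wt k powr (- (g + 2))" for k
    using R[unfolded e] by (simp add: W_def)
  have sW: "(\<lambda>k. norm (W k)) summable_on UNIV"
    by (rule abs_summable_wt[OF _ W]) (use g in simp)
  have sums: "(\<lambda>k. norm (p * X k)) summable_on UNIV" "(\<lambda>k. norm (q * Y k)) summable_on UNIV"
    unfolding norm_mult by (rule summable_on_cmult_right sX sY)+
  have spq: "(\<lambda>k. norm (p * X k + q * Y k)) summable_on UNIV"
    by (rule Infinite_Sum.abs_summable_on_comparison_test'[OF summable_on_add[OF sums]]) (rule norm_triangle_ineq)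
  have sV: "(\<lambda>k. norm (convolution X Y k)) summable_on UNIV"
  proof -
    have "norm (convolution X Y k) \<le> norm (p * X k + q * Y k) + norm (W k)" for k
      using norm_triangle_ineq[of "p * X k + q * Y k" "W k"] by (simp add: W_def)
    then show ?thesis
      by (intro Infinite_Sum.abs_summable_on_comparison_test'[OF summable_on_add[OF spq sW]])
  qed
  obtain cX KX where KX: "\<And>k. norm (convolution X U k - cX * X k) \<le> KX * wt k powr (- (g + 2))"
    using convolution_smooth[OF G g] unfolding X_def U_def by blast
  obtain cY KY where KY: "\<And>k. norm (convolution Y U k - cY * Y k) \<le> KY * wt k powr (- (g + 2))"
    using convolution_smooth[OF G g] unfolding Y_def U_def by blast
  obtain KW where KW: "\<And>k. norm (convolution W U k) \<le> KW * wt k powr (- (g + 2))"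
    using convolution_bound[OF _ order_refl W D] g by auto
  have lin: "convolution (convolution X Y) U k = p * convolution X U k + q * convolution Y U k + convolution W U k" for k
  proof -
    have "convolution (convolution X Y) U k = convolution (\<lambda>k. (p * X k + q * Y k) + W k) U k"
      by (simp add: W_def)
    then show ?thesis
      by (simp only: convolution_add_left[OF spq sW sU] convolution_add_left[OF sums sU] convolution_cmult_left)
  qed
  define z where "z k = \<mu> * convolution (convolution X Y) U k" for k
  show ?thesis
  proof (rule cheb_asymp_fourier[OF g])
    fix t :: real assume t: "\<bar>t\<bar> \<le> pi"
    have "fourier z t = \<mu> * fourier (convolution (convolution X Y) U) t"
      by (simp add: fourier_def z_def mult.assoc infsum_cmult_right')
    also have "fourier (convolution (convolution X Y) U) t = (fourier X t * fourier Y t) * fourier U t"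
      by (simp add: fourier_mult[OF sV sU] fourier_mult[OF sX sY])
    also have "\<dots> = of_real (sinpow_series g (t - \<phi>) * sinpow_series g (t + \<phi>) * G (cos t))"
      using smooth_even_ext(3)[OF G g t] by (simp add: X_def Y_def U_def fourier_sinpow_coeff[OF g])
    also have "sinpow_series g (t - \<phi>) * sinpow_series g (t + \<phi>) = c\<^sup>2 * (\<bar>sin ((t - \<phi>) / 2)\<bar> * \<bar>sin ((t + \<phi>) / 2)\<bar>) powr g"
      using t \<phi> by (simp add: c(2) powr_mult power2_eq_square)
    finally have "fourier z t = of_real (2 powr g * (\<bar>sin ((t - \<phi>) / 2)\<bar> * \<bar>sin ((t + \<phi>) / 2)\<bar>) powr g * G (cos t))"
      using c(1) by (simp add: \<mu>_def)
    also have "2 powr g * (\<bar>sin ((t - \<phi>) / 2)\<bar> * \<bar>sin ((t + \<phi>) / 2)\<bar>) powr g = \<bar>cos t - cos \<phi>\<bar> powr g"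
      by (simp add: abs_cos_diff powr_mult)
    finally show "fourier z t = of_real (f (cos t))" using f[of "cos t"] by simp
  next
    fix k
    have "z k - ((\<mu> * (p * cX)) * X k + (\<mu> * (q * cY)) * Y k)
      = \<mu> * (p * (convolution X U k - cX * X k) + q * (convolution Y U k - cY * Y k) + convolution W U k)"
      unfolding z_def lin by (simp add: algebra_simps)
    also have "norm \<dots> \<le> norm \<mu> * (norm p * (KX * wt k powr (- (g + 2))) + norm q * (KY * wt k powr (- (g + 2))) + KW * wt k powr (- (g + 2)))"
    proof -
      have "norm (p * (convolution X U k - cX * X k)) \<le> norm p * (KX * wt k powr (- (g + 2)))"
        "norm (q * (convolution Y U k - cY * Y k)) \<le> norm q * (KY * wt k powr (- (g + 2)))"
        unfolding norm_mult by (intro mult_left_mono KX KY norm_ge_zero)+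
      then show ?thesis
        unfolding norm_mult[of \<mu>]
        by (intro mult_left_mono order_trans[OF norm_triangle_ineq] add_mono KW norm_ge_zero)
    qed
    also have "\<dots> = (norm \<mu> * (norm p * KX + norm q * KY + KW)) * wt k powr (- (g + 2))"
      by (simp add: algebra_simps)
    finally show "norm (z k - ((\<mu> * (p * cX)) * twist (- \<phi>) (even_ext (sinpow_coeff g)) k + (\<mu> * (q * cY)) * twist \<phi> (even_ext (sinpow_coeff g)) k))
      \<le> (norm \<mu> * (norm p * KX + norm q * KY + KW)) * wt k powr (- (g + 2))"
      unfolding X_def Y_def .
  qed
qed

text \<open>For \<phi> = 0 or pi the arguments (t - \<phi>)/2 and (t + \<phi>)/2 differ by 0 or pi,
  so the two sines agree in absolute value and form a single power with exponent 2 \<alpha>.\<close>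

lemma cheb_asymp_endpoint_singularity:
  assumes \<alpha>: "\<alpha> > 1" and G: "smooth_on Omega G" and \<phi>: "\<phi> = 0 \<or> \<phi> = pi"
    and f: "\<And>x. x \<in> Omega \<Longrightarrow> f x = \<bar>x - cos \<phi>\<bar> powr \<alpha> * G x"
  shows "cheb_asymp (2 * \<alpha>) \<phi> f"
proof -
  define g where "g = 2 * \<alpha>"
  have g: "g > 1" using \<alpha> by (simp add: g_def)
  define X U where "X = twist (- \<phi>) (even_ext (sinpow_coeff g))" and "U = even_ext (\<lambda>k. cheb_coeff G k / 2)"
  obtain c where c: "c \<noteq> 0" "\<And>t. \<bar>t\<bar> \<le> 2 * pi \<Longrightarrow> sinpow_series g t = c * \<bar>sin (t / 2)\<bar> powr g"
    using sinpow_series_eq[OF g] by blast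
  \<comment> \<open>Only one series is used now, so a single \<open>c\<close> is divided out, while
    the factor 2 still carries the exponent \<alpha>.\<close>
  define \<mu> where "\<mu> = complex_of_real (2 powr \<alpha> / c)"
  obtain B where B: "regular B (g + 1) (even_ext (sinpow_coeff g))" using regular_sinpow_coeff[of g] g by auto
  obtain U' where U: "regular U' (g + 1) U"
    using smooth_even_ext(1)[OF G g] unfolding U_def by blast
  have sX: "(\<lambda>k. norm (X k)) summable_on UNIV" and sU: "(\<lambda>k. norm (U k)) summable_on UNIV"
    using regular_summable[OF B] regular_summable[OF U] g by (auto simp: X_def)
  obtain cX KX where KX: "\<And>k. norm (convolution X U k - cX * X k) \<le> KX * wt k powr (- (g + 2))"
    using convolution_smooth[OF G g] unfolding X_def U_def by blast
  define z where "z k = \<mu> * convolution X U k" for k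
  have "cheb_asymp g \<phi> f"
  proof (rule cheb_asymp_fourier[OF g])
    fix t :: real assume t: "\<bar>t\<bar> \<le> pi"
    have "fourier z t = \<mu> * fourier (convolution X U) t"
      by (simp add: fourier_def z_def mult.assoc infsum_cmult_right')
    also have "fourier (convolution X U) t = fourier X t * fourier U t"
      by (simp add: fourier_mult[OF sX sU])
    also have "\<dots> = of_real (sinpow_series g (t - \<phi>) * G (cos t))"
      using smooth_even_ext(3)[OF G g t] by (simp add: X_def U_def fourier_sinpow_coeff[OF g])
    also have "sinpow_series g (t - \<phi>) = c * (\<bar>sin ((t - \<phi>) / 2)\<bar> * \<bar>sin ((t - \<phi>) / 2)\<bar>) powr \<alpha>"
    proof -
      have "\<bar>t - \<phi>\<bar> \<le> 2 * pi" using t \<phi> by auto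
      moreover have "s powr g = (s * s) powr \<alpha>" if "s \<ge> 0" for s :: real
        using that by (simp add: g_def powr_mult flip: powr_add)
      ultimately show ?thesis by (simp add: c(2))
    qed
    finally have "fourier z t = of_real (2 powr \<alpha> * (\<bar>sin ((t - \<phi>) / 2)\<bar> * \<bar>sin ((t - \<phi>) / 2)\<bar>) powr \<alpha> * G (cos t))"
      using c(1) by (simp add: \<mu>_def)
    also have "2 powr \<alpha> * (\<bar>sin ((t - \<phi>) / 2)\<bar> * \<bar>sin ((t - \<phi>) / 2)\<bar>) powr \<alpha> = \<bar>cos t - cos \<phi>\<bar> powr \<alpha>"
    proof -
      have "\<bar>sin ((t - \<phi>) / 2)\<bar> = \<bar>sin ((t + \<phi>) / 2)\<bar>"
      proof (cases "\<phi> = 0")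
        case False
        then have "sin ((t + \<phi>) / 2) = sin ((t - \<phi>) / 2 + pi)" using \<phi> by (simp add: field_simps)
        then show ?thesis by simp
      qed simp
      moreover have "2 powr \<alpha> * (a * a) powr \<alpha> = (2 * a * a) powr \<alpha>" if "a \<ge> 0" for a :: real
        using that by (simp add: powr_mult)
      ultimately show ?thesis unfolding abs_cos_diff by (metis abs_ge_zero)
    qed
    finally show "fourier z t = of_real (f (cos t))" using f[of "cos t"] by simp
  next
    fix k
    \<comment> \<open>With only one singular factor, the second phase is given the coefficient
      0.\<close>
    have "z k - ((\<mu> * cX) * X k + 0 * twist \<phi> (even_ext (sinpow_coeff g)) k) = \<mu> * (convolution X U k - cX * X k)"
      unfolding z_def by (simp add: algebra_simps)
    also have "norm \<dots> \<le> norm \<mu> * (KX * wt k powr (- (g + 2)))"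
      unfolding norm_mult by (intro mult_left_mono KX) simp
    finally show "norm (z k - ((\<mu> * cX) * twist (- \<phi>) (even_ext (sinpow_coeff g)) k + 0 * twist \<phi> (even_ext (sinpow_coeff g)) k))
      \<le> (norm \<mu> * KX) * wt k powr (- (g + 2))"
      unfolding X_def by (simp add: mult.assoc)
  qed
  then show ?thesis by (simp add: g_def)
qed

theorem theorem3p3:
  fixes \<xi> \<alpha> :: real and f g :: "real \<Rightarrow> real"
  assumes "model_function \<xi> \<alpha> g f"
    and "\<alpha> > 1"
  shows "(\<xi> \<in> {-1<..<1} \<longrightarrow>
            (\<forall>x\<in>{-1<..<1}. deriv_error f x \<in> O(\<lambda>n. real n powr (-\<alpha>))) \<and>
            (\<forall>x\<in>{-1, 1}. deriv_error f x \<in> O(\<lambda>n. real n powr (1 - \<alpha>)))) \<and>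
         (\<xi> \<in> {-1, 1} \<longrightarrow>
            (\<forall>x\<in>{-1<..<1}. deriv_error f x \<in> O(\<lambda>n. real n powr (-2 * \<alpha>))) \<and>
            deriv_error f (-\<xi>) \<in> O(\<lambda>n. real n powr (1 - 2 * \<alpha>)) \<and>
            deriv_error f \<xi> \<in> O(\<lambda>n. real n powr (2 - 2 * \<alpha>)))"
proof -
  define \<phi> where "\<phi> = arccos \<xi>"
  have \<xi>: "\<xi> \<in> Omega" and G: "smooth_on Omega g"
    and f: "\<And>x. x \<in> Omega \<Longrightarrow> f x = \<bar>x - \<xi>\<bar> powr \<alpha> * g x"
    using assms(1) by (auto simp: model_function_def)
  have \<phi>: "0 \<le> \<phi>" "\<phi> \<le> pi" "cos \<phi> = \<xi>"
    using \<xi> by (auto simp: \<phi>_def intro: arccos_lbound arccos_ubound)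
  show ?thesis
  proof (intro conjI impI ballI)
    have *: "cheb_asymp \<alpha> \<phi> f"
      using assms(2) G \<phi> f by (intro cheb_asymp_interior_singularity) auto
    show "deriv_error f x \<in> O(\<lambda>n. real n powr (-\<alpha>))" if "x \<in> {-1<..<1}" for x
      using that by (intro deriv_error_interior[OF * assms(2)]) auto
    show "deriv_error f x \<in> O(\<lambda>n. real n powr (1 - \<alpha>))" if "\<xi> \<in> {-1<..<1}" "x \<in> {-1, 1}" for x
      using that \<phi> by (intro deriv_error_endpoint_away[OF * assms(2)]) auto
  next
    assume \<xi>1: "\<xi> \<in> {-1, 1}"
    then have "\<phi> = 0 \<or> \<phi> = pi" by (auto simp: \<phi>_def)
    then have *: "cheb_asymp (2 * \<alpha>) \<phi> f"
      using assms(2) G \<phi> f by (intro cheb_asymp_endpoint_singularity) auto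
    have 2: "2 * \<alpha> > 2" "2 * \<alpha> > 1" using assms(2) by auto
    show "deriv_error f x \<in> O(\<lambda>n. real n powr (-2 * \<alpha>))" if "x \<in> {-1<..<1}" for x
      using deriv_error_interior[OF * 2(2), of x] that by simp
    show "deriv_error f (-\<xi>) \<in> O(\<lambda>n. real n powr (1 - 2 * \<alpha>))"
      \<comment> \<open>The opposite endpoint differs from the singular point
        \<open>cos \<phi> = \<xi>\<close> because \<xi> is nonzero.\<close>
      using \<xi>1 \<phi> by (intro deriv_error_endpoint_away[OF * 2(2)]) auto
    show "deriv_error f \<xi> \<in> O(\<lambda>n. real n powr (2 - 2 * \<alpha>))"
      by (rule deriv_error_endpoint[OF * 2(1) \<xi>])
  qed
qed

end
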